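(* Let $\Omega=[0,1]^2$, $p\in[1,\infty)$, $$K_2=\left\{\begin{pmatrix}1&0\\0&0\end{pmatrix},\begin{pmatrix}-1&0\\0&0\end{pmatrix}\right\},$$ and let $F\in K_2^{(lc)}\setminus K_2=\left\{\begin{pmatrix}\mu&0\\0&0\end{pmatrix}:|\mu|<1\right\}$. For $\epsilon>0$ let $$E_\epsilon^{(p)}(u):=\int_\Omega \operatorname{dist}^p(\nabla u,K_2)\,dx+\epsilon\|D^2u\|_{TV},\qquad E_\epsilon^{(p)}(F):=\inf_{u\in\mathcal A_F^p}E_\epsilon^{(p)}(u),$$ where $$\mathcal A_F^p:=\{u\in W^{1,p}_{loc}(\mathbb R^2;\mathbb R^2):\ u(x)=Fx+b\text{ in }\mathbb R^2\setminus\Omega\text{ for some }b\in\mathbb R^2\}.$$ Then there exist constants $0<c\le C$, depending on $p$, $F$ and $K_2$, such that for every $\epsilon\in(0,1)$ $$c\,\epsilon^{\frac{p}{p+1}}\le E_\epsilon^{(p)}(F)\le C\,\epsilon^{\frac{p}{p+1}}.$$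
   Context: $\|D^2u\|_{TV}$ is the total variation on $(0,1)^2$ of the distributional second derivative of $u$ (equal to $+\infty$ if $\nabla u$ is not of bounded variation in $(0,1)^2$). $\operatorname{dist}(\cdot,K)$ is the Euclidean (Frobenius) distance to $K$ in matrix space. For $K\subset\mathbb R^{n\times m}$ the lamination convex hull is $K^{(lc)}=\bigcup_{j\ge0}K^{(j)}$, with $K^{(0)}=K$ and $K^{(j+1)}=K^{(j)}\cup\{\lambda A+(1-\lambda)B:\ A,B\in K^{(j)},\ \operatorname{rank}(A-B)=1,\ \lambda\in[0,1]\}$. *)

theory Defs
  imports "HOL-Analysis.Analysis"
begin

text \<open>Matrices with \<open>n\<close> rows and \<open>m\<close> columns have type \<open>real^'m^'n\<close>.  The norm of this type
  is the Frobenius norm.\<close>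

primrec lam_step :: "(real^'m^'n) set \<Rightarrow> nat \<Rightarrow> (real^'m^'n) set" where
  "lam_step K 0 = K"
| "lam_step K (Suc j) = lam_step K j \<union>
     {l *\<^sub>R A + (1 - l) *\<^sub>R B | l A B.
        A \<in> lam_step K j \<and> B \<in> lam_step K j \<and> rank (A - B) = 1 \<and> 0 \<le> l \<and> l \<le> 1}"

definition lam_hull :: "(real^'m^'n) set \<Rightarrow> (real^'m^'n) set" where
  "lam_hull K = (\<Union>j. lam_step K j)"

definition K2 :: "(real^2^2) set" where
  "K2 = {vector [vector [1, 0], vector [0, 0]], vector [vector [-1, 0], vector [0, 0]]}"

definition partial :: "'n \<Rightarrow> (real^'n \<Rightarrow> real) \<Rightarrow> real^'n \<Rightarrow> real" where
  "partial i f x = frechet_derivative f (at x) (axis i 1)"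

primrec Ck :: "nat \<Rightarrow> (real^'n \<Rightarrow> real) \<Rightarrow> bool" where
  "Ck 0 f = continuous_on UNIV f"
| "Ck (Suc k) f = ((\<forall>x. f differentiable (at x)) \<and> (\<forall>i. Ck k (partial i f)))"

definition test_functions :: "(real^'n) set \<Rightarrow> (real^'n \<Rightarrow> real) set" where
  "test_functions U = {\<phi>. (\<forall>k. Ck k \<phi>) \<and>
     compact (closure {x. \<phi> x \<noteq> 0}) \<and> closure {x. \<phi> x \<noteq> 0} \<subseteq> U}"

definition Lp_loc :: "real \<Rightarrow> (real^'n \<Rightarrow> 'b::euclidean_space) \<Rightarrow> bool" where
  "Lp_loc p f \<longleftrightarrow> f \<in> borel_measurable lebesgue \<and>
     (\<forall>K. compact K \<longrightarrow> set_integrable lebesgue K (\<lambda>x. norm (f x) powr p))"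

text \<open>\<open>G x $ i $ j\<close> is the weak derivative of the \<open>i\<close>-th component of \<open>u\<close> in direction \<open>j\<close>.\<close>

definition weak_gradient :: "(real^'n \<Rightarrow> real^'m) \<Rightarrow> (real^'n \<Rightarrow> real^'n^'m) \<Rightarrow> bool" where
  "weak_gradient u G \<longleftrightarrow> Lp_loc 1 u \<and> Lp_loc 1 G \<and>
     (\<forall>\<phi>\<in>test_functions UNIV. \<forall>i j.
        (LINT x|lebesgue. u x $ i * partial j \<phi> x) = - (LINT x|lebesgue. G x $ i $ j * \<phi> x))"

definition W1p_loc :: "real \<Rightarrow> (real^'n \<Rightarrow> real^'m) \<Rightarrow> bool" where
  "W1p_loc p u \<longleftrightarrow> Lp_loc p u \<and> (\<exists>G. weak_gradient u G \<and> Lp_loc p G)"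

text \<open>A weak gradient is unique up to null sets, so the choice of a representative does not
  affect any Lebesgue integral below.\<close>

definition grad :: "(real^'n \<Rightarrow> real^'m) \<Rightarrow> real^'n \<Rightarrow> real^'n^'m" where
  "grad u = (SOME G. weak_gradient u G)"

text \<open>The distribution \<open>D\<^sup>2 u\<close> on \<open>U\<close> as a functional on tensor-valued test functions \<open>\<Phi>\<close>, where
  \<open>\<Phi> x $ i $ j $ k\<close> is paired with the second derivative of the \<open>i\<close>-th component of \<open>u\<close> in
  directions \<open>j\<close> and \<open>k\<close>.\<close>

definition D2_pairing ::
  "(real^'n) set \<Rightarrow> (real^'n \<Rightarrow> real^'m) \<Rightarrow> (real^'n \<Rightarrow> real^'n^'n^'m) \<Rightarrow> real" where
  "D2_pairing U u \<Phi> =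
     (\<Sum>i\<in>UNIV. \<Sum>j\<in>UNIV. \<Sum>k\<in>UNIV.
        LINT x:U|lebesgue. u x $ i * partial j (partial k (\<lambda>y. \<Phi> y $ i $ j $ k)) x)"

text \<open>The total variation is the supremum over compactly supported smooth fields with pointwise
  Euclidean norm at most \<open>1\<close>; it is infinite if \<open>D\<^sup>2 u\<close> is not a finite Radon measure on \<open>U\<close>.\<close>

definition D2_TV :: "(real^'n) set \<Rightarrow> (real^'n \<Rightarrow> real^'m) \<Rightarrow> ennreal" where
  "D2_TV U u =
     (SUP \<Phi> \<in> {\<Phi>. (\<forall>i j k. (\<lambda>x. \<Phi> x $ i $ j $ k) \<in> test_functions U) \<and> (\<forall>x. norm (\<Phi> x) \<le> 1)}.
        ennreal \<bar>D2_pairing U u \<Phi>\<bar>)"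

text \<open>In \<open>real^2\<close>, \<open>cbox 0 1\<close> is the closed and \<open>box 0 1\<close> the open unit square.\<close>

definition admissible :: "real \<Rightarrow> real^2^2 \<Rightarrow> (real^2 \<Rightarrow> real^2) set" where
  "admissible p F = {u. W1p_loc p u \<and>
     (\<exists>b. AE x in lebesgue. x \<notin> cbox 0 1 \<longrightarrow> u x = F *v x + b)}"

definition energy :: "real \<Rightarrow> real \<Rightarrow> (real^2 \<Rightarrow> real^2) \<Rightarrow> ennreal" where
  "energy p \<epsilon> u =
     (\<integral>\<^sup>+x\<in>cbox 0 1. ennreal (infdist (grad u x) K2 powr p) \<partial>lebesgue)
     + ennreal \<epsilon> * D2_TV (box 0 1) u"

definition min_energy :: "real \<Rightarrow> real \<Rightarrow> real^2^2 \<Rightarrow> ennreal" where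
  "min_energy p \<epsilon> F = (INF u \<in> admissible p F. energy p \<epsilon> u)"

end

theory Submission
  imports Defs "HOL-Real_Asymp.Real_Asymp"
begin

text \<open>
  Lower bound: \<open>v x = u x $ 1 - \<mu> * x $ 1 - b\<close> vanishes outside the unit square.  Comparing a test
  function with its average over horizontal shifts of length \<open>\<delta>\<close> bounds the \<open>L\<^sup>1\<close> norm of
  \<open>\<partial>\<^sub>1 v\<close> on an interior square by \<open>\<delta>\<close> times the total variation of \<open>D\<^sup>2 u\<close> plus
  \<open>4 / \<delta>\<close> times the \<open>L\<^sup>1\<close> norm of \<open>\<partial>\<^sub>2 v\<close>.  Up to the distance of the gradient to the wells,
  the left-hand side is at least \<open>(1 - \<bar>\<mu>\<bar>) / 4\<close>; the choice of \<open>\<delta>\<close> proportional to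
  \<open>\<epsilon> powr (1 / (p + 1))\<close> then excludes a smaller energy.

  Upper bound: \<open>u\<close> has the components \<open>\<mu> * x $ 1 + w x\<close> and \<open>0\<close>, where \<open>w\<close> is the maximum of \<open>0\<close>
  and of finitely many concave functions: tents in \<open>x $ 1\<close> of width \<open>1 / (n * 2 ^ k)\<close>, lowered by a
  convex penalty that grows as \<open>x $ 2\<close> approaches \<open>0\<close> or \<open>1\<close>, so that the sawtooth refines towards
  these two edges.  Taking maxima keeps \<open>\<partial>\<^sub>1 u\<close> in the wells.  The negative part of a second
  difference of \<open>w\<close> comes from the kinks of the active concave function alone, and the positive part
  has the same integral because \<open>w\<close> has compact support; this controls \<open>D\<^sup>2 u\<close>.
\<close>

subsection \<open>Smooth functions\<close>

text \<open>The exponent comes from the scale \<open>e = \<epsilon> powr (1 / (p + 1))\<close>: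
  since \<open>\<epsilon> = e powr p * e\<close>, an elastic energy of order \<open>e powr p\<close>
  balances a total variation of order \<open>1 / e\<close>. In the lower bound, an energy below
  \<open>(c * e) powr p\<close> bounds the L1 distance of the gradient to the wells by
  \<open>2 * c * e\<close> and the total variation by \<open>c / e\<close>; both wells have a zero
  in the entry for the second partial derivative, which is therefore small, and interpolation
  propagates this to the first one. In the upper bound the coarsest sawtooth has about
  \<open>1 / e\<close> teeth. Refinement has to stop after finitely many generations, because the
  penalty slopes \<open>c k\<close> grow geometrically and enter the total variation. The strips
  beyond the last generation keep the gradient \<open>F\<close> and cost a multiple of
  \<open>\<theta> ^ N\<close>; with \<open>q ^ N\<close> comparable to \<open>e\<close> both this
  cost and the sum of the slopes stay under control. As \<open>D2_TV\<close> is defined by duality,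
  all estimates on second derivatives are made on test functions and finite differences, without a
  description of a jump set.\<close>

lemma partial_eq:
  assumes "(f has_derivative D) (at x)"
  shows "partial i f x = D (axis i 1)"
  using frechet_derivative_at[OF assms] by (simp add: partial_def)

lemma differentiable_add_partial:
  assumes "f differentiable (at x)" "g differentiable (at x)"
  shows "partial i (\<lambda>x. f x + g x) x = partial i f x + partial i g x"
  using partial_eq[OF has_derivative_add[OF assms[unfolded frechet_derivative_works]]]
  by (simp add: partial_def)

lemma differentiable_mult_partial:
  assumes "f differentiable (at x)" "g differentiable (at x)"
  shows "partial i (\<lambda>x. f x * g x) x = f x * partial i g x + partial i f x * g x"
  using partial_eq[OF has_derivative_mult[OF assms[unfolded frechet_derivative_works]]]
  by (simp add: partial_def)

lemma partial_const [simp]: "partial i (\<lambda>x. c) = (\<lambda>x. 0)"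
proof
  fix x show "partial i (\<lambda>x. c) x = 0"
    using partial_eq[OF has_derivative_const[of c "at x"], of i] by simp
qed

lemma Ck_Suc_imp: "Ck (Suc k) f \<Longrightarrow> Ck k f"
proof (induction k arbitrary: f)
  case 0
  then show ?case
    by (auto intro!: continuous_at_imp_continuous_on differentiable_imp_continuous_within)
qed auto

lemma Ck_const [simp]: "Ck k (\<lambda>x. c)"
  by (induction k arbitrary: c) auto

lemma Ck_add: "Ck k f \<Longrightarrow> Ck k g \<Longrightarrow> Ck k (\<lambda>x. f x + g x)"
proof (induction k arbitrary: f g)
  case 0 then show ?case by (simp add: continuous_on_add)
next
  case (Suc k)
  then have "partial i (\<lambda>x. f x + g x) = (\<lambda>x. partial i f x + partial i g x)" for i
    by (auto simp: fun_eq_iff differentiable_add_partial)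
  with Suc show ?case by auto
qed

lemma Ck_mult: "Ck k f \<Longrightarrow> Ck k g \<Longrightarrow> Ck k (\<lambda>x. f x * g x)"
proof (induction k arbitrary: f g)
  case 0 then show ?case by (simp add: continuous_on_mult)
next
  case (Suc k)
  then have "partial i (\<lambda>x. f x * g x) = (\<lambda>x. f x * partial i g x + partial i f x * g x)" for i
    by (auto simp: fun_eq_iff differentiable_mult_partial)
  moreover have "Ck k f" "Ck k g"
    using Suc.prems Ck_Suc_imp by blast+
  ultimately show ?case using Suc by (auto intro!: Ck_add)
qed

lemma partial_shift:
  assumes "f differentiable (at (x + a))"
  shows "partial i (\<lambda>x. f (x + a)) x = partial i f (x + a)"
proof -
  have "((\<lambda>x. f (x + a)) has_derivative (\<lambda>h. frechet_derivative f (at (x + a)) h)) (at x)"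
    by (rule has_derivative_compose[of "\<lambda>x. x + a" "\<lambda>h. h"])
      (use assms in \<open>auto intro!: derivative_eq_intros simp: frechet_derivative_works\<close>)
  from partial_eq[OF this] show ?thesis by (simp add: partial_def)
qed

lemma Ck_shift: "Ck k f \<Longrightarrow> Ck k (\<lambda>x. f (x + a))"
proof (induction k arbitrary: f)
  case 0
  have "continuous_on UNIV (\<lambda>x. x + a)" by (intro continuous_intros)
  with 0 show ?case using continuous_on_compose2[of UNIV f UNIV "\<lambda>x. x + a"] by simp
next
  case (Suc k)
  then have "partial i (\<lambda>x. f (x + a)) = (\<lambda>x. partial i f (x + a))" for i
    by (auto simp: fun_eq_iff partial_shift)
  moreover have "(\<lambda>x. f (x + a)) differentiable (at x)" for x
    using Suc.prems differentiable_chain_at[of "\<lambda>x. x + a" x f] by (auto simp: o_def)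
  ultimately show ?case using Suc by auto
qed

text \<open>The regularity clause of \<open>test_functions\<close> without the support condition;
  polynomials and other auxiliary functions without compact support also need it.\<close>

definition smooth :: "(real^'n \<Rightarrow> real) \<Rightarrow> bool" where
  "smooth f \<longleftrightarrow> (\<forall>k. Ck k f)"

lemma smooth_const [simp]: "smooth (\<lambda>x. c)"
  and smooth_add: "smooth f \<Longrightarrow> smooth g \<Longrightarrow> smooth (\<lambda>x. f x + g x)"
  and smooth_mult: "smooth f \<Longrightarrow> smooth g \<Longrightarrow> smooth (\<lambda>x. f x * g x)"
  and smooth_shift: "smooth f \<Longrightarrow> smooth (\<lambda>x. f (x + a))"
  by (auto simp: smooth_def Ck_add Ck_mult Ck_shift)

lemma smooth_cmult: "smooth f \<Longrightarrow> smooth (\<lambda>x. c * f x)"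
  by (rule smooth_mult) auto

lemma smooth_diff: "smooth f \<Longrightarrow> smooth g \<Longrightarrow> smooth (\<lambda>x. f x - g x)"
  using smooth_add[of f "\<lambda>x. -1 * g x"] smooth_cmult[of g "-1"] by simp

lemma smooth_partial: "smooth f \<Longrightarrow> smooth (partial i f)"
  unfolding smooth_def by (metis Ck.simps(2))

lemma smooth_differentiable: "smooth f \<Longrightarrow> f differentiable (at x)"
  unfolding smooth_def by (metis Ck.simps(2))

lemma smooth_continuous: "smooth f \<Longrightarrow> continuous_on S f"
  unfolding smooth_def by (metis Ck.simps(1) continuous_on_subset subset_UNIV)

lemma differentiable_has_derivative_partials:
  fixes f :: "real^'n \<Rightarrow> real"
  assumes "f differentiable (at x)"
  shows "(f has_derivative (\<lambda>h. h \<bullet> (\<chi> i. partial i f x))) (at x)"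
proof -
  let ?D = "frechet_derivative f (at x)"
  have D: "(f has_derivative ?D) (at x)" using assms by (simp add: frechet_derivative_works)
  then interpret bounded_linear ?D by (rule has_derivative_bounded_linear)
  have "?D h = h \<bullet> (\<chi> i. partial i f x)" for h
  proof -
    have "?D h = ?D (\<Sum>i\<in>UNIV. (h $ i) *\<^sub>R axis i 1)"
      using basis_expansion[of h] by (simp add: scalar_mult_eq_scaleR)
    also have "\<dots> = (\<Sum>i\<in>UNIV. h $ i * partial i f x)" 
      by (simp add: sum scaleR partial_def)
    finally show ?thesis by (simp add: inner_vec_def)
  qed
  then have "?D = (\<lambda>h. h \<bullet> (\<chi> i. partial i f x))" by auto
  with D show ?thesis by simp
qed

lemma smooth_has_derivative:
  fixes f :: "real^'n \<Rightarrow> real"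
  shows "smooth f \<Longrightarrow> (f has_derivative (\<lambda>h. h \<bullet> (\<chi> i. partial i f x))) (at x)"
  by (rule differentiable_has_derivative_partials[OF smooth_differentiable])

lemma smooth_line_derivative:
  fixes f :: "real^'n \<Rightarrow> real"
  assumes "smooth f"
  shows "((\<lambda>r. f (x + r *\<^sub>R axis j 1)) has_real_derivative partial j f (x + r *\<^sub>R axis j 1)) (at r within S)"
proof -
  have "((\<lambda>r. f (x + r *\<^sub>R axis j 1)) has_derivative
      (\<lambda>h. (h *\<^sub>R axis j 1) \<bullet> (\<chi> i. partial i f (x + r *\<^sub>R axis j 1)))) (at r within S)"
    by (rule has_derivative_compose[OF _ smooth_has_derivative[OF assms]])
      (auto intro!: derivative_eq_intros)
  then show ?thesis
    by (simp add: has_field_derivative_def inner_axis' mult.commute[of _ "partial j f _"])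
qed

lemma partial_cmult [simp]: "smooth f \<Longrightarrow> partial i (\<lambda>x. c * f x) = (\<lambda>x. c * partial i f x)"
  using differentiable_mult_partial[of "\<lambda>x. c" _ f i] smooth_differentiable
  by (auto simp: fun_eq_iff)

lemma partial_diff_smooth: "smooth f \<Longrightarrow> smooth g \<Longrightarrow> partial i (\<lambda>x. f x - g x) = (\<lambda>x. partial i f x - partial i g x)"
  using differentiable_add_partial[of f _ "\<lambda>x. -1 * g x" i] smooth_differentiable smooth_cmult[of g "-1"]
    partial_cmult[of g i "-1"]
  by (auto simp: fun_eq_iff)

lemma smooth_linear: 
  assumes "bounded_linear f" shows "smooth f"
  unfolding smooth_def
proof
  fix k show "Ck k f"
  proof (cases k)
    case 0 then show ?thesis using assms by (simp add: linear_continuous_on)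
  next
    case (Suc l)
    have d: "(f has_derivative f) (at x)" for x
      using assms bounded_linear_imp_has_derivative by blast
    have "partial i f = (\<lambda>x. f (axis i 1))" for i 
      using partial_eq[OF d] by auto
    then show ?thesis using Suc d by (auto simp: differentiable_def)
  qed
qed

text \<open>Makes the Stone-Weierstrass theorem a source of smooth approximants; multiplied by bumps
  they become test functions.\<close>

lemma smooth_real_polynomial: "real_polynomial_function f \<Longrightarrow> smooth f"
  by (induction rule: real_polynomial_function.induct)
    (auto intro: smooth_linear smooth_add smooth_mult)

subsection \<open>Test functions\<close>

lemma test_functionI:
  assumes "smooth f" "\<And>x. x \<notin> cbox a b \<Longrightarrow> f x = 0" "cbox a b \<subseteq> U"
  shows "f \<in> test_functions U"
proof -
  have "closure {x. f x \<noteq> 0} \<subseteq> cbox a b"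
    using assms(2) by (intro closure_minimal) auto
  moreover from this have "compact (closure {x. f x \<noteq> 0})"
    by (meson bounded_cbox bounded_subset closed_closure compact_eq_bounded_closed)
  ultimately show ?thesis using assms by (auto simp: test_functions_def smooth_def)
qed

lemma test_function_smooth: "f \<in> test_functions U \<Longrightarrow> smooth f"
  by (auto simp: test_functions_def smooth_def)

lemma test_function_support:
  assumes "f \<in> test_functions U" 
  obtains K where "compact K" "K \<subseteq> U" "\<And>x. x \<notin> K \<Longrightarrow> f x = 0"
proof
  show "compact (closure {x. f x \<noteq> 0})" "closure {x. f x \<noteq> 0} \<subseteq> U"
    using assms by (auto simp: test_functions_def)
  show "f x = 0" if "x \<notin> closure {x. f x \<noteq> 0}" for x
    using that closure_subset[of "{x. f x \<noteq> 0}"] by auto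
qed

lemma test_function_box:
  fixes f :: "real^'n \<Rightarrow> real"
  assumes "f \<in> test_functions U" 
  obtains a b where "\<And>x. x \<notin> cbox a b \<Longrightarrow> f x = 0"
proof -
  obtain K where "compact K" "K \<subseteq> U" "\<And>x. x \<notin> K \<Longrightarrow> f x = 0"
    using test_function_support[OF assms] by blast
  moreover obtain a b where "K \<subseteq> cbox a b"
    using bounded_subset_cbox_symmetric[OF compact_imp_bounded] calculation by metis
  ultimately show thesis using that by blast
qed

lemma test_function_mono: "f \<in> test_functions U \<Longrightarrow> f \<in> test_functions UNIV"
  by (auto simp: test_functions_def)

lemma partial_zero_open:
  assumes "open S" "x \<in> S" "\<And>y. y \<in> S \<Longrightarrow> f y = 0"
  shows "partial i f x = 0"
proof -
  have "(f has_derivative (\<lambda>h. 0)) (at x)"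
    by (rule has_derivative_transform_within_open[OF has_derivative_const assms(1,2)]) (simp add: assms(3))
  then show ?thesis by (simp add: partial_eq)
qed

lemma partial_zero_outside:
  assumes "\<And>x. x \<notin> cbox a b \<Longrightarrow> f x = 0" "x \<notin> cbox a b"
  shows "partial i f x = 0"
  by (rule partial_zero_open[of "- cbox a b"]) (use assms in auto)

lemma test_function_partial:
  assumes "f \<in> test_functions U" shows "partial i f \<in> test_functions U"
proof -
  let ?K = "closure {x. f x \<noteq> 0}" and ?L = "closure {x. partial i f x \<noteq> 0}"
  have *: "compact ?K" "?K \<subseteq> U"
    using assms by (auto simp: test_functions_def)
  have "partial i f x = 0" if "x \<notin> ?K" for x
    by (rule partial_zero_open[of "- ?K"]) (use that closure_subset[of "{x. f x \<noteq> 0}"] in auto)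
  then have L: "?L \<subseteq> ?K" by (intro closure_minimal) auto
  moreover have "compact ?L"
    using L *(1) by (meson bounded_subset closed_closure compact_eq_bounded_closed)
  ultimately show ?thesis using * smooth_partial[OF test_function_smooth[OF assms]] 
    by (auto simp: test_functions_def smooth_def)
qed

lemma test_function_cmult:
  assumes "f \<in> test_functions U" shows "(\<lambda>x. c * f x) \<in> test_functions U"
proof -
  have K: "compact (closure {x. f x \<noteq> 0})" "closure {x. f x \<noteq> 0} \<subseteq> U"
    using assms by (auto simp: test_functions_def)
  have L: "closure {x. c * f x \<noteq> 0} \<subseteq> closure {x. f x \<noteq> 0}" by (intro closure_mono) auto
  moreover have "compact (closure {x. c * f x \<noteq> 0})"
    using L K(1) by (meson bounded_subset closed_closure compact_eq_bounded_closed)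
  ultimately show ?thesis using K smooth_cmult[OF test_function_smooth[OF assms]] 
    by (auto simp: test_functions_def smooth_def)
qed

lemma zero_test_function [simp]: "(\<lambda>x. 0) \<in> test_functions U"
  by (auto simp: test_functions_def)

subsection \<open>Bump functions\<close>

text \<open>The family \<open>flat\<close> is closed under differentiation up to linear combinations, so that the
  smoothness of all its members follows from a single induction.\<close>

definition flat :: "nat \<Rightarrow> real \<Rightarrow> real" where
  "flat m t = (if 0 < t then exp (- (1 / t)) / t ^ m else 0)"

lemma flat_tendsto: "((\<lambda>t. exp (- (1 / t)) / t ^ m) \<longlongrightarrow> 0) (at_right (0::real))"
proof -
  have "((\<lambda>s::real. s ^ m / exp s) \<longlongrightarrow> 0) at_top" by (rule tendsto_power_div_exp_0)
  then have "((\<lambda>t. (inverse t) ^ m / exp (inverse t)) \<longlongrightarrow> 0) (at_right (0::real))"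
    by (rule filterlim_compose[OF _ filterlim_inverse_at_top_right])
  then show ?thesis by (simp add: field_simps exp_minus)
qed

lemma flat_deriv:
  "(flat m has_real_derivative (flat (m + 2) t - real m * flat (m + 1) t)) (at t)"
proof (cases t "0::real" rule: linorder_cases)
  case less
  then have "eventually (\<lambda>s. s \<in> {..<0}) (nhds t)" by (intro eventually_nhds_in_open) auto
  then have "eventually (\<lambda>s. flat m s = 0) (nhds t)" by eventually_elim (simp add: flat_def)
  then have "(flat m has_real_derivative 0) (at t) \<longleftrightarrow> ((\<lambda>s. 0) has_real_derivative 0) (at t)"
    by (intro DERIV_cong_ev) auto
  with less show ?thesis by (simp add: flat_def)
next
  case equal
  \<comment> \<open>The difference quotient at \<open>0\<close> is \<open>flat (m + 1) h\<close> for
    positive \<open>h\<close> and \<open>0\<close> for negative \<open>h\<close>, so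
    \<open>flat_tendsto\<close> settles the side that matters.\<close>
  have "((\<lambda>h. flat m h / h) \<longlongrightarrow> 0) (at 0)"
  proof (rule filterlim_split_at)
    have "eventually (\<lambda>h. flat m h / h = 0) (at_left 0)"
      by (rule eventually_at_leftI[of "-1"]) (simp_all add: flat_def)
    then show "((\<lambda>h. flat m h / h) \<longlongrightarrow> 0) (at_left 0)" by (rule tendsto_eventually)
    have "eventually (\<lambda>h. exp (- (1 / h)) / h ^ (m + 1) = flat m h / h) (at_right 0)"
      by (rule eventually_at_rightI[of 0 1]) (simp_all add: flat_def)
    then show "((\<lambda>h. flat m h / h) \<longlongrightarrow> 0) (at_right 0)"
      by (rule Lim_transform_eventually[OF flat_tendsto])
  qed
  with equal show ?thesis by (simp add: DERIV_def flat_def)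
next
  case greater
  then have "eventually (\<lambda>s. s \<in> {0<..}) (nhds t)" by (intro eventually_nhds_in_open) auto
  then have ev: "eventually (\<lambda>s. flat m s = exp (- (1 / s)) / s ^ m) (nhds t)"
    by eventually_elim (simp add: flat_def)
  have "((\<lambda>s. exp (- (1 / s)) / s ^ m) has_real_derivative (flat (m + 2) t - real m * flat (m + 1) t)) (at t)"
  proof -
    have "((\<lambda>s. exp (- (1 / s)) / s ^ m) has_real_derivative
        (exp (- (1 / t)) * (1 / t\<^sup>2) * t ^ m - exp (- (1 / t)) * (real m * t ^ (m - 1))) / (t ^ m * t ^ m)) (at t)"
      using greater by (auto intro!: derivative_eq_intros simp: power2_eq_square)
    moreover have "(exp (- (1 / t)) * (1 / t\<^sup>2) * t ^ m - exp (- (1 / t)) * (real m * t ^ (m - 1))) / (t ^ m * t ^ m)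
       = flat (m + 2) t - real m * flat (m + 1) t"
    proof -
      have h1: "real m * t ^ (m - 1) / (t ^ m * t ^ m) = real m / t ^ (m + 1)"
        using greater by (cases m) (simp_all add: field_simps)
      have h2: "1 / t\<^sup>2 * t ^ m / (t ^ m * t ^ m) = 1 / t ^ (m + 2)"
        using greater by (simp add: power_add field_simps power2_eq_square)
      have h3: "(E * X * Y - E * Z) / W = E * (X * Y / W) - E * (Z / W)" for E X Y Z W :: real
        by (simp add: diff_divide_distrib)
      show ?thesis unfolding h3 h1 h2 using greater by (simp add: flat_def)
    qed
    ultimately show ?thesis by simp
  qed
  then show ?thesis using DERIV_cong_ev[OF refl ev refl] by simp
qed

lemma smooth_flat: "smooth (\<lambda>x::real^'n. flat m (a * (x $ i) + b))"
proof -
  have "Ck k (\<lambda>x::real^'n. flat m (a * (x $ i) + b))" for k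
  proof (induction k arbitrary: m)
    case 0
    have "continuous_on UNIV (flat m)"
      by (intro continuous_at_imp_continuous_on ballI DERIV_isCont[OF flat_deriv])
    moreover have "continuous_on UNIV (\<lambda>x::real^'n. a * (x $ i) + b)" by (intro continuous_intros)
    ultimately show ?case
      using continuous_on_compose2[of UNIV "flat m" UNIV "\<lambda>x::real^'n. a * (x $ i) + b"] by simp
  next
    case (Suc k)
    define D where "D t = flat (m + 2) t - real m * flat (m + 1) t" for t
    have d: "((\<lambda>x. flat m (a * (x $ i) + b)) has_derivative (\<lambda>h. D (a * (x $ i) + b) * (a * (h $ i)))) (at x)" for x :: "real^'n"
    proof -
      have "((\<lambda>x::real^'n. a * (x $ i) + b) has_derivative (\<lambda>h. a * (h $ i))) (at x)"
        by (auto intro!: derivative_eq_intros bounded_linear_imp_has_derivative bounded_linear_vec_nth)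
      from has_derivative_compose[OF this flat_deriv[of m, folded D_def, unfolded has_field_derivative_def]]
      show ?thesis by simp
    qed
    have "partial j (\<lambda>x::real^'n. flat m (a * (x $ i) + b)) = 
      (\<lambda>x. (a * axis j 1 $ i) * flat (m + 2) (a * (x $ i) + b) + (- a * axis j 1 $ i * m) * flat (m + 1) (a * (x $ i) + b))" for j
      using partial_eq[OF d] by (auto simp: D_def fun_eq_iff algebra_simps)
    moreover have "Ck k (\<lambda>x::real^'n. (a * axis j 1 $ i) * flat (m + 2) (a * (x $ i) + b)
        + (- a * axis j 1 $ i * m) * flat (m + 1) (a * (x $ i) + b))" for j
      by (intro Ck_add Ck_mult Suc Ck_const)
    ultimately show ?case using d by (auto simp only: differentiable_def Ck.simps)
  qed
  then show ?thesis by (simp add: smooth_def)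
qed

lemma smooth_prod: "finite I \<Longrightarrow> (\<And>i. i \<in> I \<Longrightarrow> smooth (f i)) \<Longrightarrow> smooth (\<lambda>x. \<Prod>i\<in>I. f i x)"
  by (induction I rule: finite_induct) (auto intro: smooth_mult)

text \<open>Approximates the indicator of the open box from below as \<open>n\<close> grows, since
  \<open>flat 0 (real n * t)\<close> tends to \<open>1\<close> exactly for positive
  \<open>t\<close>. The arguments are written as affine functions \<open>a * (x $ i) + b\<close> to
  match \<open>smooth_flat\<close>.\<close>

definition bump :: "real^'n \<Rightarrow> real^'n \<Rightarrow> nat \<Rightarrow> real^'n \<Rightarrow> real" where
  "bump a b n x = (\<Prod>i\<in>UNIV. flat 0 (real n * (x $ i) + - (real n * a $ i)) * flat 0 ((- real n) * (x $ i) + real n * b $ i))"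

lemma smooth_bump: "smooth (bump a b n)"
  unfolding bump_def[abs_def] by (intro smooth_prod smooth_mult smooth_flat) auto

lemma flat0_bounds: "0 \<le> flat 0 t" "flat 0 t \<le> 1"
  by (auto simp: flat_def)

lemma bump_bounds: "0 \<le> bump a b n x" "bump a b n x \<le> 1"
  unfolding bump_def
  by (auto intro!: prod_nonneg prod_le_1 mult_nonneg_nonneg mult_le_one flat0_bounds)

lemma flat0_tendsto: "(\<lambda>n. flat 0 (real n * t)) \<longlonglongrightarrow> (if 0 < t then 1 else 0)"
proof (cases "0 < t")
  case True
  have "(\<lambda>n. exp (- ((1 / t) * (1 / real n)))) \<longlonglongrightarrow> exp (- ((1 / t) * 0))"
    by (intro tendsto_intros lim_1_over_n)
  moreover have "eventually (\<lambda>n. exp (- ((1 / t) * (1 / real n))) = flat 0 (real n * t)) sequentially"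
    using eventually_gt_at_top[of 0] by eventually_elim (use True in \<open>auto simp: flat_def\<close>)
  ultimately show ?thesis using True by (simp add: tendsto_cong)
next
  case False
  then have "flat 0 (real n * t) = 0" for n
    by (auto simp: flat_def mult_nonneg_nonpos not_less)
  then show ?thesis using False by simp
qed

lemma bump_tendsto: "(\<lambda>n. bump a b n x) \<longlonglongrightarrow> indicator (box a b) x"
proof -
  have "(\<lambda>n. bump a b n x) = (\<lambda>n. \<Prod>i\<in>UNIV. flat 0 (real n * (x $ i - a $ i)) * flat 0 (real n * (b $ i - x $ i)))"
    unfolding bump_def by (simp add: algebra_simps)
  moreover have "\<dots> \<longlonglongrightarrow> (\<Prod>i\<in>UNIV. (if 0 < x $ i - a $ i then 1 else 0) * (if 0 < b $ i - x $ i then 1 else 0))"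
    by (intro tendsto_intros flat0_tendsto)
  moreover have "(\<Prod>i\<in>UNIV. (if 0 < x $ i - a $ i then 1 else 0) * (if 0 < b $ i - x $ i then 1 else 0)) = (indicator (box a b) x :: real)"
  proof (cases "x \<in> box a b")
    case True then show ?thesis by (auto simp: mem_box_cart)
  next
    case False
    then obtain i where "\<not> (0 < x $ i - a $ i \<and> 0 < b $ i - x $ i)" by (auto simp: mem_box_cart)
    then have "\<exists>i\<in>UNIV. (if 0 < x $ i - a $ i then 1 else 0) * (if 0 < b $ i - x $ i then 1 else (0::real)) = 0" by auto
    then show ?thesis using False by (simp add: prod_zero)
  qed
  ultimately show ?thesis by simp
qed

lemma bump_zero: 
  assumes "x \<notin> cbox a b" shows "bump a b n x = 0"
proof -
  obtain i where i: "x $ i < a $ i \<or> b $ i < x $ i" using assms by (auto simp: mem_box_cart not_le)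
  have "flat 0 (real n * (x $ i) + - (real n * a $ i)) * flat 0 ((- real n) * (x $ i) + real n * b $ i) = 0"
    using i mult_left_mono[of "x$i" "a$i" "real n"] mult_left_mono[of "b$i" "x$i" "real n"] by (auto simp: flat_def)
  then show ?thesis unfolding bump_def by (intro prod_zero) auto
qed

subsection \<open>Weighted averages along a coordinate direction\<close>

text \<open>An unnormalised one-sided convolution along a segment. Two weights are of interest: for
  \<open>c = 0\<close> the derivative in direction \<open>j\<close> is a finite difference, and for
  \<open>c = 1 / M\<close> the weight vanishes at the far end, so that the derivative is
  \<open>f\<close> minus its mean over the segment.\<close>

definition avg :: "real \<Rightarrow> real \<Rightarrow> 'n \<Rightarrow> (real^'n \<Rightarrow> real) \<Rightarrow> real^'n \<Rightarrow> real" where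
  "avg c M j f x = integral {0..M} (\<lambda>r. (1 - c * r) * f (x - r *\<^sub>R axis j 1))"

lemma continuous_on_line:
  fixes f :: "real^'n \<Rightarrow> real"
  assumes "smooth f" 
  shows "continuous_on S (\<lambda>r. (1 - c * r) * f (x - r *\<^sub>R axis j 1))"
proof -
  have "continuous_on S (\<lambda>r. f (x - r *\<^sub>R axis j 1))"
    by (rule continuous_on_compose2[OF smooth_continuous[OF assms, of UNIV]]) (auto intro!: continuous_intros)
  then show ?thesis by (intro continuous_intros)
qed

text \<open>Differentiation under the integral. \<open>leibniz_rule\<close> asks for a derivative
  that is jointly continuous as an operator, hence the detour through
  \<open>blinfun_inner_left\<close>.\<close>

lemma avg_has_derivative:
  fixes f :: "real^'n \<Rightarrow> real"
  assumes "smooth f"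
  shows "((avg c M j f) has_derivative (\<lambda>h. h \<bullet> (\<chi> i. avg c M j (partial i f) x))) (at x)"
proof -
  define e :: "real^'n" where "e = axis j 1"
  let ?fx = "\<lambda>x t. blinfun_inner_left (\<chi> i. (1 - c * t) * partial i f (x - t *\<^sub>R e))"
  have d: "((\<lambda>x. (1 - c * t) * f (x - t *\<^sub>R e)) has_derivative blinfun_apply (?fx x t)) (at x within UNIV)" for x t
  proof -
    have "((\<lambda>x. f (x - t *\<^sub>R e)) has_derivative (\<lambda>h. h \<bullet> (\<chi> i. partial i f (x - t *\<^sub>R e)))) (at x)"
      by (rule has_derivative_compose[OF _ smooth_has_derivative[OF assms]])
        (auto intro!: derivative_eq_intros)
    from has_derivative_mult_right[OF this, of "1 - c * t"] show ?thesis
      by (simp add: inner_vec_def sum_distrib_left algebra_simps)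
  qed
  have c: "continuous_on (UNIV \<times> cbox 0 M) (\<lambda>(x, t). ?fx x t)"
  proof -
    have "continuous_on (UNIV \<times> cbox 0 M) (\<lambda>p. partial i f (fst p - snd p *\<^sub>R e))" for i
      by (rule continuous_on_compose2[OF smooth_continuous[OF smooth_partial[OF assms], of UNIV]])
        (auto intro!: continuous_intros)
    then have "continuous_on (UNIV \<times> cbox 0 M) (\<lambda>p. (\<chi> i. (1 - c * snd p) * partial i f (fst p - snd p *\<^sub>R e)))"
      by (intro continuous_intros) auto
    from bounded_linear.continuous_on[OF bounded_linear_blinfun_inner_left this]
    show ?thesis by (simp add: split_beta)
  qed
  have i: "(\<lambda>t. (1 - c * t) * f (x - t *\<^sub>R e)) integrable_on cbox 0 M" for x
    unfolding e_def by (intro integrable_continuous continuous_on_line assms)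
  have "((\<lambda>x. integral (cbox 0 M) (\<lambda>t. (1 - c * t) * f (x - t *\<^sub>R e))) has_derivative
     integral (cbox 0 M) (?fx x)) (at x within UNIV)"
    by (rule leibniz_rule[OF d i c]) auto
  moreover have "blinfun_apply (integral (cbox 0 M) (?fx x)) h = h \<bullet> (\<chi> i. avg c M j (partial i f) x)" for h
  proof -
    have "continuous_on (cbox 0 M) (?fx x)"
      using continuous_on_compose2[OF c, of "cbox 0 M" "\<lambda>t. (x, t)", OF continuous_on_Pair[OF continuous_on_const continuous_on_id]]
      by (simp only: prod.case) auto
    then have "blinfun_apply (integral (cbox 0 M) (?fx x)) h = integral (cbox 0 M) (\<lambda>t. blinfun_apply (?fx x t) h)"
      by (intro blinfun_apply_integral integrable_continuous)
    also have "\<dots> = integral (cbox 0 M) (\<lambda>t. \<Sum>i\<in>UNIV. h $ i * ((1 - c * t) * partial i f (x - t *\<^sub>R e)))"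
      by (simp add: inner_vec_def)
    also have "\<dots> = (\<Sum>i\<in>UNIV. integral (cbox 0 M) (\<lambda>t. h $ i * ((1 - c * t) * partial i f (x - t *\<^sub>R e))))"
      unfolding e_def by (intro integral_sum integrable_on_mult_right integrable_continuous continuous_on_line smooth_partial assms finite)
    finally show ?thesis by (simp add: inner_vec_def avg_def e_def)
  qed
  then have "blinfun_apply (integral (cbox 0 M) (?fx x)) = (\<lambda>h. h \<bullet> (\<chi> i. avg c M j (partial i f) x))" ..
  ultimately show ?thesis by (simp add: avg_def[abs_def] e_def)
qed

lemma partial_avg:
  fixes f :: "real^'n \<Rightarrow> real"
  shows "smooth f \<Longrightarrow> partial i (avg c M j f) = avg c M j (partial i f)"
  using partial_eq[OF avg_has_derivative, of f i c M j] by (auto simp: inner_axis')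

lemma smooth_avg:
  fixes f :: "real^'n \<Rightarrow> real"
  assumes "smooth f" shows "smooth (avg c M j f)"
proof -
  have dif: "avg c M j f differentiable at x" if "smooth f" for f :: "real^'n \<Rightarrow> real" and x
    using avg_has_derivative[OF that] unfolding differentiable_def by blast
  have "smooth f \<Longrightarrow> Ck k (avg c M j f)" for k f
  proof (induction k arbitrary: f)
    case 0
    then show ?case using dif 
      by (auto intro!: continuous_at_imp_continuous_on differentiable_imp_continuous_within)
  next
    case (Suc k)
    then show ?case using dif by (auto simp: partial_avg smooth_partial)
  qed
  with assms show ?thesis by (simp add: smooth_def)
qed

text \<open>Integration by parts in the shift: the derivative in \<open>r\<close> of
  \<open>- (1 - c * r) * f (x - r e)\<close> is integrated once by the fundamental theorem
  (\<open>I1\<close>) and once term by term (\<open>I2\<close>).\<close>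

lemma partial_avg_parts:
  fixes f :: "real^'n \<Rightarrow> real"
  assumes f: "smooth f" and "0 \<le> M"
  shows "partial j (avg c M j f) x = f x - (1 - c * M) * f (x - M *\<^sub>R axis j 1) - c * avg 0 M j f x"
proof -
  let ?e = "axis j 1 :: real^'n"
  have line: "((\<lambda>r. f (x - r *\<^sub>R ?e)) has_real_derivative - partial j f (x - r *\<^sub>R ?e)) (at r within S)" for r S
  proof -
    have "((\<lambda>r. f (x - r *\<^sub>R ?e)) has_derivative
        (\<lambda>h. (- (h *\<^sub>R ?e)) \<bullet> (\<chi> i. partial i f (x - r *\<^sub>R ?e)))) (at r within S)"
      by (rule has_derivative_compose[OF _ smooth_has_derivative[OF f]])
        (auto intro!: derivative_eq_intros)
    then show ?thesis unfolding has_field_derivative_def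
      by (rule has_derivative_eq_rhs) (auto simp: fun_eq_iff inner_axis')
  qed
  have I1: "((\<lambda>r. c * f (x - r *\<^sub>R ?e) + (1 - c * r) * partial j f (x - r *\<^sub>R ?e)) has_integral
      (- (1 - c * M) * f (x - M *\<^sub>R ?e)) - (- (1 - c * 0) * f (x - 0 *\<^sub>R ?e))) {0..M}"
    by (rule fundamental_theorem_of_calculus[OF assms(2)])
      (auto intro!: derivative_eq_intros line simp: has_real_derivative_iff_has_vector_derivative[symmetric] algebra_simps)
  have I2: "((\<lambda>r. c * f (x - r *\<^sub>R ?e) + (1 - c * r) * partial j f (x - r *\<^sub>R ?e)) has_integral
      (c * avg 0 M j f x + avg c M j (partial j f) x)) {0..M}"
  proof (intro has_integral_add has_integral_mult_right)
    show "((\<lambda>r. f (x - r *\<^sub>R axis j 1)) has_integral avg 0 M j f x) {0..M}"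
      using integrable_integral[OF integrable_continuous_real[OF continuous_on_line[OF f, of "{0..M}" 0]]]
      by (simp add: avg_def)
    show "((\<lambda>r. (1 - c * r) * partial j f (x - r *\<^sub>R axis j 1)) has_integral avg c M j (partial j f) x) {0..M}"
      unfolding avg_def 
      by (intro integrable_integral integrable_continuous_real continuous_on_line smooth_partial f)
  qed
  have "c * avg 0 M j f x + avg c M j (partial j f) x = f x - (1 - c * M) * f (x - M *\<^sub>R ?e)"
    using has_integral_unique[OF I2 I1] by (simp add: algebra_simps)
  then show ?thesis using partial_avg[OF f] by simp
qed

lemma avg_bound:
  fixes f :: "real^'n \<Rightarrow> real"
  assumes f: "smooth f" and "0 \<le> M" "0 \<le> c" "c * M \<le> 1" and B: "\<And>x. \<bar>f x\<bar> \<le> B"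
  shows "\<bar>avg c M j f x\<bar> \<le> B * M"
proof -
  have "norm (integral {0..M} (\<lambda>r. (1 - c * r) * f (x - r *\<^sub>R axis j 1))) \<le> B * (M - 0)"
  proof (rule integral_bound[OF assms(2) continuous_on_line[OF f]])
    fix r assume r: "r \<in> {0..M}"
    have "c * r \<le> c * M" using r assms by (intro mult_left_mono) auto
    then have "\<bar>1 - c * r\<bar> \<le> 1" using r assms by auto
    then have "\<bar>1 - c * r\<bar> * \<bar>f (x - r *\<^sub>R axis j 1)\<bar> \<le> 1 * B"
      using B by (intro mult_mono) auto
    then show "norm ((1 - c * r) * f (x - r *\<^sub>R axis j 1)) \<le> B" by (simp add: abs_mult)
  qed
  then show ?thesis by (simp add: avg_def)
qed

lemma avg_support:
  fixes f :: "real^'n \<Rightarrow> real"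
  assumes f: "\<And>x. x \<notin> cbox a b \<Longrightarrow> f x = 0" and x: "x \<notin> cbox a (b + M *\<^sub>R axis j 1)"
  shows "avg c M j f x = 0"
proof -
  have "(1 - c * r) * f (x - r *\<^sub>R axis j 1) = 0" if r: "r \<in> {0..M}" for r
  proof -
    have "x - r *\<^sub>R axis j 1 \<notin> cbox a b"
    proof
      assume *: "x - r *\<^sub>R axis j 1 \<in> cbox a b"
      have "a $ i \<le> x $ i \<and> x $ i \<le> (b + M *\<^sub>R axis j 1) $ i" for i
        using * r by (auto simp: mem_box_cart axis_def dest!: spec[of _ i] split: if_splits)
      with x show False by (auto simp: mem_box_cart)
    qed
    then show ?thesis using f by simp
  qed
  then have "integral {0..M} (\<lambda>r. (1 - c * r) * f (x - r *\<^sub>R axis j 1)) = integral {0..M} (\<lambda>r. 0)"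
    by (intro integral_cong) auto
  then show ?thesis by (simp add: avg_def)
qed

subsection \<open>Duality with test functions\<close>

text \<open>A measurable function is an almost everywhere limit of continuous ones. These are
  truncated to values in [-1, 1], replaced on the box by polynomials and cut off by bumps; all three
  steps keep the limit inside the open box.\<close>

lemma test_function_approx:
  fixes s :: "real^'n \<Rightarrow> real"
  assumes s: "s \<in> borel_measurable lebesgue" "\<And>x. \<bar>s x\<bar> \<le> 1"
  obtains \<psi> where "\<And>n. smooth (\<psi> n)" "\<And>n x. \<bar>\<psi> n x\<bar> \<le> 1" "\<And>n x. x \<notin> cbox a b \<Longrightarrow> \<psi> n x = 0"
    "AE x in lebesgue. (\<lambda>n. \<psi> n x) \<longlonglongrightarrow> indicator (box a b) x * s x"
proof -
  have "s measurable_on UNIV" using s(1) by (intro lebesgue_measurable_imp_measurable_on_real) auto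
  then obtain N g where N: "negligible N" and g: "\<And>n. continuous_on UNIV (g n)" 
      "\<And>x. x \<notin> N \<Longrightarrow> (\<lambda>n. g n x) \<longlonglongrightarrow> s x"
    unfolding measurable_on_def by auto
  define g' where "g' n x = max (-1) (min 1 (g n x))" for n x
  have g': "continuous_on (cbox a b) (g' n)" "\<bar>g' n x\<bar> \<le> 1" for n x
    unfolding g'_def[abs_def]
    using continuous_on_subset[OF g(1)] by (auto intro!: continuous_intros)
  have "\<exists>q. real_polynomial_function q \<and> (\<forall>x\<in>cbox a b. \<bar>g' n x - q x\<bar> < 1 / (real n + 1))" for n
    by (rule Stone_Weierstrass_real_polynomial_function[OF compact_cbox g'(1)[of n], of "1 / (real n + 1)"]) auto
  then obtain q where q: "\<And>n. real_polynomial_function (q n)" "\<And>n x. x \<in> cbox a b \<Longrightarrow> \<bar>g' n x - q n x\<bar> < 1 / (real n + 1)"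
    by metis
  \<comment> \<open>The polynomials may exceed \<open>1\<close> in modulus by
    \<open>1 / (real n + 1)\<close>; the factor \<open>(real n + 1) / (real n + 2)\<close> cancels
    exactly this excess and tends to \<open>1\<close>.\<close>
  define \<psi> where "\<psi> n x = bump a b n x * ((real n + 1) / (real n + 2) * q n x)" for n x
  show thesis
  proof
    show "smooth (\<psi> n)" for n
      unfolding \<psi>_def[abs_def] by (intro smooth_mult smooth_bump smooth_cmult smooth_real_polynomial q smooth_const)
    show z: "\<psi> n x = 0" if "x \<notin> cbox a b" for n x
      using that by (simp add: \<psi>_def bump_zero)
    show "\<bar>\<psi> n x\<bar> \<le> 1" for n x
    proof (cases "x \<in> cbox a b")
      case True
      have "\<bar>q n x\<bar> \<le> 1 + 1 / (real n + 1)" using q(2)[OF True, of n] g'(2)[of n x] by linarith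
      also have "\<dots> = (real n + 2) / (real n + 1)" by (simp add: field_simps)
      finally have "(real n + 1) / (real n + 2) * \<bar>q n x\<bar> \<le> (real n + 1) / (real n + 2) * ((real n + 2) / (real n + 1))"
        by (intro mult_left_mono) auto
      then have "\<bar>(real n + 1) / (real n + 2) * q n x\<bar> \<le> 1" by (simp add: abs_mult)
      then have "\<bar>bump a b n x\<bar> * \<bar>(real n + 1) / (real n + 2) * q n x\<bar> \<le> 1 * 1"
        using bump_bounds[of a b n x] by (intro mult_mono) auto
      then show ?thesis by (simp add: \<psi>_def abs_mult)
    qed (simp add: z)
    have "(\<lambda>n. \<psi> n x) \<longlonglongrightarrow> indicator (box a b) x * s x" if x: "x \<notin> N" for x
    proof (cases "x \<in> cbox a b")
      case True
      have "(\<lambda>n. g' n x) \<longlonglongrightarrow> max (-1) (min 1 (s x))"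
        unfolding g'_def by (intro tendsto_intros g x)
      moreover have "(\<lambda>n. q n x - g' n x) \<longlonglongrightarrow> 0"
      proof (rule Lim_null_comparison)
        show "\<forall>\<^sub>F n in sequentially. norm (q n x - g' n x) \<le> 1 / (real n + 1)"
          using q(2)[OF True] by (auto simp: abs_minus_commute intro!: always_eventually less_imp_le)
        show "(\<lambda>n. 1 / (real n + 1)) \<longlonglongrightarrow> 0"
          using LIMSEQ_inverse_real_of_nat by (simp add: inverse_eq_divide add.commute)
      qed
      ultimately have "(\<lambda>n. g' n x + (q n x - g' n x)) \<longlonglongrightarrow> max (-1) (min 1 (s x)) + 0" 
        by (rule tendsto_add)
      then have "(\<lambda>n. q n x) \<longlonglongrightarrow> s x" using s(2)[of x] by (simp add: max_def min_def abs_le_iff split: if_splits)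
      moreover have "(\<lambda>n. (real n + 1) / (real n + 2)) \<longlonglongrightarrow> 1" by real_asymp
      ultimately have "(\<lambda>n. \<psi> n x) \<longlonglongrightarrow> indicator (box a b) x * (1 * s x)"
        unfolding \<psi>_def by (intro tendsto_mult bump_tendsto)
      then show ?thesis by simp
    next
      case False
      then have "x \<notin> box a b" using box_subset_cbox by blast
      then show ?thesis using z[OF False] by simp
    qed
    then show "AE x in lebesgue. (\<lambda>n. \<psi> n x) \<longlonglongrightarrow> indicator (box a b) x * s x"
      using N by (intro AE_I'[of N]) (auto simp: negligible_iff_null_sets)
  qed
qed

lemma AE_cbox_box: "AE x in lebesgue. x \<in> cbox a b \<longleftrightarrow> x \<in> box a (b::'a::euclidean_space)"
proof -
  have "negligible (cbox a b - box a b)" by (rule negligible_frontier_interval)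
  then show ?thesis using box_subset_cbox[of a b]
    by (intro AE_I'[of "cbox a b - box a b"]) (auto simp: negligible_iff_null_sets)
qed

text \<open>The bound \<open>K\<close> is tested on smooth approximants of \<open>sgn (f x)\<close>;
  dominated convergence with majorant \<bar>f\<bar> on the box passes to the limit. The approximants
  converge to \<open>0\<close> on the boundary of the box, which is a null set.\<close>

lemma L1_duality:
  fixes f :: "real^'n \<Rightarrow> real"
  assumes f: "f \<in> borel_measurable lebesgue" "set_integrable lebesgue (cbox a b) f"
    and K: "\<And>\<psi>. smooth \<psi> \<Longrightarrow> (\<And>x. \<bar>\<psi> x\<bar> \<le> 1) \<Longrightarrow> (\<And>x. x \<notin> cbox a b \<Longrightarrow> \<psi> x = 0) \<Longrightarrow>
      (LINT x|lebesgue. f x * \<psi> x) \<le> K"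
  shows "(LINT x:cbox a b|lebesgue. \<bar>f x\<bar>) \<le> K"
proof -
  have sg: "(\<lambda>x. sgn (f x)) \<in> borel_measurable lebesgue" using f(1) by measurable
  then obtain \<psi> where \<psi>: "\<And>n. smooth (\<psi> n)" "\<And>n x. \<bar>\<psi> n x\<bar> \<le> 1" "\<And>n x. x \<notin> cbox a b \<Longrightarrow> \<psi> n x = 0"
    "AE x in lebesgue. (\<lambda>n. \<psi> n x) \<longlonglongrightarrow> indicator (box a b) x * sgn (f x)"
    using test_function_approx[of "\<lambda>x. sgn (f x)" a b] by (auto simp: abs_sgn_eq)
  have m[measurable]: "\<psi> n \<in> borel_measurable lebesgue" for n
    by (simp add: measurable_completion borel_measurable_continuous_onI smooth_continuous \<psi>(1))
  note f(1)[measurable]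
  have "(\<lambda>n. LINT x|lebesgue. f x * \<psi> n x) \<longlonglongrightarrow> (LINT x|lebesgue. f x * (indicator (box a b) x * sgn (f x)))"
  proof (rule integral_dominated_convergence[where w="\<lambda>x. indicator (cbox a b) x * \<bar>f x\<bar>"])
    show "integrable lebesgue (\<lambda>x. indicator (cbox a b) x * \<bar>f x\<bar>)"
      using set_integrable_abs[OF f(2)] by (simp add: set_integrable_def)
    show "AE x in lebesgue. (\<lambda>n. f x * \<psi> n x) \<longlonglongrightarrow> f x * (indicator (box a b) x * sgn (f x))"
      using \<psi>(4) by eventually_elim (intro tendsto_intros)
    show "AE x in lebesgue. norm (f x * \<psi> n x) \<le> indicator (cbox a b) x * \<bar>f x\<bar>" for n
    proof (intro AE_I2)
      fix x show "norm (f x * \<psi> n x) \<le> indicator (cbox a b) x * \<bar>f x\<bar>"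
        using mult_left_mono[OF \<psi>(2)[of n x], of "\<bar>f x\<bar>"] \<psi>(3)[of x n] 
        by (cases "x \<in> cbox a b") (auto simp: abs_mult)
    qed
  qed (use sg f(1) in \<open>auto intro!: borel_measurable_times borel_measurable_indicator\<close>)
  then have "(LINT x|lebesgue. f x * (indicator (box a b) x * sgn (f x))) \<le> K"
    by (rule LIMSEQ_le_const2) (use K[OF \<psi>(1) \<psi>(2) \<psi>(3)] in auto)
  also have "(LINT x|lebesgue. f x * (indicator (box a b) x * sgn (f x))) = (LINT x:cbox a b|lebesgue. \<bar>f x\<bar>)"
    unfolding set_lebesgue_integral_def
  proof (rule integral_cong_AE)
    show "AE x in lebesgue. f x * (indicator (box a b) x * sgn (f x)) = indicator (cbox a b) x *\<^sub>R \<bar>f x\<bar>"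
      using AE_cbox_box[of a b] by eventually_elim (auto simp: indicator_def abs_sgn)
  qed (use sg f(1) in \<open>auto intro!: borel_measurable_times borel_measurable_indicator borel_measurable_abs\<close>)
  finally show ?thesis .
qed

text \<open>An open set is a countable union of closed boxes, and on each of them
  \<open>L1_duality\<close> applies with the bound \<open>0\<close>.\<close>

lemma fundamental_lemma:
  fixes f :: "real^'n \<Rightarrow> real"
  assumes f: "f \<in> borel_measurable lebesgue" "\<And>a b. set_integrable lebesgue (cbox a b) f"
    and U: "open U" and z: "\<And>\<psi>. \<psi> \<in> test_functions U \<Longrightarrow> (LINT x|lebesgue. f x * \<psi> x) = 0"
  shows "AE x in lebesgue. x \<in> U \<longrightarrow> f x = 0"
proof -
  obtain \<D> where \<D>: "countable \<D>" "\<D> \<subseteq> Pow U" "\<And>X. X \<in> \<D> \<Longrightarrow> \<exists>a b. X = cbox a b" "\<Union>\<D> = U"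
    using open_countable_Union_open_cbox[OF U] by metis
  have "AE x in lebesgue. x \<in> X \<longrightarrow> f x = 0" if X: "X \<in> \<D>" for X
  proof -
    obtain a b where ab: "X = cbox a b" "cbox a b \<subseteq> U" using X \<D> by blast
    have le: "(LINT x:cbox a b|lebesgue. \<bar>f x\<bar>) \<le> 0"
    proof (rule L1_duality[OF f])
      fix \<psi> :: "real^'n \<Rightarrow> real"
      assume "smooth \<psi>" "\<And>x. x \<notin> cbox a b \<Longrightarrow> \<psi> x = 0"
      then have "\<psi> \<in> test_functions U" using ab(2) by (intro test_functionI) auto
      then show "(LINT x|lebesgue. f x * \<psi> x) \<le> 0" using z by simp
    qed
    have ge: "0 \<le> (LINT x:cbox a b|lebesgue. \<bar>f x\<bar>)"
      unfolding set_lebesgue_integral_def by (rule Bochner_Integration.integral_nonneg) (auto simp: indicator_def)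
    have int: "integrable lebesgue (\<lambda>x. indicator (cbox a b) x *\<^sub>R \<bar>f x\<bar>)"
      using set_integrable_abs[OF f(2)] by (simp add: set_integrable_def)
    have "AE x in lebesgue. indicator (cbox a b) x *\<^sub>R \<bar>f x\<bar> = 0"
      using integral_nonneg_eq_0_iff_AE[OF int] antisym[OF le ge]
      by (simp add: set_lebesgue_integral_def del: mult_eq_0_iff)
    then show ?thesis unfolding ab(1) by eventually_elim (auto simp: indicator_def)
  qed
  then have "AE x in lebesgue. \<forall>X\<in>\<D>. x \<in> X \<longrightarrow> f x = 0"
    using \<D>(1) by (subst AE_ball_countable) auto
  then show ?thesis by eventually_elim (use \<D>(4) in blast)
qed

subsection \<open>Difference quotients\<close>

lemma lebesgue_integral_translation:
  fixes f :: "'a::euclidean_space \<Rightarrow> real"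
  assumes "f \<in> borel_measurable borel"
  shows "(LINT x|lebesgue. f (x + a)) = (LINT x|lebesgue. f x)"
proof -
  note assms[measurable]
  have "(LINT x|lebesgue. f x) = (LINT x|distr lborel borel ((+) a). f x)"
    using assms by (subst lborel_distr_plus) (simp add: integral_completion)
  also have "\<dots> = (LINT x|lborel. f (a + x))" by (rule integral_distr) measurable
  also have "\<dots> = (LINT x|lebesgue. f (a + x))"
    by (rule integral_completion[symmetric]) measurable
  finally show ?thesis by (simp add: add.commute)
qed

lemma nn_integral_translation:
  fixes f :: "'a::euclidean_space \<Rightarrow> ennreal"
  assumes "f \<in> borel_measurable borel"
  shows "(\<integral>\<^sup>+x. f (x + a) \<partial>lborel) = (\<integral>\<^sup>+x. f x \<partial>lborel)"
proof -
  note assms[measurable]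
  have "(\<integral>\<^sup>+x. f x \<partial>lborel) = (\<integral>\<^sup>+x. f x \<partial>distr lborel borel ((+) a))"
    by (subst lborel_distr_plus) simp
  also have "\<dots> = (\<integral>\<^sup>+x. f (a + x) \<partial>lborel)" by (rule nn_integral_distr) measurable
  finally show ?thesis by (simp add: add.commute)
qed

lemma integrable_continuous_box:
  fixes f :: "real^'n \<Rightarrow> real"
  assumes "continuous_on UNIV f" "\<And>x. x \<notin> cbox a b \<Longrightarrow> f x = 0"
  shows "integrable lebesgue f"
proof -
  have "integrable lborel (\<lambda>x. indicator (cbox a b) x *\<^sub>R f x)"
    using assms(1) continuous_on_subset by (intro borel_integrable_compact) auto
  moreover have "(\<lambda>x. indicator (cbox a b) x *\<^sub>R f x) = f"
    using assms(2) by (auto simp: indicator_def fun_eq_iff)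
  ultimately show ?thesis using assms(1)
    by (simp add: integrable_completion borel_measurable_continuous_onI)
qed

lemma continuous_bounded_box:
  fixes f :: "real^'n \<Rightarrow> real"
  assumes "continuous_on UNIV f" "\<And>x. x \<notin> cbox a b \<Longrightarrow> f x = 0"
  obtains B where "0 \<le> B" "\<And>x. \<bar>f x\<bar> \<le> B"
proof -
  obtain B where "0 \<le> B" "\<And>x. x \<in> cbox a b \<Longrightarrow> norm (f x) \<le> B"
    using continuous_on_compact_bound[OF compact_cbox continuous_on_subset[OF assms(1)]] by blast
  then have "\<bar>f x\<bar> \<le> B" for x using assms(2) by (cases "x \<in> cbox a b") auto
  with \<open>0 \<le> B\<close> show thesis using that by blast
qed

lemma smooth_line_mvt:
  fixes f :: "real^'n \<Rightarrow> real"
  assumes "smooth f" "0 < h"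
  obtains s where "0 < s" "s < h" "f (x + h *\<^sub>R axis j 1) - f x = h * partial j f (x + s *\<^sub>R axis j 1)"
proof -
  have "\<exists>s. 0 < s \<and> s < h \<and> f (x + h *\<^sub>R axis j 1) - f (x + 0 *\<^sub>R axis j 1) = (h - 0) * partial j f (x + s *\<^sub>R axis j 1)"
    by (rule MVT2[OF assms(2)]) (rule smooth_line_derivative[OF assms(1)])
  then show thesis using that by auto
qed

text \<open>The mean value theorem in direction \<open>k\<close> for the increment of
  \<open>f\<close> in direction \<open>j\<close>, then in direction \<open>j\<close> for
  \<open>partial k f\<close>. Second difference quotients are thus values of the second derivative
  at nearby points, which yields their boundedness and their limit together.\<close>

lemma smooth_mixed_mvt:
  fixes f :: "real^'n \<Rightarrow> real"
  assumes "smooth f" "0 < h"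
  obtains s t where "0 < s" "s < h" "0 < t" "t < h"
    "f (x + h *\<^sub>R axis j 1 + h *\<^sub>R axis k 1) - f (x + h *\<^sub>R axis j 1) - f (x + h *\<^sub>R axis k 1) + f x
      = h\<^sup>2 * partial j (partial k f) (x + s *\<^sub>R axis k 1 + t *\<^sub>R axis j 1)"
proof -
  let ?j = "axis j 1 :: real^'n" and ?k = "axis k 1 :: real^'n"
  define g where "g = (\<lambda>y. f (y + h *\<^sub>R ?j) - f y)"
  have s1: "smooth (\<lambda>y. f (y + h *\<^sub>R ?j))" by (rule smooth_shift[OF assms(1)])
  then have g: "smooth g" unfolding g_def by (rule smooth_diff[OF _ assms(1)])
  have pg: "partial k g y = partial k f (y + h *\<^sub>R ?j) - partial k f y" for y
    unfolding g_def partial_diff_smooth[OF s1 assms(1)] 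
    by (simp add: partial_shift smooth_differentiable[OF assms(1)])
  obtain s where s: "0 < s" "s < h" "g (x + h *\<^sub>R ?k) - g x = h * partial k g (x + s *\<^sub>R ?k)"
    using smooth_line_mvt[OF g assms(2)] by blast
  obtain t where t: "0 < t" "t < h" 
    "partial k f (x + s *\<^sub>R ?k + h *\<^sub>R ?j) - partial k f (x + s *\<^sub>R ?k) = h * partial j (partial k f) (x + s *\<^sub>R ?k + t *\<^sub>R ?j)"
    using smooth_line_mvt[OF smooth_partial[OF assms(1)] assms(2)] by blast
  have "g (x + h *\<^sub>R ?k) - g x = h\<^sup>2 * partial j (partial k f) (x + s *\<^sub>R ?k + t *\<^sub>R ?j)"
    using s(3) t(3) pg by (simp add: power2_eq_square)
  moreover have "g (x + h *\<^sub>R ?k) - g x = f (x + h *\<^sub>R ?j + h *\<^sub>R ?k) - f (x + h *\<^sub>R ?j) - f (x + h *\<^sub>R ?k) + f x"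
    by (simp add: g_def algebra_simps)
  ultimately show thesis using that s t by metis
qed

lemma integrable_mult_shift:
  fixes f g :: "real^'n \<Rightarrow> real"
  assumes f: "continuous_on UNIV f" and g: "continuous_on UNIV g" "\<And>x. x \<notin> cbox a b \<Longrightarrow> g x = 0"
  shows "integrable lebesgue (\<lambda>x. f x * g (x + v))"
proof (rule integrable_continuous_box[of _ "a - v" "b - v"])
  show "continuous_on UNIV (\<lambda>x. f x * g (x + v))"
    by (intro continuous_on_mult f continuous_on_compose2[OF g(1)]) (auto intro!: continuous_intros)
  show "f x * g (x + v) = 0" if "x \<notin> cbox (a - v) (b - v)" for x
  proof -
    have "x + v \<notin> cbox a b" using that by (auto simp: mem_box_cart algebra_simps)
    then show ?thesis using g(2) by simp
  qed
qed

lemma integrable_shift_mult: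
  fixes f g :: "real^'n \<Rightarrow> real"
  assumes f: "continuous_on UNIV f" and g: "continuous_on UNIV g" "\<And>x. x \<notin> cbox a b \<Longrightarrow> g x = 0"
  shows "integrable lebesgue (\<lambda>x. f (x + v) * g x)"
proof -
  have "continuous_on UNIV (\<lambda>x. f (x + v))"
    by (rule continuous_on_compose2[OF f]) (auto intro!: continuous_intros)
  from integrable_mult_shift[OF this g, where v=0] show ?thesis by simp
qed

lemma integral_mult_shift:
  fixes f g :: "real^'n \<Rightarrow> real"
  assumes f: "continuous_on UNIV f" and g: "continuous_on UNIV g"
  shows "(LINT x|lebesgue. f x * g (x + v)) = (LINT x|lebesgue. f (x - v) * g x)"
proof -
  have "(\<lambda>x. f (x - v) * g x) \<in> borel_measurable borel"
    by (intro borel_measurable_continuous_onI continuous_on_mult g continuous_on_compose2[OF f])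
      (auto intro!: continuous_intros)
  from lebesgue_integral_translation[OF this, of v] show ?thesis by simp
qed

text \<open>Dominated convergence for quotients that stay bounded and supported in one box for all
  steps up to \<open>1\<close>; serves the first-order and the second-order quotients of test
  functions.\<close>

lemma difference_quotient_limit:
  fixes D :: "real \<Rightarrow> real^'n \<Rightarrow> real" and f :: "real^'n \<Rightarrow> real"
  assumes f: "continuous_on UNIV f" 
    and D: "\<And>h. continuous_on UNIV (D h)" "\<And>h x. 0 < h \<Longrightarrow> h \<le> 1 \<Longrightarrow> x \<notin> cbox a b \<Longrightarrow> D h x = 0"
      "\<And>h x. 0 < h \<Longrightarrow> h \<le> 1 \<Longrightarrow> \<bar>D h x\<bar> \<le> B"
    and g: "continuous_on UNIV g"
    and lim: "\<And>x. (\<lambda>n. D (1 / (real n + 1)) x) \<longlonglongrightarrow> g x"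
  shows "(\<lambda>n. LINT x|lebesgue. f x * D (1 / (real n + 1)) x) \<longlonglongrightarrow> (LINT x|lebesgue. f x * g x)"
proof (rule integral_dominated_convergence[where w="\<lambda>x. indicator (cbox a b) x *\<^sub>R (B * \<bar>f x\<bar>)"])
  have m: "u \<in> borel_measurable lebesgue" if "continuous_on UNIV u" for u :: "real^'n \<Rightarrow> real"
    using that by (simp add: measurable_completion borel_measurable_continuous_onI)
  show "(\<lambda>x. f x * g x) \<in> borel_measurable lebesgue" 
    by (intro m continuous_intros f g)
  show "(\<lambda>x. f x * D (1 / (real n + 1)) x) \<in> borel_measurable lebesgue" for n
    by (intro m continuous_intros f D)
  have "continuous_on (cbox a b) (\<lambda>x. B * \<bar>f x\<bar>)"
    by (intro continuous_intros continuous_on_subset[OF f]) auto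
  then have "integrable lborel (\<lambda>x. indicator (cbox a b) x *\<^sub>R (B * \<bar>f x\<bar>))"
    by (intro borel_integrable_compact) auto
  then show "integrable lebesgue (\<lambda>x. indicator (cbox a b) x *\<^sub>R (B * \<bar>f x\<bar>))"
    by (subst integrable_completion) auto
  show "AE x in lebesgue. (\<lambda>n. f x * D (1 / (real n + 1)) x) \<longlonglongrightarrow> f x * g x"
    by (intro AE_I2 tendsto_intros lim)
  show "AE x in lebesgue. norm (f x * D (1 / (real n + 1)) x) \<le> indicator (cbox a b) x *\<^sub>R (B * \<bar>f x\<bar>)" for n
  proof (intro AE_I2)
    fix x
    have h: "0 < 1 / (real n + 1)" "1 / (real n + 1) \<le> 1" by (auto simp: field_simps)
    show "norm (f x * D (1 / (real n + 1)) x) \<le> indicator (cbox a b) x *\<^sub>R (B * \<bar>f x\<bar>)"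
      using D(2)[OF h, of x] mult_right_mono[OF D(3)[OF h, of x], of "\<bar>f x\<bar>"]
      by (cases "x \<in> cbox a b") (auto simp: abs_mult mult.commute)
  qed
qed

lemma inverse_Suc_tendsto: "(\<lambda>n. 1 / (real n + 1)) \<longlonglongrightarrow> 0"
  using LIMSEQ_inverse_real_of_nat by (simp add: inverse_eq_divide add.commute)

text \<open>The margin \<open>2\<close> leaves room for two successive steps of length at most
  \<open>1\<close>, which may be in the same direction.\<close>

lemma cbox_shift_axis:
  fixes a b x :: "real^'n"
  assumes "x \<notin> cbox (a - (\<chi> i. 2)) (b + (\<chi> i. 2))" "\<And>i. \<bar>v $ i\<bar> \<le> 2"
  shows "x + v \<notin> cbox a b"
proof
  assume *: "x + v \<in> cbox a b"
  have "a $ i - 2 \<le> x $ i \<and> x $ i \<le> b $ i + 2" for i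
    using * assms(2)[of i] by (auto simp: mem_box_cart abs_le_iff dest!: spec[of _ i])
  then show False using assms(1) by (auto simp: mem_box_cart)
qed


lemma continuous_near_limit:
  fixes u :: "'a::real_normed_vector \<Rightarrow> real"
  assumes "continuous_on UNIV u" "\<And>n::nat. \<exists>v. norm v \<le> c / (real n + 1) \<and> y n = u (x + v)"
  shows "y \<longlonglongrightarrow> u x"
proof -
  obtain v where v: "\<And>n. norm (v n) \<le> c / (real n + 1)" "\<And>n. y n = u (x + v n)"
    using assms(2) by metis
  have "(\<lambda>n. c * (1 / (real n + 1))) \<longlonglongrightarrow> c * 0"
    by (intro tendsto_intros inverse_Suc_tendsto)
  then have "v \<longlonglongrightarrow> 0"
    using v(1) by (intro Lim_null_comparison[of v]) (auto intro!: always_eventually)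
  then have "(\<lambda>n. x + v n) \<longlonglongrightarrow> x + 0" by (intro tendsto_intros)
  moreover have "isCont u x" using assms(1) by (simp add: continuous_on_eq_continuous_at)
  ultimately have "(\<lambda>n. u (x + v n)) \<longlonglongrightarrow> u x"
    using isCont_tendsto_compose[of x u] by simp
  then show ?thesis by (simp add: v(2)[symmetric])
qed

text \<open>Discrete integration by parts: translation invariance moves the difference quotient from
  \<open>\<phi>\<close> to \<open>f\<close>, where \<open>L\<close> bounds it, so that dominated
  convergence applies on both sides. The almost everywhere limit \<open>g\<close> is an assumption,
  to be checked by hand for affine and piecewise affine functions.\<close>

lemma weak_derivative_lipschitz:
  fixes f g \<phi> :: "real^'n \<Rightarrow> real"
  assumes L: "L-lipschitz_on UNIV f"
    and g: "g \<in> borel_measurable lebesgue"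
    and lim: "AE x in lebesgue. (\<lambda>n. (f (x + (1 / (real n + 1)) *\<^sub>R axis j 1) - f x) / (1 / (real n + 1))) \<longlonglongrightarrow> g x"
    and \<phi>: "\<phi> \<in> test_functions UNIV"
  shows "(LINT x|lebesgue. f x * partial j \<phi> x) = - (LINT x|lebesgue. g x * \<phi> x)"
proof -
  let ?e = "axis j 1 :: real^'n"
  let ?h = "\<lambda>n. 1 / (real n + 1)"
  have h: "0 < ?h n" "?h n \<le> 1" for n by (auto simp: field_simps)
  note sm = test_function_smooth[OF \<phi>]
  have fc: "continuous_on UNIV f" using L by (rule lipschitz_on_continuous_on)
  note \<phi>c = smooth_continuous[OF sm, of UNIV]
  obtain a b where ab: "\<And>x. x \<notin> cbox a b \<Longrightarrow> \<phi> x = 0" using test_function_box[OF \<phi>] by blast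
  have p0: "partial j \<phi> x = 0" if "x \<notin> cbox a b" for x
    using partial_zero_outside[of a b \<phi>] ab that by blast
  obtain B where B: "0 \<le> B" "\<And>x. \<bar>partial j \<phi> x\<bar> \<le> B"
    using continuous_bounded_box[OF smooth_continuous[OF smooth_partial[OF sm]] p0] by blast
  \<comment> \<open>A backward quotient of \<open>\<phi>\<close>, so that the translation turns it
    into the forward quotient of \<open>f\<close> in the hypothesis, with the opposite sign.\<close>
  define D where "D h x = (\<phi> x - \<phi> (x - h *\<^sub>R ?e)) / h" for h x
  have D: "\<exists>v. norm v \<le> h \<and> D h x = partial j \<phi> (x + v)" if hp: "0 < h" for h x
  proof -
    obtain s where s: "0 < s" "s < h" 
      "\<phi> (x - h *\<^sub>R ?e + h *\<^sub>R ?e) - \<phi> (x - h *\<^sub>R ?e) = h * partial j \<phi> (x - h *\<^sub>R ?e + s *\<^sub>R ?e)"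
      using smooth_line_mvt[OF sm hp] by blast
    then have "D h x = partial j \<phi> (x + (s - h) *\<^sub>R ?e)"
      using that by (simp add: D_def scaleR_left_diff_distrib algebra_simps)
    moreover have "norm ((s - h) *\<^sub>R ?e) \<le> h" using s by simp
    ultimately show ?thesis by blast
  qed
  have "(\<lambda>n. LINT x|lebesgue. f x * D (?h n) x) \<longlonglongrightarrow> (LINT x|lebesgue. f x * partial j \<phi> x)"
  proof (rule difference_quotient_limit[where D=D, OF fc])
    show "continuous_on UNIV (D h)" for h
    proof -
      have "continuous_on UNIV (\<lambda>x. \<phi> (x + (- h *\<^sub>R ?e)))" by (intro smooth_continuous smooth_shift sm)
      then show ?thesis unfolding D_def[abs_def] divide_inverse
        by (intro continuous_intros \<phi>c) simp
    qed
    show "continuous_on UNIV (partial j \<phi>)" by (intro smooth_continuous smooth_partial sm)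
    show "D h x = 0" if "0 < h" "h \<le> 1" "x \<notin> cbox (a - (\<chi> i. 2)) (b + (\<chi> i. 2))" for h x
    proof -
      have "x + 0 \<notin> cbox a b" "x + (- h *\<^sub>R ?e) \<notin> cbox a b"
        by (rule cbox_shift_axis[OF that(3)]; use that in \<open>simp add: axis_def\<close>)+
      then show ?thesis using ab by (simp add: D_def)
    qed
    show "\<bar>D h x\<bar> \<le> B" if "0 < h" "h \<le> 1" for h x using D[OF that(1), of x] B(2) by auto
    show "(\<lambda>n. D (?h n) x) \<longlonglongrightarrow> partial j \<phi> x" for x
      by (rule continuous_near_limit[of _ 1]) (use D[OF h(1)] smooth_continuous[OF smooth_partial[OF sm]] in auto)
  qed
  moreover have "(LINT x|lebesgue. f x * D (?h n) x) = - (LINT x|lebesgue. (f (x + ?h n *\<^sub>R ?e) - f x) / ?h n * \<phi> x)" for n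
  proof -
    let ?v = "?h n *\<^sub>R ?e"
    have i: "integrable lebesgue (\<lambda>x. f x * \<phi> x)" "integrable lebesgue (\<lambda>x. f x * \<phi> (x + - ?v))"
      "integrable lebesgue (\<lambda>x. f (x + ?v) * \<phi> x)"
      using integrable_mult_shift[OF fc \<phi>c, where a=a and b=b and v=0] integrable_mult_shift[OF fc \<phi>c, where a=a and b=b and v="- ?v"]
        integrable_shift_mult[OF fc \<phi>c, where a=a and b=b and v="?v"] ab by auto
    have "(LINT x|lebesgue. f x * D (?h n) x) = (LINT x|lebesgue. (real n + 1) * (f x * \<phi> x - f x * \<phi> (x + - ?v)))"
      by (intro Bochner_Integration.integral_cong refl) (simp add: D_def algebra_simps)
    also have "\<dots> = (real n + 1) * ((LINT x|lebesgue. f x * \<phi> x) - (LINT x|lebesgue. f x * \<phi> (x + - ?v)))"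
      by (simp only: integral_mult_right_zero Bochner_Integration.integral_diff[OF i(1,2)])
    also have "(LINT x|lebesgue. f x * \<phi> (x + - ?v)) = (LINT x|lebesgue. f (x + ?v) * \<phi> x)"
      by (subst integral_mult_shift[OF fc \<phi>c]) simp
    also have "(real n + 1) * ((LINT x|lebesgue. f x * \<phi> x) - (LINT x|lebesgue. f (x + ?v) * \<phi> x))
      = (LINT x|lebesgue. (real n + 1) * (f x * \<phi> x - f (x + ?v) * \<phi> x))"
      by (simp only: integral_mult_right_zero Bochner_Integration.integral_diff[OF i(1,3)])
    also have "\<dots> = (LINT x|lebesgue. - ((f (x + ?v) - f x) / ?h n * \<phi> x))"
      by (intro Bochner_Integration.integral_cong refl) (simp add: algebra_simps)
    finally show ?thesis by simp
  qed
  ultimately have "(\<lambda>n. - (LINT x|lebesgue. (f (x + ?h n *\<^sub>R ?e) - f x) / ?h n * \<phi> x)) \<longlonglongrightarrow> (LINT x|lebesgue. f x * partial j \<phi> x)"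
    by simp
  moreover have "(\<lambda>n. LINT x|lebesgue. (f (x + ?h n *\<^sub>R ?e) - f x) / ?h n * \<phi> x) \<longlonglongrightarrow> (LINT x|lebesgue. g x * \<phi> x)"
  proof (rule integral_dominated_convergence[where w="\<lambda>x. L * \<bar>\<phi> x\<bar>"])
    have m: "u \<in> borel_measurable lebesgue" if "continuous_on UNIV u" for u :: "real^'n \<Rightarrow> real"
      using that by (simp add: measurable_completion borel_measurable_continuous_onI)
    show "(\<lambda>x. g x * \<phi> x) \<in> borel_measurable lebesgue"
      by (intro borel_measurable_times g m \<phi>c)
    show "(\<lambda>x. (f (x + ?h n *\<^sub>R ?e) - f x) / ?h n * \<phi> x) \<in> borel_measurable lebesgue" for n
      by (intro m continuous_on_mult continuous_on_divide continuous_on_diff fc \<phi>c continuous_on_compose2[OF fc])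
        (auto intro!: continuous_intros)
    show "integrable lebesgue (\<lambda>x. L * \<bar>\<phi> x\<bar>)"
      by (rule integrable_continuous_box[of _ a b]) (auto intro!: continuous_intros \<phi>c simp: ab)
    show "AE x in lebesgue. (\<lambda>n. (f (x + ?h n *\<^sub>R ?e) - f x) / ?h n * \<phi> x) \<longlonglongrightarrow> g x * \<phi> x"
      using lim by eventually_elim (intro tendsto_intros)
    show "AE x in lebesgue. norm ((f (x + ?h n *\<^sub>R ?e) - f x) / ?h n * \<phi> x) \<le> L * \<bar>\<phi> x\<bar>" for n
    proof (intro AE_I2)
      fix x
      have "dist (f (x + ?h n *\<^sub>R ?e)) (f x) \<le> L * dist (x + ?h n *\<^sub>R ?e) x"
        by (rule lipschitz_onD[OF L]) auto
      then have "\<bar>f (x + ?h n *\<^sub>R ?e) - f x\<bar> \<le> L * ?h n" by (simp add: dist_norm)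
      then have "\<bar>(f (x + ?h n *\<^sub>R ?e) - f x) / ?h n\<bar> \<le> L"
        by (subst abs_divide) (simp only: abs_of_pos[OF h(1)] pos_divide_le_eq[OF h(1)])
      then show "norm ((f (x + ?h n *\<^sub>R ?e) - f x) / ?h n * \<phi> x) \<le> L * \<bar>\<phi> x\<bar>"
        unfolding real_norm_def abs_mult by (intro mult_right_mono) auto
    qed
  qed
  then have "(\<lambda>n. - (LINT x|lebesgue. (f (x + ?h n *\<^sub>R ?e) - f x) / ?h n * \<phi> x)) \<longlonglongrightarrow> - (LINT x|lebesgue. g x * \<phi> x)"
    by (rule tendsto_minus)
  ultimately show ?thesis by (rule LIMSEQ_unique)
qed

text \<open>The mixed second difference of \<open>\<phi>\<close> is translated onto the merely
  continuous \<open>f\<close>. As \<bar>\<phi>\<bar> is at most \<open>1\<close>, the L1 norm of the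
  second difference of \<open>f\<close> bounds the pairing, and its factor \<open>h\<^sup>2\<close>
  cancels the denominator.\<close>

lemma second_derivative_pairing_bound:
  fixes f \<phi> :: "real^'n \<Rightarrow> real"
  assumes f: "continuous_on UNIV f" and \<phi>: "\<phi> \<in> test_functions UNIV" "\<And>x. \<bar>\<phi> x\<bar> \<le> 1"
    and K: "0 \<le> K" "\<And>h. 0 < h \<Longrightarrow> h \<le> 1 \<Longrightarrow>
      (\<integral>\<^sup>+x. ennreal \<bar>f (x - h *\<^sub>R axis j 1 - h *\<^sub>R axis k 1) - f (x - h *\<^sub>R axis j 1) - f (x - h *\<^sub>R axis k 1) + f x\<bar> \<partial>lborel)
      \<le> ennreal (K * h\<^sup>2)"
  shows "\<bar>LINT x|lebesgue. f x * partial j (partial k \<phi>) x\<bar> \<le> K"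
proof -
  let ?j = "axis j 1 :: real^'n" and ?k = "axis k 1 :: real^'n"
  let ?h = "\<lambda>n. 1 / (real n + 1)"
  have h: "0 < ?h n" "?h n \<le> 1" for n by (auto simp: field_simps)
  note sm = test_function_smooth[OF \<phi>(1)]
  note \<phi>c = smooth_continuous[OF sm, of UNIV]
  let ?p = "partial j (partial k \<phi>)"
  obtain a b where ab: "\<And>x. x \<notin> cbox a b \<Longrightarrow> \<phi> x = 0" using test_function_box[OF \<phi>(1)] by blast
  have p0: "?p x = 0" if "x \<notin> cbox a b" for x
    using partial_zero_outside[of a b "partial k \<phi>"] partial_zero_outside[of a b \<phi>] ab that by blast
  have pc: "continuous_on UNIV ?p" by (intro smooth_continuous smooth_partial sm)
  obtain B where B: "0 \<le> B" "\<And>x. \<bar>?p x\<bar> \<le> B"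
    using continuous_bounded_box[OF pc p0] by blast
  define D where "D h x = (\<phi> (x + (h *\<^sub>R ?j + h *\<^sub>R ?k)) - \<phi> (x + h *\<^sub>R ?j) - \<phi> (x + h *\<^sub>R ?k) + \<phi> x) / h\<^sup>2" for h x
  have D: "\<exists>v. norm v \<le> 2 * h \<and> D h x = ?p (x + v)" if hp: "0 < h" for h x
  proof -
    obtain s t where st: "0 < s" "s < h" "0 < t" "t < h"
      "\<phi> (x + h *\<^sub>R ?j + h *\<^sub>R ?k) - \<phi> (x + h *\<^sub>R ?j) - \<phi> (x + h *\<^sub>R ?k) + \<phi> x
        = h\<^sup>2 * ?p (x + s *\<^sub>R ?k + t *\<^sub>R ?j)"
      using smooth_mixed_mvt[OF sm hp] by blast
    have "D h x = h\<^sup>2 * ?p (x + s *\<^sub>R ?k + t *\<^sub>R ?j) / h\<^sup>2"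
      unfolding D_def st(5)[symmetric] by (simp only: add.assoc)
    then have "D h x = ?p (x + (s *\<^sub>R ?k + t *\<^sub>R ?j))"
      using hp by (simp only: add.assoc nonzero_mult_div_cancel_left power_not_zero less_irrefl) simp
    moreover have "norm (s *\<^sub>R ?k + t *\<^sub>R ?j) \<le> 2 * h" 
    proof -
      have "norm (s *\<^sub>R ?k) \<le> h" "norm (t *\<^sub>R ?j) \<le> h" using st(1-4) by auto
      then show ?thesis using norm_triangle_ineq[of "s *\<^sub>R ?k" "t *\<^sub>R ?j"] by linarith
    qed
    ultimately show ?thesis by (intro exI[of _ "s *\<^sub>R ?k + t *\<^sub>R ?j"] conjI)
  qed
  have "(\<lambda>n. LINT x|lebesgue. f x * D (?h n) x) \<longlonglongrightarrow> (LINT x|lebesgue. f x * ?p x)"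
  proof (rule difference_quotient_limit[where D=D, OF f])
    show "continuous_on UNIV ?p" by (rule pc)
    show "continuous_on UNIV (D h)" for h
    proof -
      have c: "continuous_on UNIV (\<lambda>x. \<phi> (x + v))" for v
        by (rule smooth_continuous[OF smooth_shift[OF sm]])
      show ?thesis unfolding D_def[abs_def] divide_inverse
        by (rule continuous_on_mult_right, rule continuous_on_add[OF continuous_on_diff[OF continuous_on_diff[OF c c] c] \<phi>c])
    qed
    show "D h x = 0" if "0 < h" "h \<le> 1" "x \<notin> cbox (a - (\<chi> i. 2)) (b + (\<chi> i. 2))" for h x
    proof -
      have "x + 0 \<notin> cbox a b" "x + h *\<^sub>R ?j \<notin> cbox a b" "x + h *\<^sub>R ?k \<notin> cbox a b" "x + (h *\<^sub>R ?j + h *\<^sub>R ?k) \<notin> cbox a b"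
        by (rule cbox_shift_axis[OF that(3)]; use that in \<open>simp add: axis_def\<close>)+
      then show ?thesis using ab by (simp add: D_def)
    qed
    show "\<bar>D h x\<bar> \<le> B" if "0 < h" "h \<le> 1" for h x using D[OF that(1), of x] B(2) by auto
    show "(\<lambda>n. D (?h n) x) \<longlonglongrightarrow> ?p x" for x
      by (rule continuous_near_limit[OF pc, of 2]) (use D[OF h(1)] in auto)
  qed
  then have "(\<lambda>n. \<bar>LINT x|lebesgue. f x * D (?h n) x\<bar>) \<longlonglongrightarrow> \<bar>LINT x|lebesgue. f x * ?p x\<bar>"
    by (rule tendsto_rabs)
  moreover have "\<bar>LINT x|lebesgue. f x * D (?h n) x\<bar> \<le> K" for n
  proof -
    define u v where "u = ?h n *\<^sub>R ?j" and "v = ?h n *\<^sub>R ?k"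
    let ?d = "\<lambda>x. f (x - u - v) - f (x - u) - f (x - v) + f x"
    have i: "integrable lebesgue (\<lambda>x. f x * \<phi> (x + w))" "integrable lebesgue (\<lambda>x. f (x - w) * \<phi> x)" for w
      using integrable_mult_shift[OF f \<phi>c, where a=a and b=b and v=w]
        integrable_shift_mult[OF f \<phi>c, where a=a and b=b and v="- w"] ab by auto
    note i0 = i(1)[of 0, unfolded add_0_right]
    have id: "integrable lebesgue (\<lambda>x. ?d x * \<phi> x)"
    proof -
      have "integrable lebesgue (\<lambda>x. f (x - (u + v)) * \<phi> x - f (x - u) * \<phi> x - f (x - v) * \<phi> x + f x * \<phi> x)"
        by (intro Bochner_Integration.integrable_add Bochner_Integration.integrable_diff i i0)
      then show ?thesis by (simp add: algebra_simps)
    qed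
    have "(LINT x|lebesgue. f x * D (?h n) x) 
      = (LINT x|lebesgue. (real n + 1)\<^sup>2 * (f x * \<phi> (x + (u + v)) - f x * \<phi> (x + u) - f x * \<phi> (x + v) + f x * \<phi> x))"
      by (intro Bochner_Integration.integral_cong refl) (simp add: D_def u_def v_def power_divide algebra_simps)
    also have "\<dots> = (real n + 1)\<^sup>2 * ((LINT x|lebesgue. f x * \<phi> (x + (u + v))) - (LINT x|lebesgue. f x * \<phi> (x + u))
       - (LINT x|lebesgue. f x * \<phi> (x + v)) + (LINT x|lebesgue. f x * \<phi> x))"
      by (simp add: i i0 Bochner_Integration.integral_add Bochner_Integration.integral_diff)
    also have "\<dots> = (real n + 1)\<^sup>2 * ((LINT x|lebesgue. f (x - (u + v)) * \<phi> x) - (LINT x|lebesgue. f (x - u) * \<phi> x)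
       - (LINT x|lebesgue. f (x - v) * \<phi> x) + (LINT x|lebesgue. f x * \<phi> x))"
      by (simp only: integral_mult_shift[OF f \<phi>c])
    also have "\<dots> = (real n + 1)\<^sup>2 * (LINT x|lebesgue. f (x - (u + v)) * \<phi> x - f (x - u) * \<phi> x - f (x - v) * \<phi> x + f x * \<phi> x)"
      by (simp add: i i0 Bochner_Integration.integral_add Bochner_Integration.integral_diff)
    also have "\<dots> = (real n + 1)\<^sup>2 * (LINT x|lebesgue. ?d x * \<phi> x)"
      by (simp add: algebra_simps)
    finally have eq: "(LINT x|lebesgue. f x * D (?h n) x) = (real n + 1)\<^sup>2 * (LINT x|lebesgue. ?d x * \<phi> x)" .
    have "ennreal \<bar>LINT x|lebesgue. ?d x * \<phi> x\<bar> \<le> (\<integral>\<^sup>+x. ennreal \<bar>?d x * \<phi> x\<bar> \<partial>lebesgue)"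
      using integral_norm_bound_ennreal[OF id] by simp
    also have "\<dots> \<le> (\<integral>\<^sup>+x. ennreal \<bar>?d x\<bar> \<partial>lebesgue)"
    proof (intro nn_integral_mono ennreal_leI)
      fix x show "\<bar>?d x * \<phi> x\<bar> \<le> \<bar>?d x\<bar>" 
        using mult_left_mono[OF \<phi>(2)[of x], of "\<bar>?d x\<bar>"] by (simp add: abs_mult)
    qed
    also have "\<dots> \<le> ennreal (K * (?h n)\<^sup>2)"
      unfolding nn_integral_completion u_def v_def by (rule K(2)[OF h])
    finally have "\<bar>LINT x|lebesgue. ?d x * \<phi> x\<bar> \<le> K * (?h n)\<^sup>2"
      using K(1) by (subst (asm) ennreal_le_iff) auto
    then have "(real n + 1)\<^sup>2 * \<bar>LINT x|lebesgue. ?d x * \<phi> x\<bar> \<le> (real n + 1)\<^sup>2 * (K * (?h n)\<^sup>2)"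
      by (intro mult_left_mono) auto
    also have "\<dots> = K" by (simp add: power_divide)
    finally show ?thesis unfolding eq abs_mult by simp
  qed
  ultimately show ?thesis by (intro LIMSEQ_le_const2[where a=K]) auto
qed

subsection \<open>Lower bound\<close>

definition Fmat :: "real \<Rightarrow> real^2^2" where
  "Fmat \<mu> = vector [vector [\<mu>, 0], vector [0, 0]]"

lemma Fmat_nth [simp]: "Fmat \<mu> $ 1 $ 1 = \<mu>" "Fmat \<mu> $ 1 $ 2 = 0" "Fmat \<mu> $ 2 = 0"
  by (simp_all add: Fmat_def vec_eq_iff forall_2)

lemma Fmat_mult [simp]: "(Fmat \<mu> *v x) $ 1 = \<mu> * x $ 1" "(Fmat \<mu> *v x) $ 2 = 0"
  by (simp_all add: matrix_vector_mult_def sum_2)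

lemma K2_Fmat: "K2 = {Fmat 1, Fmat (-1)}"
  by (simp add: K2_def Fmat_def)

lemma Lp_loc_set_integrable:
  assumes "Lp_loc 1 f" "compact K"
  shows "set_integrable lebesgue K f"
proof -
  have m: "f \<in> borel_measurable lebesgue" and i: "set_integrable lebesgue K (\<lambda>x. norm (f x))"
    using assms by (auto simp: Lp_loc_def)
  have "K \<in> sets lebesgue" using assms(2) by (simp add: borel_compact)
  then show ?thesis
    using i m unfolding set_integrable_def
    by (intro Bochner_Integration.integrable_bound[OF i[unfolded set_integrable_def]]) auto
qed

lemma borel_measurable_nth:
  "f \<in> borel_measurable M \<Longrightarrow> (\<lambda>x. (f x :: 'a::euclidean_space^'n) $ i) \<in> borel_measurable M"
  by (rule measurable_compose[of f M borel "\<lambda>y. y $ i"])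
    (auto intro!: borel_measurable_continuous_onI continuous_intros)

lemma set_integrable_nth:
  assumes "set_integrable M K (f :: _ \<Rightarrow> 'a::euclidean_space^'n)" 
  shows "set_integrable M K (\<lambda>x. f x $ i)"
  using integrable_bounded_linear[OF bounded_linear_vec_nth[of i] assms[unfolded set_integrable_def]]
  unfolding set_integrable_def by simp

lemma weak_gradient_component:
  assumes "weak_gradient u G"
  shows "(\<lambda>x. u x $ i) \<in> borel_measurable lebesgue" "(\<lambda>x. G x $ i $ j) \<in> borel_measurable lebesgue"
    "compact K \<Longrightarrow> set_integrable lebesgue K (\<lambda>x. u x $ i)" 
    "compact K \<Longrightarrow> set_integrable lebesgue K (\<lambda>x. G x $ i $ j)"
    "\<phi> \<in> test_functions UNIV \<Longrightarrow> (LINT x|lebesgue. u x $ i * partial j \<phi> x) = - (LINT x|lebesgue. G x $ i $ j * \<phi> x)"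
  using assms unfolding weak_gradient_def
  by (auto intro!: borel_measurable_nth set_integrable_nth Lp_loc_set_integrable simp: Lp_loc_def[of _ u] Lp_loc_def[of _ G])

lemma integrable_mult_compact:
  fixes f g :: "real^'n \<Rightarrow> real"
  assumes f: "f \<in> borel_measurable lebesgue" "set_integrable lebesgue (cbox a b) f"
    and g: "continuous_on UNIV g" "\<And>x. x \<notin> cbox a b \<Longrightarrow> g x = 0"
  shows "integrable lebesgue (\<lambda>x. f x * g x)"
proof -
  obtain B where B: "0 \<le> B" "\<And>x. \<bar>g x\<bar> \<le> B" using continuous_bounded_box[OF g] by blast
  have "integrable lebesgue (\<lambda>x. B * \<bar>indicator (cbox a b) x *\<^sub>R f x\<bar>)"
    using f(2) by (auto simp: set_integrable_def)
  moreover have "(\<lambda>x. f x * g x) \<in> borel_measurable lebesgue"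
    using f(1) g(1) by (intro borel_measurable_times) (simp_all add: measurable_completion borel_measurable_continuous_onI)
  moreover have "AE x in lebesgue. norm (f x * g x) \<le> norm (B * \<bar>indicator (cbox a b) x *\<^sub>R f x\<bar>)"
  proof (intro AE_I2)
    fix x show "norm (f x * g x) \<le> norm (B * \<bar>indicator (cbox a b) x *\<^sub>R f x\<bar>)"
      using g(2)[of x] mult_right_mono[OF B(2)[of x], of "\<bar>f x\<bar>"] B(1)
      by (cases "x \<in> cbox a b") (auto simp: abs_mult mult.commute)
  qed
  ultimately show ?thesis by (rule Bochner_Integration.integrable_bound)
qed

text \<open>Difference quotients of an affine function are constant in the step. Needed to subtract
  the affine boundary datum from \<open>u\<close>.\<close>

lemma weak_derivative_affine:
  fixes \<phi> :: "real^'n \<Rightarrow> real"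
  assumes "\<phi> \<in> test_functions UNIV"
  shows "(LINT x|lebesgue. (c * x $ i + d) * partial j \<phi> x) = - (LINT x|lebesgue. (if i = j then c else 0) * \<phi> x)"
proof (rule weak_derivative_lipschitz[OF _ _ _ assms])
  show "\<bar>c\<bar>-lipschitz_on UNIV (\<lambda>x. c * x $ i + d)"
  proof (rule lipschitz_onI)
    fix x y :: "real^'n"
    have "\<bar>c * x $ i - c * y $ i\<bar> = \<bar>c\<bar> * \<bar>(x - y) $ i\<bar>"
      by (simp add: abs_mult[symmetric] right_diff_distrib)
    also have "\<dots> \<le> \<bar>c\<bar> * norm (x - y)"
      by (intro mult_left_mono component_le_norm_cart) auto
    finally show "dist (c * x $ i + d) (c * y $ i + d) \<le> \<bar>c\<bar> * dist x y"
      by (simp add: dist_norm)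
  qed auto
  show "AE x in lebesgue. (\<lambda>n. (c * (x + (1 / (real n + 1)) *\<^sub>R axis j 1) $ i + d - (c * x $ i + d)) / (1 / (real n + 1))) 
      \<longlonglongrightarrow> (if i = j then c else 0)"
  proof (intro AE_I2)
    fix x :: "real^'n"
    have "(c * (x + (1 / (real n + 1)) *\<^sub>R axis j 1) $ i + d - (c * x $ i + d)) / (1 / (real n + 1)) = (if i = j then c else 0)" for n
      by (simp add: axis_def field_simps)
    then show "(\<lambda>n. (c * (x + (1 / (real n + 1)) *\<^sub>R axis j 1) $ i + d - (c * x $ i + d)) / (1 / (real n + 1))) 
      \<longlonglongrightarrow> (if i = j then c else 0)" by simp
  qed
qed simp

lemma norm_axis: "norm (axis i x :: 'a::real_normed_vector^'n) = norm x"
  by (simp add: norm_vec_def L2_set_def axis_def if_distrib[where f=norm] if_distrib[where f="\<lambda>x. x\<^sup>2"] cong: if_cong)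

text \<open>A field whose only nonzero entry is \<open>\<theta> x / B\<close> has norm at most
  \<open>1\<close> and competes in the supremum; the factor \<open>B\<close> undoes the
  scaling.\<close>

lemma D2_TV_pairing_bound:
  fixes \<theta> :: "real^'n \<Rightarrow> real" and u :: "real^'n \<Rightarrow> real^'m"
  assumes T: "D2_TV U u \<le> ennreal T" "0 \<le> T"
    and \<theta>: "\<theta> \<in> test_functions U" "\<And>x. \<bar>\<theta> x\<bar> \<le> B" "0 < B"
  shows "\<bar>LINT x|lebesgue. u x $ i * partial j (partial k \<theta>) x\<bar> \<le> B * T"
proof -
  define \<Phi> :: "real^'n \<Rightarrow> real^'n^'n^'m" where "\<Phi> x = axis i (axis j (axis k (\<theta> x / B)))" for x
  have eq: "(\<lambda>y. \<Phi> y $ i' $ j' $ k') = (if i' = i \<and> j' = j \<and> k' = k then (\<lambda>y. (1 / B) * \<theta> y) else (\<lambda>y. 0))" for i' j' k'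
    unfolding \<Phi>_def axis_def by (simp add: fun_eq_iff)
  have "norm (\<Phi> x) \<le> 1" for x
    unfolding \<Phi>_def norm_axis using \<theta>(2)[of x] \<theta>(3) by simp
  moreover have "(\<lambda>y. \<Phi> y $ i' $ j' $ k') \<in> test_functions U" for i' j' k'
    unfolding eq by (cases "i' = i \<and> j' = j \<and> k' = k")
      (simp_all only: if_True if_False test_function_cmult[OF \<theta>(1)] zero_test_function simp_thms)
  ultimately have "ennreal \<bar>D2_pairing U u \<Phi>\<bar> \<le> D2_TV U u"
    unfolding D2_TV_def by (intro SUP_upper) auto
  from order_trans[OF this T(1)] have "\<bar>D2_pairing U u \<Phi>\<bar> \<le> T"
    using T(2) by (simp add: ennreal_le_iff)
  moreover have "D2_pairing U u \<Phi> = (1 / B) * (LINT x|lebesgue. u x $ i * partial j (partial k \<theta>) x)"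
  proof -
    let ?I = "(1 / B) * (LINT x|lebesgue. u x $ i * partial j (partial k \<theta>) x)"
    note sm = test_function_smooth[OF \<theta>(1)]
    have p: "partial j' (partial k' (\<lambda>y. \<Phi> y $ i' $ j' $ k')) = 
      (if i' = i \<and> j' = j \<and> k' = k then (\<lambda>x. (1 / B) * partial j (partial k \<theta>) x) else (\<lambda>y. 0))" for i' j' k'
      unfolding eq by (cases "i' = i \<and> j' = j \<and> k' = k")
        (simp_all only: partial_cmult[OF sm] partial_cmult[OF smooth_partial[OF sm]] if_True if_False partial_const simp_thms)
    obtain K where K: "K \<subseteq> U" "\<And>x. x \<notin> K \<Longrightarrow> partial j (partial k \<theta>) x = 0"
      using test_function_support[OF test_function_partial[OF test_function_partial[OF \<theta>(1)]]] by metis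
    have "(LINT x:U|lebesgue. u x $ i' * partial j' (partial k' (\<lambda>y. \<Phi> y $ i' $ j' $ k')) x) = 
       (if i' = i \<and> j' = j \<and> k' = k then ?I else 0)" for i' j' k'
    proof (cases "i' = i \<and> j' = j \<and> k' = k")
      case True
      have "(LINT x:U|lebesgue. u x $ i' * partial j' (partial k' (\<lambda>y. \<Phi> y $ i' $ j' $ k')) x) = 
         (LINT x|lebesgue. (1 / B) * (u x $ i * partial j (partial k \<theta>) x))"
        unfolding set_lebesgue_integral_def p using True K
        by (intro Bochner_Integration.integral_cong refl) (auto simp: indicator_def)
      then show ?thesis using True by (simp only: integral_mult_right_zero if_True simp_thms)
    next
      case False
      then have z: "partial j' (partial k' (\<lambda>y. \<Phi> y $ i' $ j' $ k')) = (\<lambda>y. 0)" unfolding p by (simp only: if_False)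
      show ?thesis unfolding z if_not_P[OF False] by (simp add: set_lebesgue_integral_def)
    qed
    then have "D2_pairing U u \<Phi> = (\<Sum>i'\<in>UNIV. \<Sum>j'\<in>UNIV. \<Sum>k'\<in>UNIV. if i' = i \<and> j' = j \<and> k' = k then ?I else 0)"
      unfolding D2_pairing_def by simp
    also have "\<dots> = (\<Sum>i'\<in>UNIV. \<Sum>j'\<in>UNIV. if i' = i \<and> j' = j then ?I else 0)"
      by (intro sum.cong refl) (auto simp: sum.delta)
    also have "\<dots> = (\<Sum>i'\<in>UNIV. if i' = i then ?I else 0)"
      by (intro sum.cong refl) (auto simp: sum.delta)
    finally show ?thesis by simp
  qed
  ultimately show ?thesis using \<theta>(3) by (simp add: abs_mult field_simps)
qed

section \<open>Interpolation between the second derivative and the second partial derivative\<close>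

locale clamped =
  fixes u :: "real^2 \<Rightarrow> real^2" and G :: "real^2 \<Rightarrow> real^2^2" and \<mu> b :: real
  assumes wg: "weak_gradient u G" 
    and bd: "AE x in lebesgue. x \<notin> cbox 0 1 \<longrightarrow> u x $ 1 = \<mu> * x $ 1 + b"
begin

definition v :: "real^2 \<Rightarrow> real" where "v x = u x $ 1 - (\<mu> * x $ 1 + b)"

lemma affine_integrable:
  fixes \<phi> :: "real^2 \<Rightarrow> real"
  assumes "continuous_on UNIV \<phi>" "\<And>x. x \<notin> cbox a c \<Longrightarrow> \<phi> x = 0"
  shows "integrable lebesgue (\<lambda>x. (\<mu> * x $ 1 + b) * \<phi> x)"
  by (rule integrable_continuous_box[of _ a c]) (auto intro!: continuous_intros assms)

lemma u_integrable:
  fixes \<phi> :: "real^2 \<Rightarrow> real"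
  assumes "continuous_on UNIV \<phi>" "\<And>x. x \<notin> cbox a c \<Longrightarrow> \<phi> x = 0"
  shows "integrable lebesgue (\<lambda>x. u x $ 1 * \<phi> x)"
  by (rule integrable_mult_compact[of _ a c]) (use assms weak_gradient_component[OF wg] in auto)

lemma v_integrable:
  fixes \<phi> :: "real^2 \<Rightarrow> real"
  assumes "continuous_on UNIV \<phi>" "\<And>x. x \<notin> cbox a c \<Longrightarrow> \<phi> x = 0"
  shows "integrable lebesgue (\<lambda>x. v x * \<phi> x)"
  using Bochner_Integration.integrable_diff[OF u_integrable[of \<phi> a c] affine_integrable[of \<phi> a c]] assms
  by (simp add: v_def left_diff_distrib)

lemma v_integral:
  fixes \<phi> :: "real^2 \<Rightarrow> real"
  assumes "continuous_on UNIV \<phi>" "\<And>x. x \<notin> cbox a c \<Longrightarrow> \<phi> x = 0"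
  shows "(LINT x|lebesgue. v x * \<phi> x) = (LINT x|lebesgue. u x $ 1 * \<phi> x) - (LINT x|lebesgue. (\<mu> * x $ 1 + b) * \<phi> x)"
  using Bochner_Integration.integral_diff[OF u_integrable[of \<phi> a c] affine_integrable[of \<phi> a c]] assms
  by (simp add: v_def left_diff_distrib)

lemma G_integrable:
  fixes \<phi> :: "real^2 \<Rightarrow> real"
  assumes "continuous_on UNIV \<phi>" "\<And>x. x \<notin> cbox a c \<Longrightarrow> \<phi> x = 0"
  shows "integrable lebesgue (\<lambda>x. G x $ 1 $ j * \<phi> x)"
  by (rule integrable_mult_compact[of _ a c]) (use assms weak_gradient_component[OF wg] in auto)

lemma v_weak_derivative:
  assumes "\<phi> \<in> test_functions UNIV"
  shows "(LINT x|lebesgue. v x * partial j \<phi> x) = - (LINT x|lebesgue. (G x $ 1 $ j - Fmat \<mu> $ 1 $ j) * \<phi> x)"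
proof -
  obtain a c where ac: "\<And>x. x \<notin> cbox a c \<Longrightarrow> \<phi> x = 0" using test_function_box[OF assms] by blast
  note sm = test_function_smooth[OF assms]
  have p0: "partial j \<phi> x = 0" if "x \<notin> cbox a c" for x
    using partial_zero_outside[of a c \<phi>] ac that by blast
  have F: "Fmat \<mu> $ 1 $ j = (if 1 = j then \<mu> else 0)" 
    using exhaust_2[of j] by auto
  have i: "integrable lebesgue (\<lambda>x. G x $ 1 $ j * \<phi> x)" "integrable lebesgue (\<lambda>x. Fmat \<mu> $ 1 $ j * \<phi> x)"
    using G_integrable[OF smooth_continuous[OF sm], of a c] ac
      integrable_continuous_box[of \<phi> a c] smooth_continuous[OF sm] by auto
  have "(LINT x|lebesgue. v x * partial j \<phi> x) = (LINT x|lebesgue. u x $ 1 * partial j \<phi> x) - (LINT x|lebesgue. (\<mu> * x $ 1 + b) * partial j \<phi> x)"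
    by (rule v_integral[OF smooth_continuous[OF smooth_partial[OF sm]] p0])
  also have "\<dots> = - (LINT x|lebesgue. G x $ 1 $ j * \<phi> x) + (LINT x|lebesgue. Fmat \<mu> $ 1 $ j * \<phi> x)"
    unfolding weak_gradient_component(5)[OF wg assms] weak_derivative_affine[OF assms] F by simp
  also have "\<dots> = - (LINT x|lebesgue. G x $ 1 $ j * \<phi> x - Fmat \<mu> $ 1 $ j * \<phi> x)"
    by (subst Bochner_Integration.integral_diff[OF i]) simp
  finally show ?thesis by (simp add: left_diff_distrib)
qed

lemma v_outside:
  assumes "\<And>x. x \<in> cbox 0 1 \<Longrightarrow> f x = 0"
  shows "(LINT x|lebesgue. v x * f x) = 0"
proof -
  have "AE x in lebesgue. v x * f x = 0"
    using bd by eventually_elim (auto simp: v_def assms)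
  then show ?thesis by (rule integral_eq_zero_AE)
qed

text \<open>On the open complement of the square \<open>v\<close> vanishes, hence so does its weak
  derivative. The primitive \<open>H\<close> in \<open>interpolation\<close> leaves the square,
  while the energy controls the gradient only inside.\<close>

lemma G12_outside: "AE x in lebesgue. x \<notin> cbox 0 1 \<longrightarrow> G x $ 1 $ 2 = 0"
proof -
  have "AE x in lebesgue. x \<in> - cbox 0 1 \<longrightarrow> G x $ 1 $ 2 = 0"
  proof (rule fundamental_lemma)
    fix \<psi> :: "real^2 \<Rightarrow> real" assume \<psi>: "\<psi> \<in> test_functions (- cbox 0 1)"
    obtain K where K: "K \<subseteq> - cbox 0 1" "\<And>x. x \<notin> K \<Longrightarrow> partial 2 \<psi> x = 0"
      using test_function_support[OF test_function_partial[OF \<psi>]] by metis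
    have "(LINT x|lebesgue. v x * partial 2 \<psi> x) = 0"
      using K by (intro v_outside) auto
    then show "(LINT x|lebesgue. G x $ 1 $ 2 * \<psi> x) = 0"
      using v_weak_derivative[OF test_function_mono[OF \<psi>], of 2] by simp
  qed (use weak_gradient_component[OF wg] in auto)
  then show ?thesis by simp
qed

text \<open>A test function \<open>\<psi>\<close> is split as \<open>\<partial>\<^sub>1 \<Theta> + S / \<delta>\<close>, where \<open>S / \<delta>\<close> is its average over shifts
  up to \<open>\<delta>\<close>.  The first part is paired with \<open>D\<^sup>2 u\<close>.  The derivative of the second one is the
  difference quotient \<open>h / \<delta>\<close>, whose primitive \<open>H\<close> in direction \<open>x $ 2\<close> reaches beyond the square:
  there the boundary values of \<open>u\<close> enter.\<close>

lemma interpolation: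
  assumes T: "D2_TV (box 0 1) u \<le> ennreal T" "0 \<le> T" and \<delta>: "0 < \<delta>" "\<delta> \<le> 1 / 8"
  shows "(LINT x:cbox (\<chi> i. 1/4) (\<chi> i. 3/4)|lebesgue. \<bar>G x $ 1 $ 1 - \<mu>\<bar>) 
    \<le> \<delta> * T + 4 / \<delta> * (LINT x:cbox 0 1|lebesgue. \<bar>G x $ 1 $ 2\<bar>)"
proof (rule L1_duality)
  show "(\<lambda>x. G x $ 1 $ 1 - \<mu>) \<in> borel_measurable lebesgue"
    by (intro borel_measurable_diff weak_gradient_component[OF wg]) auto
  show "set_integrable lebesgue (cbox (\<chi> i. 1/4) (\<chi> i. 3/4)) (\<lambda>x. G x $ 1 $ 1 - \<mu>)"
    by (intro set_integral_diff weak_gradient_component[OF wg] absolutely_integrable_continuous) auto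
  fix \<psi> :: "real^2 \<Rightarrow> real"
  assume \<psi>: "smooth \<psi>" "\<And>x. \<bar>\<psi> x\<bar> \<le> 1" "\<And>x. x \<notin> cbox (\<chi> i. 1/4) (\<chi> i. 3/4) \<Longrightarrow> \<psi> x = 0"
  let ?a = "(\<chi> i. 1/4) :: real^2" and ?b = "(\<chi> i. 3/4) :: real^2" and ?e = "axis 1 1 :: real^2"
  \<comment> \<open>\<open>7 / 8 = 3 / 4 + 1 / 8\<close> contains the supports after a shift by at
    most \<open>\<delta>\<close> and still lies inside the open square, as the pairing with
    \<open>D2_TV\<close> demands.\<close>
  define c :: "real^2" where "c = (\<chi> i. 7/8)"
  have bc: "cbox ?a (?b + \<delta> *\<^sub>R ?e) \<subseteq> cbox ?a c" "cbox ?a ?b \<subseteq> cbox ?a c" "cbox ?a c \<subseteq> box 0 1"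
    using \<delta> by (auto simp: mem_box_cart forall_2 axis_def c_def; smt (verit))+
  define \<Theta> where "\<Theta> = avg (1 / \<delta>) \<delta> 1 \<psi>"
  define S where "S = avg 0 \<delta> 1 \<psi>"
  define h where "h x = \<psi> x - \<psi> (x - \<delta> *\<^sub>R ?e)" for x
  \<comment> \<open>The length \<open>2\<close> exceeds the height of the square: the second term of
    \<open>partial 2 H\<close> lives where \<open>v\<close> vanishes, so \<open>v\<close> sees only
    \<open>h\<close>. Together with the bound \<open>2\<close> on \<open>h\<close> this length
    produces the constant \<open>4\<close>.\<close>
  define H where "H = avg 0 2 2 h"
  have \<Theta>0: "\<Theta> x = 0" and S0: "S x = 0" if "x \<notin> cbox ?a c" for x
    using avg_support[of ?a ?b \<psi> x \<delta> 1] \<psi>(3) bc that unfolding \<Theta>_def S_def by blast+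
  have sm: "smooth \<Theta>" "smooth S" unfolding \<Theta>_def S_def by (intro smooth_avg \<psi>)+
  have \<Theta>t: "\<Theta> \<in> test_functions (box 0 1)" and St: "S \<in> test_functions (box 0 1)"
    using sm \<Theta>0 S0 bc(3) by (auto intro: test_functionI)
  have dS: "partial 1 S = h"
    using partial_avg_parts[OF \<psi>(1), of \<delta> 1 0] \<delta> by (auto simp: fun_eq_iff S_def h_def)
  have d\<Theta>: "partial 1 \<Theta> x = \<psi> x - (1 / \<delta>) * S x" for x
    using partial_avg_parts[OF \<psi>(1), of \<delta> 1 "1 / \<delta>"] \<delta> by (simp add: \<Theta>_def S_def)
  have \<Theta>B: "\<bar>\<Theta> x\<bar> \<le> \<delta>" for x
    using avg_bound[OF \<psi>(1), of \<delta> "1 / \<delta>" 1] \<psi>(2) \<delta> by (simp add: \<Theta>_def)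
  have hs: "smooth h" unfolding dS[symmetric] by (rule smooth_partial[OF sm(2)])
  have h0: "h x = 0" if "x \<notin> cbox ?a c" for x
    using partial_zero_outside[of ?a c S] S0 that dS by blast
  have hB: "\<bar>h x\<bar> \<le> 2" for x
    using \<psi>(2)[of x] \<psi>(2)[of "x - \<delta> *\<^sub>R ?e"] unfolding h_def by linarith
  have HB: "\<bar>H x\<bar> \<le> 4" for x
    using avg_bound[OF hs, of 2 0 2 2 x] hB by (simp add: H_def)
  have H0: "H x = 0" if "x \<notin> cbox ?a (c + 2 *\<^sub>R axis 2 1)" for x
    unfolding H_def by (rule avg_support[OF h0 that])
  have Hs: "smooth H" unfolding H_def by (rule smooth_avg[OF hs])
  have Ht: "H \<in> test_functions UNIV" by (rule test_functionI[OF Hs H0]) auto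
  have dH: "partial 2 H x = h x - h (x - 2 *\<^sub>R axis 2 1)" for x
    using partial_avg_parts[OF hs, of 2 2 0 x] by (simp add: H_def)
  have TV: "\<bar>LINT x|lebesgue. v x * partial 1 (partial 1 \<Theta>) x\<bar> \<le> \<delta> * T"
  proof -
    let ?p = "partial 1 (partial 1 \<Theta>)"
    have z: "?p x = 0" if "x \<notin> cbox ?a c" for x
      using partial_zero_outside[of ?a c "partial 1 \<Theta>"] partial_zero_outside[of ?a c \<Theta>] \<Theta>0 that by blast
    have "(LINT x|lebesgue. (\<mu> * x $ 1 + b) * ?p x) = - (LINT x|lebesgue. \<mu> * partial 1 \<Theta> x)"
      using weak_derivative_affine[OF test_function_partial[OF test_function_mono[OF \<Theta>t]], where i=1 and j=1] by simp
    \<comment> \<open>The constant \<open>1\<close> is written as an affine function of slope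
      \<open>0\<close>, so that \<open>weak_derivative_affine\<close> shows that a derivative of a
      test function has integral \<open>0\<close>. Hence the affine part of \<open>u\<close> does
      not contribute to the second-order pairing.\<close>
    also have "\<dots> = - \<mu> * (LINT x|lebesgue. (0 * x $ 1 + 1) * partial 1 \<Theta> x)" by simp
    also have "\<dots> = 0"
      unfolding weak_derivative_affine[OF test_function_mono[OF \<Theta>t]] by simp
    finally have "(LINT x|lebesgue. v x * ?p x) = (LINT x|lebesgue. u x $ 1 * ?p x)"
      using v_integral[OF smooth_continuous[OF smooth_partial[OF smooth_partial[OF sm(1)]]] z] by simp
    then show ?thesis using D2_TV_pairing_bound[OF T \<Theta>t \<Theta>B \<delta>(1)] by simp
  qed
  have vh: "\<bar>LINT x|lebesgue. v x * h x\<bar> \<le> 4 * (LINT x:cbox 0 1|lebesgue. \<bar>G x $ 1 $ 2\<bar>)"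
  proof -
    have sh: "smooth (\<lambda>x. h (x - 2 *\<^sub>R axis 2 1))"
      using smooth_shift[OF hs, of "- 2 *\<^sub>R axis 2 1"] by simp
    have sh0: "h (x - 2 *\<^sub>R axis 2 1) = 0" if "x \<notin> cbox (?a + 2 *\<^sub>R axis 2 1) (c + 2 *\<^sub>R axis 2 1)" for x
    proof (rule h0)
      show "x - 2 *\<^sub>R axis 2 1 \<notin> cbox ?a c" using that by (auto simp: mem_box_cart algebra_simps)
    qed
    have i: "integrable lebesgue (\<lambda>x. v x * h x)" "integrable lebesgue (\<lambda>x. v x * h (x - 2 *\<^sub>R axis 2 1))"
      by (rule v_integrable[OF smooth_continuous[OF hs] h0], assumption)
        (rule v_integrable[OF smooth_continuous[OF sh] sh0], assumption)
    have "(LINT x|lebesgue. v x * h (x - 2 *\<^sub>R axis 2 1)) = 0"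
    proof (rule v_outside, rule h0)
      fix x :: "real^2" assume "x \<in> cbox 0 1"
      then show "x - 2 *\<^sub>R axis 2 1 \<notin> cbox ?a c" by (auto simp: mem_box_cart forall_2 axis_def)
    qed
    then have "(LINT x|lebesgue. v x * h x) = (LINT x|lebesgue. v x * h x - v x * h (x - 2 *\<^sub>R axis 2 1))"
      by (subst Bochner_Integration.integral_diff[OF i]) simp
    also have "\<dots> = (LINT x|lebesgue. v x * partial 2 H x)"
      by (simp add: dH right_diff_distrib)
    also have "\<dots> = - (LINT x|lebesgue. G x $ 1 $ 2 * H x)"
      using v_weak_derivative[OF Ht, of 2] by simp
    finally have "\<bar>LINT x|lebesgue. v x * h x\<bar> = \<bar>LINT x|lebesgue. G x $ 1 $ 2 * H x\<bar>" by simp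
    also have "\<dots> \<le> (LINT x|lebesgue. \<bar>G x $ 1 $ 2 * H x\<bar>)"
      using integral_norm_bound[of lebesgue "\<lambda>x. G x $ 1 $ 2 * H x"] by simp
    also have "\<dots> \<le> (LINT x|lebesgue. 4 * (indicator (cbox 0 1) x *\<^sub>R \<bar>G x $ 1 $ 2\<bar>))"
    proof (rule integral_mono_AE)
      show "integrable lebesgue (\<lambda>x. \<bar>G x $ 1 $ 2 * H x\<bar>)"
        using G_integrable[OF smooth_continuous[OF Hs] H0] by (intro integrable_abs)
      show "integrable lebesgue (\<lambda>x. 4 * (indicator (cbox 0 1) x *\<^sub>R \<bar>G x $ 1 $ 2\<bar>))"
        using set_integrable_abs[OF weak_gradient_component(4)[OF wg compact_cbox]] 
        by (intro integrable_mult_right) (simp add: set_integrable_def)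
      show "AE x in lebesgue. \<bar>G x $ 1 $ 2 * H x\<bar> \<le> 4 * (indicator (cbox 0 1) x *\<^sub>R \<bar>G x $ 1 $ 2\<bar>)"
        using G12_outside
      proof eventually_elim
        case (elim x)
        then show ?case using mult_left_mono[OF HB[of x], of "\<bar>G x $ 1 $ 2\<bar>"] 
          by (cases "x \<in> cbox 0 1") (auto simp: abs_mult mult.commute)
      qed
    qed
    finally show ?thesis by (simp only: integral_mult_right_zero set_lebesgue_integral_def)
  qed
  let ?g = "\<lambda>x. G x $ 1 $ 1 - \<mu>"
  have iS: "integrable lebesgue (\<lambda>x. ?g x * S x)" and i\<Theta>: "integrable lebesgue (\<lambda>x. ?g x * partial 1 \<Theta> x)"
  proof -
    have *: "integrable lebesgue (\<lambda>x. ?g x * f x)" if "continuous_on UNIV f" "\<And>x. x \<notin> cbox ?a c \<Longrightarrow> f x = 0" for f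
      using Bochner_Integration.integrable_diff[OF G_integrable[OF that, where j=1] 
          integrable_mult_right[OF integrable_continuous_box[OF that], of \<mu>]]
      by (simp add: left_diff_distrib)
    show "integrable lebesgue (\<lambda>x. ?g x * S x)"
      by (rule *[OF smooth_continuous[OF sm(2)] S0])
    show "integrable lebesgue (\<lambda>x. ?g x * partial 1 \<Theta> x)"
      by (rule *[OF smooth_continuous[OF smooth_partial[OF sm(1)]]], rule partial_zero_outside[of ?a c], rule \<Theta>0)
  qed
  have "(LINT x|lebesgue. ?g x * \<psi> x) = (LINT x|lebesgue. ?g x * partial 1 \<Theta> x + (1 / \<delta>) * (?g x * S x))"
    by (intro Bochner_Integration.integral_cong refl) (simp add: d\<Theta> algebra_simps)
  also have "\<dots> = (LINT x|lebesgue. ?g x * partial 1 \<Theta> x) + (1 / \<delta>) * (LINT x|lebesgue. ?g x * S x)"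
    using i\<Theta> iS by (subst Bochner_Integration.integral_add) auto
  also have "\<dots> = - (LINT x|lebesgue. v x * partial 1 (partial 1 \<Theta>) x) - (1 / \<delta>) * (LINT x|lebesgue. v x * h x)"
    using v_weak_derivative[OF test_function_partial[OF test_function_mono[OF \<Theta>t]], of 1 1] 
      v_weak_derivative[OF test_function_mono[OF St], of 1] dS by simp
  also have "\<dots> \<le> \<delta> * T + (1 / \<delta>) * (4 * (LINT x:cbox 0 1|lebesgue. \<bar>G x $ 1 $ 2\<bar>))"
  proof -
    have "- ((1 / \<delta>) * (LINT x|lebesgue. v x * h x)) \<le> (1 / \<delta>) * (4 * (LINT x:cbox 0 1|lebesgue. \<bar>G x $ 1 $ 2\<bar>))"
      unfolding mult_minus_right[symmetric] using vh \<delta> by (intro mult_left_mono) auto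
    then show ?thesis using TV by linarith
  qed
  finally show "(LINT x|lebesgue. ?g x * \<psi> x) \<le> \<delta> * T + 4 / \<delta> * (LINT x:cbox 0 1|lebesgue. \<bar>G x $ 1 $ 2\<bar>)"
    by simp
qed

end


section \<open>Distance to the wells and the energy lower bound\<close>

lemma infdist_K2:
  obtains \<sigma> where "\<bar>\<sigma>\<bar> = 1" "infdist A K2 = norm (A - Fmat \<sigma>)"
proof -
  have "closed K2" "K2 \<noteq> {}" by (auto simp: K2_Fmat)
  then obtain y where "y \<in> K2" "infdist A K2 = dist A y"
    using infdist_attains_inf by blast
  then show thesis using that[of 1] that[of "-1"] by (auto simp: K2_Fmat dist_norm)
qed

lemma component_le_norm_matrix: "\<bar>(A :: real^'n^'m) $ i $ j\<bar> \<le> norm A"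
  using component_le_norm_cart[of "A $ i" j] Finite_Cartesian_Product.norm_nth_le[of A i] by linarith

lemma infdist_K2_12: "\<bar>A $ 1 $ 2\<bar> \<le> infdist A K2"
proof -
  obtain \<sigma> where "infdist A K2 = norm (A - Fmat \<sigma>)" using infdist_K2 by metis
  then show ?thesis using component_le_norm_matrix[of "A - Fmat \<sigma>" 1 2] by simp
qed

text \<open>Both wells have the entry 1 or -1 here, at distance at least
  \<open>1 - \<bar>\<mu>\<bar>\<close> from \<open>\<mu>\<close>. A gradient cannot be close to the
  boundary datum and to the wells at once.\<close>

lemma infdist_K2_11: 
  assumes "\<bar>\<mu>\<bar> < 1" shows "1 - \<bar>\<mu>\<bar> \<le> \<bar>A $ 1 $ 1 - \<mu>\<bar> + infdist A K2"
proof -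
  obtain \<sigma> where "\<bar>\<sigma>\<bar> = 1" "infdist A K2 = norm (A - Fmat \<sigma>)" using infdist_K2 by metis
  then show ?thesis using component_le_norm_matrix[of "A - Fmat \<sigma>" 1 1] assms by simp
qed

text \<open>Takes the place of Jensen's inequality for \<open>\<lambda>d. d powr p\<close>.\<close>

lemma le_add_powr:
  fixes d r p :: real
  assumes "0 \<le> d" "0 < r" "1 \<le> p"
  shows "d \<le> r + r powr (1 - p) * d powr p"
proof (cases "d \<le> r")
  case False
  then have "d powr (1 - p) \<le> r powr (1 - p)" using assms by (intro powr_mono2') auto
  then have "d powr (1 - p) * d powr p \<le> r powr (1 - p) * d powr p" by (rule mult_right_mono) auto
  moreover have "d powr (1 - p) * d powr p = d" using False assms by (simp add: powr_add[symmetric])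
  ultimately show ?thesis using assms by linarith
qed (use assms in \<open>auto intro: add_increasing2\<close>)

lemma measure_cbox_const: "a \<le> b \<Longrightarrow> measure lebesgue (cbox (\<chi> i::2. a) (\<chi> i. b)) = (b - a)\<^sup>2"
  by (simp add: content_cbox_if_cart interval_eq_empty_cart not_less UNIV_2 power2_eq_square)

lemma emeasure_lborel_cbox_eq_measure: "emeasure lborel (cbox a b) = ennreal (measure lborel (cbox a b))"
  by (rule emeasure_eq_ennreal_measure) (use emeasure_lborel_cbox_finite[of a b] in \<open>simp add: less_top\<close>)

lemma unit_box: "(0::real^2) = (\<chi> i. 0)" "(1::real^2) = (\<chi> i. 1)"
  by (auto simp: vec_eq_iff)

text \<open>If the energy were smaller, both its parts would be below \<open>r powr p\<close>. Then
  \<open>infdist_K2_11\<close>, integrated over the inner square of area \<open>1 / 4\<close>,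
  contradicts the smallness of its right-hand side given by \<open>interpolation\<close>.\<close>

lemma energy_lower_bound:
  assumes p: "1 \<le> p" and \<mu>: "\<bar>\<mu>\<bar> < 1" and u: "u \<in> admissible p (Fmat \<mu>)" and \<epsilon>: "0 < \<epsilon>" "\<epsilon> < 1"
  shows "ennreal (((1 - \<bar>\<mu>\<bar>) / 600) powr p * \<epsilon> powr (p / (p + 1))) \<le> energy p \<epsilon> u"
proof (rule ccontr)
  assume "\<not> ?thesis"
  then have less: "energy p \<epsilon> u < ennreal (((1 - \<bar>\<mu>\<bar>) / 600) powr p * \<epsilon> powr (p / (p + 1)))" by simp
  define G where "G = grad u"
  obtain b where b: "AE x in lebesgue. x \<notin> cbox 0 1 \<longrightarrow> u x = Fmat \<mu> *v x + b"
    using u by (auto simp: admissible_def)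
  have "\<exists>G. weak_gradient u G" using u by (auto simp: admissible_def W1p_loc_def)
  then have wg: "weak_gradient u G" unfolding G_def grad_def by (rule someI_ex)
  interpret clamped u G \<mu> "b $ 1"
    by unfold_locales (use wg b in \<open>auto elim!: eventually_mono\<close>)
  \<comment> \<open>With this \<open>c\<close> the integral of \<open>1 - \<bar>\<mu>\<bar>\<close>
    over the inner square is \<open>150 * c\<close>, which has to exceed the total
    \<open>c / 16 + 128 * c + 2 * c\<close> of the upper bounds.\<close>
  define c e where "c = (1 - \<bar>\<mu>\<bar>) / 600" and "e = \<epsilon> powr (1 / (p + 1))"
  define r where "r = c * e"
  have c: "0 < c" "c \<le> 1" using \<mu> by (auto simp: c_def)
  have e: "0 < e" "e < 1" using \<epsilon> p powr_less_mono2[of "1 / (p + 1)" \<epsilon> 1] by (auto simp: e_def)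
  have r: "0 < r" using c e by (simp add: r_def)
  have "e powr p = \<epsilon> powr (p / (p + 1))" by (simp add: e_def powr_powr)
  then have rp: "r powr p = c powr p * \<epsilon> powr (p / (p + 1))"
    using c e by (simp add: r_def powr_mult)
  have \<epsilon>e: "\<epsilon> = e powr p * e"
  proof -
    have "e powr p * e = e powr (p + 1)" using e by (simp add: powr_add)
    also have "\<dots> = \<epsilon> powr 1" unfolding e_def powr_powr using p by simp
    finally show ?thesis using \<epsilon> by simp
  qed
  define d where "d x = infdist (G x) K2" for x
  have d0: "0 \<le> d x" for x by (simp add: d_def infdist_nonneg)
  have Gm: "G \<in> borel_measurable lebesgue" using wg by (auto simp: weak_gradient_def Lp_loc_def)
  have dm: "d \<in> borel_measurable lebesgue"
    unfolding d_def[abs_def]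
    by (rule measurable_compose[OF Gm]) (intro borel_measurable_continuous_onI continuous_intros)
  define P where "P = (\<integral>\<^sup>+x\<in>cbox 0 1. ennreal (d x powr p) \<partial>lebesgue)"
  have en: "P + ennreal \<epsilon> * D2_TV (box 0 1) u < ennreal (r powr p)"
    using less unfolding energy_def P_def d_def G_def rp c_def by simp
  have P: "P \<le> ennreal (r powr p)"
    by (rule order_trans[OF add_increasing2[OF zero_le order_refl] less_imp_le[OF en]])
  have TV: "ennreal \<epsilon> * D2_TV (box 0 1) u \<le> ennreal (r powr p)"
    by (rule order_trans[OF add_increasing[OF zero_le order_refl] less_imp_le[OF en]])
  have T: "D2_TV (box 0 1) u \<le> ennreal (c / e)"
  proof (cases "D2_TV (box 0 1) u")
    case (real T)
    then have "ennreal (\<epsilon> * T) \<le> ennreal (r powr p)" using TV \<epsilon> by (simp add: ennreal_mult)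
    then have "\<epsilon> * T \<le> c powr p * e powr p" using c e by (simp add: r_def powr_mult)
    then have "e powr p * (e * T) \<le> e powr p * c powr p" by (subst (asm) \<epsilon>e) (simp add: mult_ac)
    then have "e * T \<le> c powr p" using e by (simp add: mult_le_cancel_left)
    also have "c powr p \<le> c" using powr_mono'[of 1 p c] c p by simp
    finally show ?thesis using e real by (simp add: ennreal_leI field_simps)
  next
    case top
    then show ?thesis using TV \<epsilon> by (simp add: ennreal_mult_top top_unique)
  qed
  let ?\<Omega> = "cbox 0 (1::real^2)"
  let ?Q = "cbox (\<chi> i. 1/4) ((\<chi> i. 3/4)::real^2)"
  \<comment> \<open>The threshold \<open>r\<close> balances the two terms of
    \<open>le_add_powr\<close>: on a square of area \<open>1\<close> each contributes at most
    \<open>r\<close>.\<close>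
  have "(\<integral>\<^sup>+x. ennreal (indicator ?\<Omega> x * d x) \<partial>lebesgue) \<le> 
      (\<integral>\<^sup>+x. ennreal r * indicator ?\<Omega> x + ennreal (r powr (1 - p)) * (ennreal (d x powr p) * indicator ?\<Omega> x) \<partial>lebesgue)"
  proof (rule nn_integral_mono)
    fix x
    have "ennreal (d x) \<le> ennreal (r + r powr (1 - p) * d x powr p)"
      using le_add_powr[OF d0 r p] by (rule ennreal_leI)
    then show "ennreal (indicator ?\<Omega> x * d x) \<le> 
      ennreal r * indicator ?\<Omega> x + ennreal (r powr (1 - p)) * (ennreal (d x powr p) * indicator ?\<Omega> x)"
      using r by (cases "x \<in> ?\<Omega>") (auto simp: ennreal_plus ennreal_mult)
  qed
  also have "\<dots> = ennreal r * emeasure lebesgue ?\<Omega> + ennreal (r powr (1 - p)) * P"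
  proof -
    have "(\<lambda>x. ennreal (d x powr p) * indicator ?\<Omega> x) \<in> borel_measurable lebesgue"
      using dm by (intro borel_measurable_times_ennreal borel_measurable_indicator measurable_compose[OF _ measurable_ennreal] powr_real_measurable borel_measurable_const) auto
    moreover have "(\<lambda>x. ennreal r * indicator ?\<Omega> x) \<in> borel_measurable lebesgue"
      by (intro borel_measurable_times_ennreal borel_measurable_indicator borel_measurable_const) simp
    ultimately show ?thesis
      by (simp add: nn_integral_add nn_integral_cmult nn_integral_cmult_indicator borel_measurable_times_ennreal P_def)
  qed
  also have "emeasure lebesgue ?\<Omega> = 1"
    using measure_cbox_const[of 0 1] unfolding unit_box by (simp add: emeasure_lborel_cbox_eq_measure)
  also have "ennreal (r powr (1 - p)) * P \<le> ennreal (r powr (1 - p)) * ennreal (r powr p)"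
    using P by (rule mult_left_mono) simp
  also have "\<dots> = ennreal r" using r by (simp add: ennreal_mult[symmetric] powr_add[symmetric])
  finally have NI: "(\<integral>\<^sup>+x. ennreal (indicator ?\<Omega> x * d x) \<partial>lebesgue) \<le> ennreal (2 * r)"
    using r by (simp add: ennreal_plus[symmetric] del: ennreal_plus)
  have di: "integrable lebesgue (\<lambda>x. indicator ?\<Omega> x * d x)"
  proof (rule integrableI_nonneg)
    show "(\<lambda>x. indicator ?\<Omega> x * d x) \<in> borel_measurable lebesgue"
      by (intro borel_measurable_times dm borel_measurable_indicator) simp
  qed (use d0 le_less_trans[OF NI ennreal_less_top] in auto)
  have "ennreal (LINT x|lebesgue. indicator ?\<Omega> x * d x) \<le> ennreal (2 * r)"
    using NI by (subst (asm) nn_integral_eq_integral[OF di]) (auto simp: d0)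
  then have I: "(LINT x|lebesgue. indicator ?\<Omega> x * d x) \<le> 2 * r" using r by (simp add: ennreal_le_iff)
  \<comment> \<open>Here \<open>\<delta> = e / 16\<close>, below \<open>1 / 8\<close> because
    \<open>e < 1\<close>. The second derivative contributes \<open>c / 16\<close> and the bound
    \<open>2 * r\<close> on the other integral gives \<open>128 * c\<close>, both independent of
    \<open>\<epsilon>\<close>.\<close>
  have J0: "(LINT x:?Q|lebesgue. \<bar>G x $ 1 $ 1 - \<mu>\<bar>) \<le> (e / 16) * (c / e) + 4 / (e / 16) * (LINT x:?\<Omega>|lebesgue. \<bar>G x $ 1 $ 2\<bar>)"
    by (rule interpolation[OF T]) (use c e in auto)
  have "(LINT x:?\<Omega>|lebesgue. \<bar>G x $ 1 $ 2\<bar>) \<le> 2 * r"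
  proof -
    have "(LINT x:?\<Omega>|lebesgue. \<bar>G x $ 1 $ 2\<bar>) \<le> (LINT x|lebesgue. indicator ?\<Omega> x * d x)"
      unfolding set_lebesgue_integral_def
    proof (rule integral_mono)
      show "integrable lebesgue (\<lambda>x. indicator ?\<Omega> x *\<^sub>R \<bar>G x $ 1 $ 2\<bar>)"
        using set_integrable_abs[OF weak_gradient_component(4)[OF wg compact_cbox]] by (simp add: set_integrable_def)
      show "indicator ?\<Omega> x *\<^sub>R \<bar>G x $ 1 $ 2\<bar> \<le> indicator ?\<Omega> x * d x" for x
        using infdist_K2_12[of "G x"] by (simp add: d_def mult_left_mono)
    qed (rule di)
    then show ?thesis using I by linarith
  qed
  then have "4 / (e / 16) * (LINT x:?\<Omega>|lebesgue. \<bar>G x $ 1 $ 2\<bar>) \<le> 4 / (e / 16) * (2 * r)"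
    using e by (intro mult_left_mono) auto
  moreover have "(e / 16) * (c / e) + 4 / (e / 16) * (2 * r) = c / 16 + 128 * c"
    using e by (simp add: r_def)
  ultimately have J: "(LINT x:?Q|lebesgue. \<bar>G x $ 1 $ 1 - \<mu>\<bar>) \<le> c / 16 + 128 * c" using J0 by linarith
  have Qi: "integrable lebesgue (\<lambda>x. indicator ?Q x *\<^sub>R \<bar>G x $ 1 $ 1 - \<mu>\<bar>)"
    using set_integrable_abs[OF set_integral_diff(1)[OF weak_gradient_component(4)[OF wg compact_cbox] 
        absolutely_integrable_continuous[OF continuous_on_const]]] by (simp add: set_integrable_def)
  have Qc: "integrable lebesgue (\<lambda>x. indicator ?Q x * (1 - \<bar>\<mu>\<bar>))"
    using absolutely_integrable_continuous[OF continuous_on_const, of "\<chi> i. 1/4" "(\<chi> i. 3/4)::real^2" "1 - \<bar>\<mu>\<bar>"] 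
    by (simp add: set_integrable_def)
  have "(LINT x|lebesgue. indicator ?Q x * (1 - \<bar>\<mu>\<bar>)) \<le> 
     (LINT x|lebesgue. indicator ?Q x *\<^sub>R \<bar>G x $ 1 $ 1 - \<mu>\<bar> + indicator ?\<Omega> x * d x)"
  proof (rule integral_mono)
    fix x
    have "x \<in> ?\<Omega>" if q: "x \<in> ?Q"
      unfolding mem_box_cart
    proof
      fix i show "(0::real^2) $ i \<le> x $ i \<and> x $ i \<le> 1 $ i"
        using q[unfolded mem_box_cart, rule_format, of i] by auto
    qed
    then show "indicator ?Q x * (1 - \<bar>\<mu>\<bar>) \<le> indicator ?Q x *\<^sub>R \<bar>G x $ 1 $ 1 - \<mu>\<bar> + indicator ?\<Omega> x * d x"
      using infdist_K2_11[OF \<mu>, of "G x"] d0[of x] by (auto simp: d_def indicator_def)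
  qed (intro Qc Qi di Bochner_Integration.integrable_add)+
  also have "\<dots> = (LINT x:?Q|lebesgue. \<bar>G x $ 1 $ 1 - \<mu>\<bar>) + (LINT x|lebesgue. indicator ?\<Omega> x * d x)"
    by (subst Bochner_Integration.integral_add[OF Qi di]) (simp add: set_lebesgue_integral_def)
  also have "(LINT x|lebesgue. indicator ?Q x * (1 - \<bar>\<mu>\<bar>)) = (1 - \<bar>\<mu>\<bar>) / 4"
    using measure_cbox_const[of "1/4" "3/4"] by (simp add: power2_eq_square)
  finally have "(1 - \<bar>\<mu>\<bar>) / 4 \<le> c / 16 + 128 * c + 2 * r" using J I by linarith
  moreover have "r \<le> c" using c e by (simp add: r_def mult_left_le)
  moreover have "(1 - \<bar>\<mu>\<bar>) / 4 = 150 * c" by (simp add: c_def)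
  ultimately have "150 * c \<le> c / 16 + 128 * c + 2 * c" by linarith
  then show False using c(1) by simp
qed

subsection \<open>Gradients of piecewise affine functions\<close>

text \<open>Identifies the arbitrarily chosen representative \<open>grad u\<close> with an explicit
  weak gradient.\<close>

lemma weak_gradient_unique:
  assumes "weak_gradient u G" "weak_gradient u H"
  shows "AE x in lebesgue. G x = H x"
proof -
  have "AE x in lebesgue. G x $ i $ j = H x $ i $ j" for i j
  proof -
    have "AE x in lebesgue. x \<in> UNIV \<longrightarrow> G x $ i $ j - H x $ i $ j = 0"
    proof (rule fundamental_lemma)
      show "(\<lambda>x. G x $ i $ j - H x $ i $ j) \<in> borel_measurable lebesgue"
        by (intro borel_measurable_diff weak_gradient_component[OF assms(1)] weak_gradient_component[OF assms(2)])
      show "set_integrable lebesgue (cbox a b) (\<lambda>x. G x $ i $ j - H x $ i $ j)" for a b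
        by (intro set_integral_diff weak_gradient_component(4)[OF assms(1)] weak_gradient_component(4)[OF assms(2)]) auto
      fix \<psi> :: "real^'a \<Rightarrow> real" assume \<psi>: "\<psi> \<in> test_functions UNIV"
      obtain a b where ab: "\<And>x. x \<notin> cbox a b \<Longrightarrow> \<psi> x = 0" using test_function_box[OF \<psi>] by blast
      have i: "integrable lebesgue (\<lambda>x. G x $ i $ j * \<psi> x)" "integrable lebesgue (\<lambda>x. H x $ i $ j * \<psi> x)"
        using assms ab
        by (auto intro!: integrable_mult_compact[where a=a and b=b] weak_gradient_component smooth_continuous[OF test_function_smooth[OF \<psi>]])
      show "(LINT x|lebesgue. (G x $ i $ j - H x $ i $ j) * \<psi> x) = 0"
        using weak_gradient_component(5)[OF assms(1) \<psi>, of i j] weak_gradient_component(5)[OF assms(2) \<psi>, of i j]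
        by (simp add: left_diff_distrib Bochner_Integration.integral_diff[OF i])
    qed simp
    then show ?thesis by simp
  qed
  then have "AE x in lebesgue. \<forall>i\<in>UNIV. \<forall>j\<in>UNIV. G x $ i $ j = H x $ i $ j"
    by (intro AE_finite_allI) auto
  then show ?thesis by eventually_elim (simp add: vec_eq_iff)
qed

text \<open>Away from the finitely many sets on which two distinct pieces agree, exactly one piece
  matches \<open>f\<close> at the point, and by continuity all others stay excluded nearby. The
  universal form over all matching pieces is what \<open>zero_set_strip\<close> exploits.\<close>

lemma AE_locally_affine:
  fixes f :: "real^'n \<Rightarrow> real" and \<A> :: "((real^'n) \<times> real) set"
  assumes f: "continuous_on UNIV f" and \<A>: "finite \<A>" "\<And>x. \<exists>(v, c)\<in>\<A>. f x = v \<bullet> x + c"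
  shows "AE x in lebesgue. \<forall>(v, c)\<in>\<A>. f x = v \<bullet> x + c \<longrightarrow> (\<forall>\<^sub>F y in nhds x. f y = v \<bullet> y + c)"
proof -
  let ?N = "\<Union>(p, q)\<in>{(p, q) \<in> \<A> \<times> \<A>. p \<noteq> q}. {x. (fst p - fst q) \<bullet> x = snd q - snd p}"
  have "finite {(p, q) \<in> \<A> \<times> \<A>. p \<noteq> q}" by (rule finite_subset[of _ "\<A> \<times> \<A>"]) (use \<A> in auto)
  \<comment> \<open>Two pieces with equal slopes differ in their constants and agree nowhere;
    \<open>negligible_hyperplane\<close> covers this case, since a nonzero offset suffices.\<close>
  then have neg: "negligible ?N"
    by (intro negligible_Union) (auto intro!: negligible_hyperplane simp: prod_eq_iff)
  have P: "\<forall>(v, c)\<in>\<A>. f x = v \<bullet> x + c \<longrightarrow> (\<forall>\<^sub>F y in nhds x. f y = v \<bullet> y + c)" if x: "x \<notin> ?N" for x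
  proof (clarify)
    fix v c assume vc: "(v, c) \<in> \<A>" "f x = v \<bullet> x + c"
    have "\<forall>\<^sub>F y in nhds x. f y \<noteq> fst q \<bullet> y + snd q" if q: "q \<in> \<A> - {(v, c)}" for q
    proof -
      have "f x \<noteq> fst q \<bullet> x + snd q"
        using x q vc by (fastforce simp: inner_diff_left)
      moreover have "open {y. f y \<noteq> fst q \<bullet> y + snd q}"
        by (intro open_Collect_neq f continuous_intros)
      ultimately show ?thesis using eventually_nhds_in_open by fastforce
    qed
    then have "\<forall>\<^sub>F y in nhds x. \<forall>q\<in>\<A> - {(v, c)}. f y \<noteq> fst q \<bullet> y + snd q"
      using \<A>(1) by (subst eventually_ball_finite_distrib) auto
    then show "\<forall>\<^sub>F y in nhds x. f y = v \<bullet> y + c"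
    proof eventually_elim
      case (elim y)
      then show ?case using \<A>(2)[of y] by (auto; metis fst_conv insert_Diff insert_iff snd_conv vc(1))
    qed
  qed
  show ?thesis
    using AE_not_in[OF neg[unfolded negligible_iff_null_sets]] by eventually_elim (rule P)
qed

definition dquot :: "(real^'n \<Rightarrow> real) \<Rightarrow> 'n \<Rightarrow> nat \<Rightarrow> real^'n \<Rightarrow> real" where
  "dquot f j n x = (f (x + (1 / (real n + 1)) *\<^sub>R axis j 1) - f x) / (1 / (real n + 1))"

lemma dquot_tendsto:
  assumes "\<forall>\<^sub>F y in nhds x. f y = v \<bullet> y + c" "f x = v \<bullet> x + c"
  shows "(\<lambda>n. dquot f j n x) \<longlonglongrightarrow> v $ j"
proof -
  have "(\<lambda>n. x + (1 / (real n + 1)) *\<^sub>R axis j 1) \<longlonglongrightarrow> x + 0 *\<^sub>R axis j 1"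
    by (intro tendsto_intros inverse_Suc_tendsto)
  then have "\<forall>\<^sub>F n in sequentially. f (x + (1 / (real n + 1)) *\<^sub>R axis j 1) = v \<bullet> (x + (1 / (real n + 1)) *\<^sub>R axis j 1) + c"
    using assms(1) by (auto simp: filterlim_iff)
  then have "\<forall>\<^sub>F n in sequentially. dquot f j n x = v $ j"
    by eventually_elim (simp add: dquot_def assms(2) inner_add_right inner_axis field_simps)
  then show ?thesis by (rule tendsto_eventually)
qed

lemma dquot_bound:
  assumes "L-lipschitz_on UNIV f" shows "\<bar>dquot f j n x\<bar> \<le> L"
proof -
  have "dist (f (x + (1 / (real n + 1)) *\<^sub>R axis j 1)) (f x) \<le> L * dist (x + (1 / (real n + 1)) *\<^sub>R axis j 1) x"
    by (rule lipschitz_onD[OF assms]) auto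
  then have "\<bar>f (x + (1 / (real n + 1)) *\<^sub>R axis j 1) - f x\<bar> \<le> L * (1 / (real n + 1))" by (simp add: dist_norm)
  then show ?thesis unfolding dquot_def
    by (subst abs_divide) (simp add: pos_divide_le_eq pos_le_divide_eq)
qed

text \<open>The difference quotients converge almost everywhere to the slope of the matching piece
  and are bounded by \<open>L\<close>, so their limit is the weak gradient by
  \<open>weak_derivative_lipschitz\<close>.\<close>

lemma piecewise_affine_weak_gradient:
  fixes f :: "real^2 \<Rightarrow> real" and \<A> :: "((real^2) \<times> real) set"
  assumes f: "L-lipschitz_on UNIV f" and \<A>: "finite \<A>" "\<And>x. \<exists>(v, c)\<in>\<A>. f x = v \<bullet> x + c"
    and p: "0 \<le> p"
  shows "W1p_loc p (\<lambda>x. vector [f x, 0] :: real^2)"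
    and "AE x in lebesgue. \<forall>(v, c)\<in>\<A>. f x = v \<bullet> x + c \<longrightarrow> grad (\<lambda>x. vector [f x, 0] :: real^2) x = vector [v, 0]"
proof -
  let ?u = "\<lambda>x. vector [f x, 0] :: real^2"
  have fc: "continuous_on UNIV f" using f by (rule lipschitz_on_continuous_on)
  \<comment> \<open>Defined through \<open>lim\<close> rather than through a selected piece:
    measurability then follows from that of the quotients.\<close>
  define g where "g j x = lim (\<lambda>n. dquot f j n x)" for j x
  define G :: "real^2 \<Rightarrow> real^2^2" where "G x = vector [\<chi> j. g j x, 0]" for x
  have dq: "continuous_on UNIV (dquot f j n)" for j n
    unfolding dquot_def[abs_def]
    by (intro continuous_on_divide continuous_on_diff fc continuous_on_compose2[OF fc]) (auto intro!: continuous_intros)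
  have gm: "g j \<in> borel_measurable lebesgue" for j
    unfolding g_def[abs_def]
    by (intro borel_measurable_lim_metric measurable_completion) (simp add: borel_measurable_continuous_onI dq)
  have loc: "AE x in lebesgue. \<forall>(v, c)\<in>\<A>. f x = v \<bullet> x + c \<longrightarrow> (\<forall>\<^sub>F y in nhds x. f y = v \<bullet> y + c)"
    by (rule AE_locally_affine[OF fc \<A>])
  have conv: "AE x in lebesgue. \<forall>(v, c)\<in>\<A>. f x = v \<bullet> x + c \<longrightarrow> (\<forall>j. (\<lambda>n. dquot f j n x) \<longlonglongrightarrow> v $ j)"
    using loc by eventually_elim (auto intro: dquot_tendsto)
  have glim: "AE x in lebesgue. \<forall>j. (\<lambda>n. dquot f j n x) \<longlonglongrightarrow> g j x"
    using conv
  proof eventually_elim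
    case (elim x)
    obtain v c where "(v, c) \<in> \<A>" "f x = v \<bullet> x + c" using \<A>(2)[of x] by auto
    then have "(\<lambda>n. dquot f j n x) \<longlonglongrightarrow> v $ j" for j using elim by auto
    then show ?case unfolding g_def using limI by metis
  qed
  have gb: "AE x in lebesgue. \<forall>j. \<bar>g j x\<bar> \<le> L"
    using glim
  proof eventually_elim
    case (elim x)
    show ?case
    proof
      fix j show "\<bar>g j x\<bar> \<le> L"
        by (rule LIMSEQ_le_const2[OF tendsto_rabs[OF elim[rule_format, of j]]]) (use dquot_bound[OF f] in auto)
    qed
  qed
  have Gm: "G \<in> borel_measurable lebesgue"
  proof -
    have "G = (\<lambda>x. g 1 x *\<^sub>R axis 1 (axis 1 1) + g 2 x *\<^sub>R axis 1 (axis 2 1))"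
      by (auto simp: G_def fun_eq_iff vec_eq_iff forall_2 axis_def)
    also have "\<dots> \<in> borel_measurable lebesgue"
      by (intro borel_measurable_add borel_measurable_scaleR gm borel_measurable_const)
    finally show ?thesis .
  qed
  have norm_G: "norm (G x) \<le> \<bar>g 1 x\<bar> + \<bar>g 2 x\<bar>" for x
  proof -
    have "G x = axis 1 (\<chi> j. g j x)" by (auto simp: G_def vec_eq_iff forall_2 axis_def)
    then show ?thesis using norm_le_l1_cart[of "\<chi> j. g j x"] by (simp add: norm_axis sum_2)
  qed
  have fm: "?u \<in> borel_measurable lebesgue"
  proof -
    have "?u = (\<lambda>x. f x *\<^sub>R axis 1 1)"
      by (auto simp: fun_eq_iff vec_eq_iff forall_2 axis_def)
    also have "\<dots> \<in> borel_measurable lebesgue"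
      using fc by (intro borel_measurable_scaleR borel_measurable_const) (simp add: measurable_completion borel_measurable_continuous_onI)
    finally show ?thesis .
  qed

  have Lp: "Lp_loc r H" if H: "H \<in> borel_measurable lebesgue" and r: "0 \<le> r"
    and B: "\<And>K. compact K \<Longrightarrow> \<exists>B. AE x in lebesgue. x \<in> K \<longrightarrow> norm (H x) \<le> B" for r and H :: "real^2 \<Rightarrow> 'c::euclidean_space"
    unfolding Lp_loc_def
  proof (intro conjI H allI impI)
    fix K :: "(real^2) set" assume K: "compact K"
    obtain B where B: "AE x in lebesgue. x \<in> K \<longrightarrow> norm (H x) \<le> B" using B[OF K] by blast
    have Ks: "K \<in> sets lebesgue" using K by (simp add: borel_compact)
    show "set_integrable lebesgue K (\<lambda>x. norm (H x) powr r)"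
      unfolding set_integrable_def
    proof (rule integrableI_bounded_set[of K _ _ "B powr r"])
      show "emeasure lebesgue K < \<infinity>" using K Ks emeasure_compact_finite[OF K] by (simp add: borel_compact)
      show "(\<lambda>x. indicator K x *\<^sub>R norm (H x) powr r) \<in> borel_measurable lebesgue"
        using H Ks by (intro borel_measurable_scaleR borel_measurable_indicator powr_real_measurable borel_measurable_norm) auto
      show "AE x in lebesgue. x \<in> K \<longrightarrow> norm (indicator K x *\<^sub>R norm (H x) powr r) \<le> B powr r"
        using B by eventually_elim (auto intro: powr_mono2 r)
    qed (use Ks in auto)
  qed
  have LG: "Lp_loc r G" if "0 \<le> r" for r
  proof (rule Lp[OF Gm that])
    fix K :: "(real^2) set"
    have "AE x in lebesgue. x \<in> K \<longrightarrow> norm (G x) \<le> 2 * L"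
      using gb
    proof eventually_elim
      case (elim x)
      then show ?case using norm_G[of x] elim[rule_format, of 1] elim[rule_format, of 2] by linarith
    qed
    then show "\<exists>B. AE x in lebesgue. x \<in> K \<longrightarrow> norm (G x) \<le> B" by blast
  qed
  have Lu: "Lp_loc r ?u" if "0 \<le> r" for r
  proof (rule Lp[OF fm that])
    fix K :: "(real^2) set" assume K: "compact K"
    obtain B where B: "\<And>x. x \<in> K \<Longrightarrow> norm (f x) \<le> B"
      using continuous_on_compact_bound[OF K continuous_on_subset[OF fc]] by blast
    have "norm (?u x) \<le> B" if "x \<in> K" for x
      using norm_le_l1_cart[of "?u x"] B[OF that] by (simp add: sum_2)
    then show "\<exists>B. AE x in lebesgue. x \<in> K \<longrightarrow> norm (?u x) \<le> B" by blast
  qed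
  have wg: "weak_gradient ?u G"
    unfolding weak_gradient_def
  proof (intro conjI LG Lu ballI allI)
    fix \<phi> :: "real^2 \<Rightarrow> real" and i j :: 2 assume \<phi>: "\<phi> \<in> test_functions UNIV"
    have "AE x in lebesgue. (\<lambda>n. (f (x + (1 / (real n + 1)) *\<^sub>R axis j 1) - f x) / (1 / (real n + 1))) \<longlonglongrightarrow> g j x"
      using glim by eventually_elim (simp add: dquot_def)
    from weak_derivative_lipschitz[OF f gm this \<phi>]
    show "(LINT x|lebesgue. ?u x $ i * partial j \<phi> x) = - (LINT x|lebesgue. G x $ i $ j * \<phi> x)"
      using exhaust_2[of i] by (auto simp: G_def)
  qed auto
  then show "W1p_loc p ?u" unfolding W1p_loc_def using LG Lu p by auto
  have "weak_gradient ?u (grad ?u)" unfolding grad_def by (rule someI[of "weak_gradient ?u", OF wg])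
  then have "AE x in lebesgue. grad ?u x = G x" using wg by (rule weak_gradient_unique)
  then show "AE x in lebesgue. \<forall>(v, c)\<in>\<A>. f x = v \<bullet> x + c \<longrightarrow> grad ?u x = vector [v, 0]"
    using conv
  proof eventually_elim
    case (elim x)
    show ?case
    proof clarify
      fix v c assume "(v, c) \<in> \<A>" "f x = v \<bullet> x + c"
      then have "(\<lambda>n. dquot f j n x) \<longlonglongrightarrow> v $ j" for j using elim by auto
      then have "g j x = v $ j" for j unfolding g_def by (rule limI)
      then have "(\<chi> j. g j x) = v" by (simp add: vec_eq_iff)
      then show "grad ?u x = vector [v, 0]" using elim by (simp add: G_def)
    qed
  qed
qed

subsection \<open>Second differences\<close>

definition diff2 :: "('a::real_vector \<Rightarrow> real) \<Rightarrow> 'a \<Rightarrow> 'a \<Rightarrow> real" where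
  "diff2 f v x = f (x + v) + f (x - v) - 2 * f x"

text \<open>Polarisation: along the half diagonals \<open>v\<close> and \<open>w\<close>, the mixed
  difference is the symmetric second difference in direction \<open>v\<close> minus the one in
  direction \<open>w\<close>, both centred at \<open>x - v\<close>. Symmetric differences are the
  ones that concavity controls.\<close>

lemma mixed_difference_bound:
  fixes f :: "real^'n \<Rightarrow> real"
  assumes f: "continuous_on UNIV f" and "0 \<le> K"
    and K: "\<And>v. (\<And>i. \<bar>v $ i\<bar> \<le> h) \<Longrightarrow> (\<integral>\<^sup>+x. ennreal \<bar>diff2 f v x\<bar> \<partial>lborel) \<le> ennreal K" and h: "0 < h"
  shows "(\<integral>\<^sup>+x. ennreal \<bar>f (x - h *\<^sub>R axis j 1 - h *\<^sub>R axis k 1) - f (x - h *\<^sub>R axis j 1) - f (x - h *\<^sub>R axis k 1) + f x\<bar> \<partial>lborel)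
      \<le> ennreal (2 * K)"
proof -
  define v w :: "real^'n" where "v = (h / 2) *\<^sub>R (axis j 1 + axis k 1)" and "w = (h / 2) *\<^sub>R (axis j 1 - axis k 1)"
  have vw: "\<bar>v $ i\<bar> \<le> h" "\<bar>w $ i\<bar> \<le> h" for i
    using h by (auto simp: v_def w_def axis_def)
  have dm: "(\<lambda>x. ennreal \<bar>diff2 f z x\<bar>) \<in> borel_measurable borel" for z
  proof -
    have "continuous_on UNIV (\<lambda>x. \<bar>diff2 f z x\<bar>)"
      unfolding diff2_def by (intro continuous_intros f continuous_on_compose2[OF f]) auto
    then show ?thesis by (intro measurable_compose[OF _ measurable_ennreal] borel_measurable_continuous_onI)
  qed
  have dm': "(\<lambda>x. ennreal \<bar>diff2 f z (x - v)\<bar>) \<in> borel_measurable lborel" for z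
    using measurable_compose[OF _ dm, of "\<lambda>x. x - v" borel z] by simp
  have sv: "v - w = h *\<^sub>R axis k 1" "v + w = h *\<^sub>R axis j 1"
    by (simp_all add: v_def w_def vec_eq_iff algebra_simps)
  have "f (x - h *\<^sub>R axis j 1 - h *\<^sub>R axis k 1) - f (x - h *\<^sub>R axis j 1) - f (x - h *\<^sub>R axis k 1) + f x
      = diff2 f v (x - v) - diff2 f w (x - v)" for x
  proof -
    have e: "x - v - w - h *\<^sub>R axis k 1 = x - v - v" "x - h *\<^sub>R axis j 1 = x - v - w" "x - h *\<^sub>R axis k 1 = x - v + w"
      unfolding sv(1,2)[symmetric] by simp_all
    show ?thesis unfolding diff2_def e by simp
  qed
  then have "(\<integral>\<^sup>+x. ennreal \<bar>f (x - h *\<^sub>R axis j 1 - h *\<^sub>R axis k 1) - f (x - h *\<^sub>R axis j 1) - f (x - h *\<^sub>R axis k 1) + f x\<bar> \<partial>lborel)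
     = (\<integral>\<^sup>+x. ennreal \<bar>diff2 f v (x - v) - diff2 f w (x - v)\<bar> \<partial>lborel)" by simp
  also have "\<dots> \<le> (\<integral>\<^sup>+x. ennreal \<bar>diff2 f v (x - v)\<bar> + ennreal \<bar>diff2 f w (x - v)\<bar> \<partial>lborel)"
    by (intro nn_integral_mono) (simp add: ennreal_plus[symmetric] ennreal_leI del: ennreal_plus)
  also have "\<dots> = (\<integral>\<^sup>+x. ennreal \<bar>diff2 f v (x - v)\<bar> \<partial>lborel) + (\<integral>\<^sup>+x. ennreal \<bar>diff2 f w (x - v)\<bar> \<partial>lborel)"
    by (rule nn_integral_add) (rule dm')+
  also have "\<dots> = (\<integral>\<^sup>+x. ennreal \<bar>diff2 f v x\<bar> \<partial>lborel) + (\<integral>\<^sup>+x. ennreal \<bar>diff2 f w x\<bar> \<partial>lborel)"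
    using nn_integral_translation[OF dm, of v "- v"] nn_integral_translation[OF dm, of w "- v"] by simp
  also have "\<dots> \<le> ennreal K + ennreal K"
    by (intro add_mono K vw)
  finally show ?thesis using \<open>0 \<le> K\<close> by (simp add: ennreal_plus[symmetric] del: ennreal_plus)
qed

text \<open>Only the first component of the map is nonzero; the factor \<open>8\<close> counts four
  index pairs \<open>j\<close>, \<open>k\<close>, each contributing at most
  \<open>2 * K\<close>.\<close>

lemma D2_TV_le:
  fixes f :: "real^2 \<Rightarrow> real"
  assumes f: "continuous_on UNIV f" and K: "0 \<le> K"
    and bound: "\<And>h v. 0 < h \<Longrightarrow> h \<le> 1 \<Longrightarrow> (\<And>i. \<bar>v $ i\<bar> \<le> h) \<Longrightarrow> (\<integral>\<^sup>+x. ennreal \<bar>diff2 f v x\<bar> \<partial>lborel) \<le> ennreal (K * h\<^sup>2)"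
  shows "D2_TV U (\<lambda>x. vector [f x, 0] :: real^2) \<le> ennreal (8 * K)"
  unfolding D2_TV_def
proof (rule SUP_least)
  fix \<Phi> :: "real^2 \<Rightarrow> real^2^2^2"
  assume "\<Phi> \<in> {\<Phi>. (\<forall>i j k. (\<lambda>x. \<Phi> x $ i $ j $ k) \<in> test_functions U) \<and> (\<forall>x. norm (\<Phi> x) \<le> 1)}"
  then have \<Phi>: "(\<lambda>x. \<Phi> x $ i $ j $ k) \<in> test_functions U" "norm (\<Phi> x) \<le> 1" for i j k x by auto
  let ?u = "\<lambda>x. vector [f x, 0] :: real^2"
  have b: "\<bar>LINT x:U|lebesgue. f x * partial j (partial k (\<lambda>y. \<Phi> y $ 1 $ j $ k)) x\<bar> \<le> 2 * K" for j k
  proof -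
    let ?\<phi> = "\<lambda>y. \<Phi> y $ 1 $ j $ k"
    obtain S where S: "S \<subseteq> U" "\<And>x. x \<notin> S \<Longrightarrow> partial j (partial k ?\<phi>) x = 0"
      using test_function_support[OF test_function_partial[OF test_function_partial[OF \<Phi>(1)[of 1 j k]]]] by metis
    have "(LINT x:U|lebesgue. f x * partial j (partial k ?\<phi>) x) = (LINT x|lebesgue. f x * partial j (partial k ?\<phi>) x)"
      unfolding set_lebesgue_integral_def using S
      by (intro Bochner_Integration.integral_cong refl) (auto simp: indicator_def)
    moreover have "\<bar>LINT x|lebesgue. f x * partial j (partial k ?\<phi>) x\<bar> \<le> 2 * K"
    proof (rule second_derivative_pairing_bound[OF f test_function_mono[OF \<Phi>(1)]])
      show "\<bar>?\<phi> x\<bar> \<le> 1" for x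
        using component_le_norm_matrix[of "\<Phi> x $ 1" j k] Finite_Cartesian_Product.norm_nth_le[of "\<Phi> x" 1] \<Phi>(2)[of x] by linarith
      fix h :: real assume h: "0 < h" "h \<le> 1"
      show "(\<integral>\<^sup>+x. ennreal \<bar>f (x - h *\<^sub>R axis j 1 - h *\<^sub>R axis k 1) - f (x - h *\<^sub>R axis j 1) - f (x - h *\<^sub>R axis k 1) + f x\<bar> \<partial>lborel)
        \<le> ennreal (2 * K * h\<^sup>2)"
        using mixed_difference_bound[OF f _ bound[OF h] h(1), of j k] K by (simp add: mult.assoc)
    qed (use K in auto)
    ultimately show ?thesis by simp
  qed
  have "D2_pairing U ?u \<Phi> = (\<Sum>j\<in>UNIV. \<Sum>k\<in>UNIV. LINT x:U|lebesgue. f x * partial j (partial k (\<lambda>y. \<Phi> y $ 1 $ j $ k)) x)"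
    unfolding D2_pairing_def sum_2[where 'a=real] by (simp add: set_lebesgue_integral_def)
  then have "\<bar>D2_pairing U ?u \<Phi>\<bar> \<le> (\<Sum>j\<in>(UNIV::2 set). \<Sum>k\<in>(UNIV::2 set). 2 * K)"
    by (simp only:) (intro order_trans[OF sum_abs] sum_mono b)
  then show "ennreal \<bar>D2_pairing U ?u \<Phi>\<bar> \<le> ennreal (8 * K)"
    by (intro ennreal_leI) simp
qed

subsection \<open>The branching construction\<close>

definition ramp :: "real \<Rightarrow> real" where "ramp z = max 0 z"

text \<open>The second difference is exactly \<open>max 0 (\<bar>r\<bar> - \<bar>z\<bar>)\<close>:
  it is felt only within distance \<open>\<tau>\<close> of the kink.\<close>

lemma ramp_diff2:
  assumes "\<bar>r\<bar> \<le> \<tau>"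
  shows "ramp (z + r) + ramp (z - r) - 2 * ramp z \<le> (if \<bar>z\<bar> \<le> \<tau> then \<tau> else 0)"
  using assms by (auto simp: ramp_def max_def)

lemma ramp_lipschitz: "\<bar>ramp x - ramp y\<bar> \<le> \<bar>x - y\<bar>"
  by (auto simp: ramp_def)

text \<open>\<open>n\<close> is the number of tents in generation \<open>0\<close> and
  \<open>N\<close> the last generation. Both are chosen only once \<open>\<epsilon>\<close> is
  given, so final constants must not involve them.\<close>

locale branching =
  fixes \<mu> p :: real and n N :: nat
  assumes mu: "\<bar>\<mu>\<bar> < 1" and p: "1 \<le> p" and n: "0 < n"
begin

text \<open>Generation \<open>k\<close> of tents has width \<open>h k\<close>, peaks at \<open>m k i\<close>, and is lowered by the penalty \<open>t k\<close>
  at distance less than \<open>\<theta> ^ k / 2\<close> from the horizontal edges.  For this \<open>\<theta>\<close>, which is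
  \<open>2 powr (- (p + 1) / p)\<close>, both the elastic energy \<open>c k powr p * \<theta> ^ k\<close> and the number of kinks
  \<open>2 ^ k * \<theta> ^ k\<close> of generation \<open>k\<close> decay like \<open>q ^ k\<close>.\<close>

definition q :: real where "q = 2 powr (- 1 / p)"
definition \<theta> :: real where "\<theta> = q / 2"
definition h :: "nat \<Rightarrow> real" where "h k = 1 / (real n * 2 ^ k)"
definition \<rho> :: "nat \<Rightarrow> real" where "\<rho> k = (1 - \<theta> ^ k) / 2"
definition c :: "nat \<Rightarrow> real" where "c k = 2 / (q ^ k * real n)"
definition m :: "nat \<Rightarrow> nat \<Rightarrow> real" where "m k i = (real i + (1 + \<mu>) / 2) * h k"
definition T :: "nat \<Rightarrow> nat \<Rightarrow> real \<Rightarrow> real" where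
  "T k i s = (1 - \<mu>) * (s - real i * h k) - 2 * ramp (s - m k i)"
definition t :: "nat \<Rightarrow> real \<Rightarrow> real" where
  "t k s = c k * (ramp (s - (1 / 2 + \<rho> k)) + ramp ((1 / 2 - \<rho> k) - s))"
definition g :: "nat \<Rightarrow> nat \<Rightarrow> real^2 \<Rightarrow> real" where "g k i x = T k i (x $ 1) - t k (x $ 2)"
definition I :: "(nat \<times> nat) set" where "I = (SIGMA k:{..N}. {..<n * 2 ^ k})"
definition w :: "real^2 \<Rightarrow> real" where "w x = Max (insert 0 ((\<lambda>(k, i). g k i x) ` I))"

lemma q: "1 / 2 \<le> q" "q < 1" "q powr p = 1 / 2"
proof -
  have "2 powr (- 1) \<le> (2::real) powr (- 1 / p)" using p by (intro powr_mono) (auto simp: field_simps)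
  then show "1 / 2 \<le> q" by (simp add: q_def powr_minus)
  have "2 powr (- 1 / p) < (2::real) powr 0" using p by (intro powr_less_mono) auto
  then show "q < 1" by (simp add: q_def)
  have "(- 1 / p) * p = - 1" using p by simp
  then show "q powr p = 1 / 2" unfolding q_def powr_powr by (simp add: powr_minus)
qed

lemma \<theta>: "0 < \<theta>" "\<theta> < 1 / 2" "2 * \<theta> = q"
  using q by (auto simp: \<theta>_def)

lemma h_pos: "0 < h k" and c_pos: "0 < c k" and h_Suc: "h k = 2 * h (Suc k)"
  using n q by (auto simp: h_def c_def)

lemma \<rho>: "0 \<le> \<rho> k" "\<rho> k < 1 / 2" "\<rho> (Suc k) - \<rho> k = \<theta> ^ k * (1 - \<theta>) / 2"
proof -
  have "\<theta> ^ k \<le> 1" using \<theta> by (intro power_le_one) auto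
  then show "0 \<le> \<rho> k" "\<rho> k < 1 / 2" using \<theta> by (auto simp: \<rho>_def)
  show "\<rho> (Suc k) - \<rho> k = \<theta> ^ k * (1 - \<theta>) / 2" by (simp add: \<rho>_def field_simps)
qed

text \<open>A tent over the \<open>i\<close>-th interval of generation \<open>k\<close> with slopes
  \<open>1 - \<mu>\<close> and \<open>- (1 + \<mu>)\<close>; adding \<open>\<mu> * s\<close> turns
  these into 1 and -1, the entries of the wells.\<close>

lemma T_eq: "T k i s = min ((1 - \<mu>) * (s - real i * h k)) ((1 + \<mu>) * ((real i + 1) * h k - s))"
proof -
  have "(1 + \<mu>) * ((real i + 1) * h k - s) = (1 - \<mu>) * (s - real i * h k) - 2 * (s - m k i)"
    by (simp add: m_def field_simps)
  then show ?thesis by (auto simp: T_def ramp_def min_def max_def)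
qed

text \<open>The average of the two branches of \<open>T_eq\<close> with weights
  \<open>(1 + \<mu>) / 2\<close> and \<open>(1 - \<mu>) / 2\<close> no longer depends on
  \<open>s\<close> and equals \<open>(1 - \<mu>\<^sup>2) * h k / 2\<close>.\<close>

lemma T_le: "T k i s \<le> h k / 2"
proof (rule ccontr)
  assume "\<not> ?thesis"
  then have 1: "h k / 2 < (1 - \<mu>) * (s - real i * h k)" and 2: "h k / 2 < (1 + \<mu>) * ((real i + 1) * h k - s)"
    by (auto simp: T_eq)
  have "(1 + \<mu>) * (h k / 2) < (1 + \<mu>) * ((1 - \<mu>) * (s - real i * h k))"
    using 1 mu by (intro mult_strict_left_mono) auto
  moreover have "(1 - \<mu>) * (h k / 2) < (1 - \<mu>) * ((1 + \<mu>) * ((real i + 1) * h k - s))"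
    using 2 mu by (intro mult_strict_left_mono) auto
  moreover have "(1 + \<mu>) * ((1 - \<mu>) * X) + (1 - \<mu>) * ((1 + \<mu>) * Y) = (1 - \<mu>\<^sup>2) * (X + Y)" for X Y
    by (simp add: algebra_simps power2_eq_square)
  moreover have "(s - real i * h k) + ((real i + 1) * h k - s) = h k" by (simp add: algebra_simps)
  moreover have "(1 + \<mu>) * (h k / 2) + (1 - \<mu>) * (h k / 2) = h k" by (simp add: field_simps)
  ultimately have "h k < (1 - \<mu>\<^sup>2) * h k" by (metis add_strict_mono)
  then have "h k < h k - \<mu>\<^sup>2 * h k" by (simp add: algebra_simps)
  moreover have "0 \<le> \<mu>\<^sup>2 * h k" using h_pos[of k] by simp
  ultimately show False by simp
qed

lemma T_pos: "0 < T k i s \<Longrightarrow> real i * h k < s \<and> s < (real i + 1) * h k"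
  using mu by (auto simp: T_eq zero_less_mult_iff)

lemma T_nonneg: "real i * h k \<le> s \<Longrightarrow> s \<le> (real i + 1) * h k \<Longrightarrow> 0 \<le> T k i s"
  using mu by (auto simp: T_eq)

text \<open>The interval of a tent is one half of the interval of its parent \<open>i div 2\<close>,
  and moving the endpoints outwards raises both branches of \<open>T_eq\<close>.\<close>

lemma T_Suc_le: "T (Suc k) i s \<le> T k (i div 2) s"
proof -
  have "2 * (i div 2) \<le> i" "i + 1 \<le> 2 * (i div 2) + 2" by auto
  then have "real (2 * (i div 2)) \<le> real i" "real (i + 1) \<le> real (2 * (i div 2) + 2)"
    by (simp_all only: of_nat_le_iff)
  then have "2 * real (i div 2) \<le> real i" "real i + 1 \<le> 2 * real (i div 2) + 2" by simp_all
  then have "2 * real (i div 2) * h (Suc k) \<le> real i * h (Suc k)" "(real i + 1) * h (Suc k) \<le> (2 * real (i div 2) + 2) * h (Suc k)"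
    using h_pos[of "Suc k"] by (auto intro!: mult_right_mono)
  then have "real (i div 2) * h k \<le> real i * h (Suc k)" "(real i + 1) * h (Suc k) \<le> (real (i div 2) + 1) * h k"
    by (auto simp: h_Suc[of k] algebra_simps)
  then show ?thesis unfolding T_eq using mu by (intro min.mono mult_left_mono) auto
qed

lemma t_zero: "\<bar>s - 1 / 2\<bar> \<le> \<rho> k \<Longrightarrow> t k s = 0"
  by (auto simp: t_def ramp_def max_def abs_le_iff)

lemma t_nonneg: "0 \<le> t k s"
  using c_pos[of k] by (simp add: t_def ramp_def)

text \<open>The origin of \<open>c k\<close>: over its strip of height
  \<open>\<theta> ^ k / 2\<close> the penalty grows up to \<open>h k\<close>, twice the bound on the
  height of a tent.\<close>

lemma c_theta: "c k * \<theta> ^ k = 2 * h k"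
  using q by (simp add: h_def c_def \<theta>_def power_divide)

text \<open>Where generation \<open>k + 1\<close> starts to be penalised, the penalty of generation
  \<open>k\<close> has reached \<open>h k * (1 - \<theta>)\<close>. Since
  \<open>\<theta> < 1 / 2\<close>, this already exceeds every tent of generation
  \<open>k\<close>.\<close>

lemma t_ge: 
  assumes "\<rho> (Suc k) \<le> \<bar>s - 1 / 2\<bar>" shows "h k / 2 \<le> t k s"
proof -
  have "h k / 2 \<le> h k * (1 - \<theta>)" using h_pos[of k] \<theta> by (simp add: field_simps)
  also have "\<dots> = c k * (\<theta> ^ k * (1 - \<theta>) / 2)"
    using c_theta[of k] by simp
  also have "\<dots> \<le> c k * (ramp (s - (1 / 2 + \<rho> k)) + ramp ((1 / 2 - \<rho> k) - s))"
  proof (rule mult_left_mono)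
    show "\<theta> ^ k * (1 - \<theta>) / 2 \<le> ramp (s - (1 / 2 + \<rho> k)) + ramp ((1 / 2 - \<rho> k) - s)"
      unfolding \<rho>(3)[symmetric] using assms by (auto simp: ramp_def max_def abs_if split: if_splits)
  qed (use c_pos[of k] in simp)
  finally show ?thesis by (simp add: t_def)
qed

lemma finite_I: "finite I" by (simp add: I_def)

lemma g_le_w: "(k, i) \<in> I \<Longrightarrow> g k i x \<le> w x"
  unfolding w_def by (intro Max_ge) (auto intro: finite_I)

lemma w_nonneg: "0 \<le> w x"
  unfolding w_def by (intro Max_ge) (auto intro: finite_I)

lemma w_cases: 
  obtains "w x = 0" | k i where "(k, i) \<in> I" "w x = g k i x" "0 < w x"
proof -
  have "w x \<in> insert 0 ((\<lambda>(k, i). g k i x) ` I)" unfolding w_def by (intro Max_in) (auto intro: finite_I)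
  then show thesis using that w_nonneg[of x] by (cases "w x = 0") auto
qed

text \<open>Every positive summand of the maximum is confined to the square, strictly in the
  vertical direction; the boundary condition and the compact support of \<open>w\<close> rest on
  this.\<close>

lemma g_pos:
  assumes "0 < g k i x" "(k, i) \<in> I"
  shows "0 \<le> x $ 1" "x $ 1 \<le> 1" "\<bar>x $ 2 - 1 / 2\<bar> < \<rho> (Suc k)"
proof -
  have "0 < T k i (x $ 1)" using assms(1) t_nonneg[of k "x $ 2"] by (simp add: g_def)
  from T_pos[OF this] have *: "real i * h k < x $ 1" "x $ 1 < (real i + 1) * h k" by auto
  have "0 \<le> real i * h k" using h_pos[of k] by simp
  then show "0 \<le> x $ 1" using * by linarith
  have "real i + 1 \<le> real n * 2 ^ k" 
  proof -
    have "real (i + 1) \<le> real (n * 2 ^ k)" using assms(2) unfolding of_nat_le_iff by (simp add: I_def)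
    then show ?thesis by simp
  qed
  then have "(real i + 1) * h k \<le> real n * 2 ^ k * h k" using h_pos[of k] by (intro mult_right_mono) auto
  moreover have "real n * 2 ^ k * h k = 1" using n by (simp add: h_def)
  ultimately show "x $ 1 \<le> 1" using * by linarith
  show "\<bar>x $ 2 - 1 / 2\<bar> < \<rho> (Suc k)"
  proof (rule ccontr)
    assume "\<not> ?thesis"
    then show False using t_ge[of k "x $ 2"] T_le[of k i "x $ 1"] assms(1) by (simp add: g_def)
  qed
qed

lemma w_outside: 
  assumes "x \<notin> cbox 0 1" shows "w x = 0"
proof (cases rule: w_cases[of x])
  case (2 k i)
  then have "x \<in> cbox 0 1" using g_pos[of k i x] \<rho>(2)[of "Suc k"] 
    by (auto simp: mem_box_cart forall_2 abs_less_iff)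
  then show ?thesis using assms by blast
qed

text \<open>With the coarsest active generation, the peaks of generation \<open>k\<close> only matter in the strips
  next to the horizontal edges where generation \<open>k - 1\<close> is penalised.\<close>

lemma w_cases_minimal: 
  obtains "w x = 0" | k i where "(k, i) \<in> I" "w x = g k i x" "0 < w x" "k = 0 \<or> \<rho> (k - 1) \<le> \<bar>x $ 2 - 1 / 2\<bar>"
proof (cases "w x = 0")
  case False
  define P where "P k \<longleftrightarrow> (\<exists>i. (k, i) \<in> I \<and> w x = g k i x)" for k
  have "\<exists>k. P k" using w_cases[of x] False unfolding P_def by metis
  define k where "k = (LEAST k. P k)"
  have "P k" unfolding k_def using \<open>\<exists>k. P k\<close> by (rule LeastI_ex)
  then obtain i where i: "(k, i) \<in> I" "w x = g k i x" unfolding P_def by blast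
  have "k = 0 \<or> \<rho> (k - 1) \<le> \<bar>x $ 2 - 1 / 2\<bar>"
  proof (rule ccontr)
    assume *: "\<not> ?thesis"
    then obtain l where l: "k = Suc l" by (cases k) auto
    have "g k i x \<le> g l (i div 2) x"
      using * l t_zero[of "x $ 2" l] t_nonneg[of k "x $ 2"] T_Suc_le[of l i "x $ 1"] by (simp add: g_def)
    moreover have "(l, i div 2) \<in> I" using i(1) l by (auto simp: I_def)
    ultimately have "P l" unfolding P_def using i(2) g_le_w[of l "i div 2" x] by (intro exI[of _ "i div 2"]) auto
    then have "k \<le> l" unfolding k_def by (rule Least_le)
    then show False using l by simp
  qed
  then show thesis using that(2) i w_nonneg[of x] False by force
qed (use that in blast)

text \<open>A crude constant, uniform over all members of the maximum, so that \<open>w\<close>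
  inherits it.\<close>

lemma g_lipschitz:
  assumes "k \<le> N" shows "\<bar>g k i x - g k i y\<bar> \<le> (4 + (\<Sum>k\<le>N. 2 * c k)) * norm (x - y)"
proof -
  have n1: "\<bar>x $ 1 - y $ 1\<bar> \<le> norm (x - y)" "\<bar>x $ 2 - y $ 2\<bar> \<le> norm (x - y)"
    using component_le_norm_cart[of "x - y"] by auto
  have "\<bar>T k i (x $ 1) - T k i (y $ 1)\<bar> \<le> (1 - \<mu>) * \<bar>x $ 1 - y $ 1\<bar> + 2 * \<bar>x $ 1 - y $ 1\<bar>"
  proof -
    have eq: "T k i (x $ 1) - T k i (y $ 1) = (1 - \<mu>) * (x $ 1 - y $ 1) - 2 * (ramp (x $ 1 - m k i) - ramp (y $ 1 - m k i))"
      by (simp add: T_def algebra_simps)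
    have tri: "\<bar>X - 2 * R\<bar> \<le> \<bar>X\<bar> + 2 * \<bar>R\<bar>" for X R :: real by linarith
    have 1: "\<bar>(1 - \<mu>) * (x $ 1 - y $ 1)\<bar> \<le> (1 - \<mu>) * \<bar>x $ 1 - y $ 1\<bar>" using mu by (simp add: abs_mult)
    have 2: "2 * \<bar>ramp (x $ 1 - m k i) - ramp (y $ 1 - m k i)\<bar> \<le> 2 * \<bar>x $ 1 - y $ 1\<bar>"
      using ramp_lipschitz[of "x $ 1 - m k i" "y $ 1 - m k i"] by simp
    show ?thesis unfolding eq by (rule order_trans[OF tri add_mono[OF 1 2]])
  qed
  also have "\<dots> \<le> 2 * \<bar>x $ 1 - y $ 1\<bar> + 2 * \<bar>x $ 1 - y $ 1\<bar>"
    using mu by (intro add_mono mult_right_mono) auto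
  also have "\<dots> \<le> 2 * norm (x - y) + 2 * norm (x - y)"
    using n1 by (intro add_mono mult_left_mono) auto
  finally have 1: "\<bar>T k i (x $ 1) - T k i (y $ 1)\<bar> \<le> 4 * norm (x - y)" by simp
  have eq: "t k (x $ 2) - t k (y $ 2) = c k * ((ramp (x $ 2 - (1 / 2 + \<rho> k)) - ramp (y $ 2 - (1 / 2 + \<rho> k)))
      + (ramp ((1 / 2 - \<rho> k) - x $ 2) - ramp ((1 / 2 - \<rho> k) - y $ 2)))" (is "_ = c k * (?a + ?b)")
    unfolding t_def by (simp only: algebra_simps)
  have ab: "\<bar>?a\<bar> \<le> norm (x - y)" "\<bar>?b\<bar> \<le> norm (x - y)"
    using n1(2) by (auto intro!: order_trans[OF ramp_lipschitz] simp: abs_minus_commute)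
  have "\<bar>t k (x $ 2) - t k (y $ 2)\<bar> = c k * \<bar>?a + ?b\<bar>"
    unfolding eq abs_mult using c_pos[of k] by simp
  also have "\<dots> \<le> c k * (2 * norm (x - y))"
    using c_pos[of k] order_trans[OF abs_triangle_ineq add_mono[OF ab]] by (intro mult_left_mono) auto
  also have "\<dots> = (2 * c k) * norm (x - y)" by simp
  also have "\<dots> \<le> (\<Sum>k\<le>N. 2 * c k) * norm (x - y)"
    using assms c_pos by (intro mult_right_mono member_le_sum) (auto intro: less_imp_le)
  finally have 2: "\<bar>t k (x $ 2) - t k (y $ 2)\<bar> \<le> (\<Sum>k\<le>N. 2 * c k) * norm (x - y)" .
  have "\<bar>g k i x - g k i y\<bar> \<le> \<bar>T k i (x $ 1) - T k i (y $ 1)\<bar> + \<bar>t k (x $ 2) - t k (y $ 2)\<bar>"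
    unfolding g_def by linarith
  also have "\<dots> \<le> 4 * norm (x - y) + (\<Sum>k\<le>N. 2 * c k) * norm (x - y)"
    by (rule add_mono[OF 1 2])
  finally show ?thesis by (simp add: distrib_right)
qed

lemma w_lipschitz: "w x - w y \<le> (4 + (\<Sum>k\<le>N. 2 * c k)) * norm (x - y)"
proof (cases rule: w_cases[of x])
  case 1
  then show ?thesis using w_nonneg[of y] sum_nonneg[of "{..N}" "\<lambda>k. 2 * c k"] c_pos
    by (smt (verit) mult_nonneg_nonneg norm_ge_zero)
next
  case (2 k i)
  then have "k \<le> N" by (auto simp: I_def)
  from g_lipschitz[OF this, of i x y] show ?thesis using 2 g_le_w[of k i y] by linarith
qed

definition f :: "real^2 \<Rightarrow> real" where "f x = \<mu> * x $ 1 + w x"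

lemma f_lipschitz: "(5 + (\<Sum>k\<le>N. 2 * c k))-lipschitz_on UNIV f"
proof (rule lipschitz_onI)
  fix x y :: "real^2"
  let ?S = "\<Sum>k\<le>N. 2 * c k"
  have "\<bar>\<mu> * x $ 1 - \<mu> * y $ 1\<bar> = \<bar>\<mu>\<bar> * \<bar>(x - y) $ 1\<bar>" by (simp add: abs_mult[symmetric] right_diff_distrib)
  also have "\<dots> \<le> 1 * norm (x - y)" using mu by (intro mult_mono component_le_norm_cart) auto
  finally have "\<bar>\<mu> * x $ 1 - \<mu> * y $ 1\<bar> \<le> norm (x - y)" by simp
  moreover have "\<bar>w x - w y\<bar> \<le> (4 + ?S) * norm (x - y)"
    using w_lipschitz[of x y] w_lipschitz[of y x] by (simp add: norm_minus_commute abs_le_iff)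
  ultimately show "dist (f x) (f y) \<le> (5 + ?S) * dist x y"
    unfolding dist_norm f_def real_norm_def distrib_right by linarith
next
  show "0 \<le> 5 + (\<Sum>k\<le>N. 2 * c k)" using c_pos by (intro add_nonneg_nonneg sum_nonneg) (auto intro: less_imp_le)
qed

lemma f_continuous: "continuous_on UNIV f"
  using f_lipschitz by (rule lipschitz_on_continuous_on)

lemma w_continuous: "continuous_on UNIV w"
proof -
  have "w = (\<lambda>x. f x - \<mu> * x $ 1)" by (simp add: f_def fun_eq_iff)
  then show ?thesis by (auto intro!: continuous_intros f_continuous)
qed

end

lemma measure_cbox_2:
  assumes "a \<le> c" "b \<le> d"
  shows "measure lborel (cbox (vector [a, b]) (vector [c, d] :: real^2)) = (c - a) * (d - b)"
proof -
  have "vector [a, b] \<in> cbox (vector [a, b]) (vector [c, d] :: real^2)"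
    using assms by (simp add: mem_box_cart forall_2)
  then have "cbox (vector [a, b]) (vector [c, d] :: real^2) \<noteq> {}" by blast
  then show ?thesis by (simp add: content_cbox_if_cart UNIV_2)
qed

lemma mem_cbox_2: "x \<in> cbox (vector [a, b]) (vector [c, d] :: real^2) \<longleftrightarrow> a \<le> x $ 1 \<and> x $ 1 \<le> c \<and> b \<le> x $ 2 \<and> x $ 2 \<le> d"
  by (auto simp: mem_box_cart forall_2)

section \<open>Total variation of the second derivative of the construction\<close>

context branching
begin

text \<open>Bounds the negative part of the second differences of \<open>w\<close> for steps of size at most \<open>\<tau>\<close>; the
  indicator functions single out neighbourhoods of the kinks of the tents and of the penalties.\<close>

definition kinks :: "real \<Rightarrow> real^2 \<Rightarrow> real" where
  "kinks \<tau> x = (\<Sum>k\<le>N.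
     (\<Sum>i<n * 2 ^ k. 2 * \<tau> * indicator (cbox (vector [m k i - \<tau>, 0]) (vector [m k i + \<tau>, \<theta> ^ k / (2 * \<theta>)])) x
        + 2 * \<tau> * indicator (cbox (vector [m k i - \<tau>, 1 - \<theta> ^ k / (2 * \<theta>)]) (vector [m k i + \<tau>, 1])) x)
     + (c k * \<tau> * indicator (cbox (vector [0, 1 / 2 + \<rho> k - \<tau>]) (vector [1, 1 / 2 + \<rho> k + \<tau>])) x
        + c k * \<tau> * indicator (cbox (vector [0, 1 / 2 - \<rho> k - \<tau>]) (vector [1, 1 / 2 - \<rho> k + \<tau>])) x))"

text \<open>The integral of \<open>kinks \<tau>\<close> divided by \<open>\<tau>\<^sup>2\<close>. Up
  to factors it adds jump times length: \<open>n * 2 ^ k\<close> ridges of length about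
  \<open>\<theta> ^ k / \<theta>\<close> with jump \<open>2\<close>, and creases of unit length with
  jump \<open>c k\<close>.\<close>

definition V :: real where "V = (\<Sum>k\<le>N. 4 * real n * q ^ k / \<theta> + 4 * c k)"

lemma V_nonneg: "0 \<le> V"
  unfolding V_def using c_pos q \<theta> by (intro sum_nonneg add_nonneg_nonneg) (auto intro: less_imp_le)

lemma integrable_indicator_cbox: "integrable lborel (\<lambda>x. C * indicator (cbox a b) x :: real)"
  by (intro integrable_mult_right) (simp add: integrable_indicator_iff emeasure_lborel_cbox_finite[unfolded infinity_ennreal_def])

lemma kinks_integral: 
  assumes "0 < \<tau>"
  shows "integrable lborel (kinks \<tau>)" "(LINT x|lborel. kinks \<tau> x) = V * \<tau>\<^sup>2"
proof -
  have th: "0 \<le> \<theta> ^ k / (2 * \<theta>)" for k using \<theta> by simp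
  show "integrable lborel (kinks \<tau>)" unfolding kinks_def[abs_def]
    by (intro Bochner_Integration.integrable_sum Bochner_Integration.integrable_add integrable_indicator_cbox)
  note int = Bochner_Integration.integrable_sum Bochner_Integration.integrable_add integrable_indicator_cbox
  have ind: "(LINT x|lborel. C * indicator (cbox (vector [a, b]) (vector [a', b'] :: real^2)) x) = C * ((a' - a) * (b' - b))"
    if "a \<le> a'" "b \<le> b'" for C a b a' b' :: real
    using that by (simp add: measure_cbox_2)
  have "(LINT x|lborel. kinks \<tau> x) = (\<Sum>k\<le>N. (\<Sum>i<n * 2 ^ k. 
        2 * \<tau> * ((m k i + \<tau> - (m k i - \<tau>)) * (\<theta> ^ k / (2 * \<theta>) - 0)) 
        + 2 * \<tau> * ((m k i + \<tau> - (m k i - \<tau>)) * (1 - (1 - \<theta> ^ k / (2 * \<theta>))))) 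
      + (c k * \<tau> * ((1 - 0) * (1 / 2 + \<rho> k + \<tau> - (1 / 2 + \<rho> k - \<tau>))) 
        + c k * \<tau> * ((1 - 0) * (1 / 2 - \<rho> k + \<tau> - (1 / 2 - \<rho> k - \<tau>)))))"
    unfolding kinks_def
    apply (subst Bochner_Integration.integral_sum, intro int)
    apply (rule sum.cong[OF refl])
    apply (subst Bochner_Integration.integral_add, (intro int)+)
    apply (subst Bochner_Integration.integral_sum, intro int)
    apply (rule arg_cong2[where f="(+)"])
     apply (rule sum.cong[OF refl])
     apply (subst Bochner_Integration.integral_add, (intro int)+)
     apply (rule arg_cong2[where f="(+)"]; rule ind)
        apply (use assms th in auto)[4]
    apply (subst Bochner_Integration.integral_add, (intro int)+)
    apply (rule arg_cong2[where f="(+)"]; rule ind)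
       apply (use assms th in auto)
    done
  also have "\<dots> = V * \<tau>\<^sup>2"
  proof -
    have "2 ^ k * \<theta> ^ k = q ^ k" for k by (simp add: \<theta>_def power_divide)
    then show ?thesis unfolding V_def sum_distrib_right
      by (intro sum.cong refl) (simp add: power2_eq_square field_simps)
  qed
  finally show "(LINT x|lborel. kinks \<tau> x) = V * \<tau>\<^sup>2" .
qed


lemma kinks_nonneg: "0 \<le> \<tau> \<Longrightarrow> 0 \<le> kinks \<tau> x"
  unfolding kinks_def using c_pos by (intro sum_nonneg add_nonneg_nonneg mult_nonneg_nonneg) (auto intro: less_imp_le)

lemma g_diff2:
  "diff2 (g k i) v x = - 2 * (ramp (x $ 1 - m k i + v $ 1) + ramp (x $ 1 - m k i - v $ 1) - 2 * ramp (x $ 1 - m k i))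
    - c k * ((ramp (x $ 2 - (1 / 2 + \<rho> k) + v $ 2) + ramp (x $ 2 - (1 / 2 + \<rho> k) - v $ 2) - 2 * ramp (x $ 2 - (1 / 2 + \<rho> k)))
      + (ramp ((1 / 2 - \<rho> k) - x $ 2 + v $ 2) + ramp ((1 / 2 - \<rho> k) - x $ 2 - v $ 2) - 2 * ramp ((1 / 2 - \<rho> k) - x $ 2)))"
proof -
  have e: "x $ 1 + v $ 1 - m k i = x $ 1 - m k i + v $ 1" "x $ 1 - v $ 1 - m k i = x $ 1 - m k i - v $ 1"
    "x $ 2 + v $ 2 - (1 / 2 + \<rho> k) = x $ 2 - (1 / 2 + \<rho> k) + v $ 2"
    "x $ 2 - v $ 2 - (1 / 2 + \<rho> k) = x $ 2 - (1 / 2 + \<rho> k) - v $ 2"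
    "(1 / 2 - \<rho> k) - (x $ 2 + v $ 2) = (1 / 2 - \<rho> k) - x $ 2 - v $ 2"
    "(1 / 2 - \<rho> k) - (x $ 2 - v $ 2) = (1 / 2 - \<rho> k) - x $ 2 + v $ 2"
    by auto
  have lin: "(A * (y + z - j) - 2 * R1 - C * (P1 + Q1)) + (A * (y - z - j) - 2 * R2 - C * (P2 + Q2)) - 2 * (A * (y - j) - 2 * R3 - C * (P3 + Q3))
     = - 2 * (R1 + R2 - 2 * R3) - C * ((P1 + P2 - 2 * P3) + (Q2 + Q1 - 2 * Q3))" for A y z j R1 C P1 Q1 R2 P2 Q2 R3 P3 Q3 :: real
    by (simp add: algebra_simps)
  show ?thesis unfolding diff2_def g_def T_def t_def vector_add_component vector_minus_component e by (rule lin)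
qed

text \<open>The height \<open>\<theta> ^ k / (2 * \<theta>)\<close> stands for half the power of
  exponent \<open>k - 1\<close>. For \<open>k = 0\<close> it exceeds \<open>1\<close>, so that the
  strip is the whole square without a case distinction in \<open>kinks\<close>.\<close>

lemma active_strip:
  assumes "\<bar>x $ 2 - 1 / 2\<bar> < 1 / 2" "k = 0 \<or> \<rho> (k - 1) \<le> \<bar>x $ 2 - 1 / 2\<bar>"
  shows "(0 \<le> x $ 2 \<and> x $ 2 \<le> \<theta> ^ k / (2 * \<theta>)) \<or> (1 - \<theta> ^ k / (2 * \<theta>) \<le> x $ 2 \<and> x $ 2 \<le> 1)"
proof (cases k)
  case 0
  have "1 \<le> 1 / (2 * \<theta>)" using \<theta> by (simp add: field_simps)
  then show ?thesis using 0 assms by (auto simp: abs_less_iff)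
next
  case (Suc l)
  have "\<theta> ^ k / (2 * \<theta>) = \<theta> ^ l / 2" using Suc \<theta>(1) by simp
  then show ?thesis using assms Suc by (auto simp: abs_if \<rho>_def field_simps split: if_splits)
qed

text \<open>The maximum \<open>w\<close> lies above the active function at \<open>x + v\<close> and
  \<open>x - v\<close> and equals it at \<open>x\<close>, so its second difference is the larger
  one. Where \<open>w\<close> vanishes it has a minimum and the second difference is nonnegative.
  The choice of the coarsest active function keeps the ridges short.\<close>

lemma w_diff2_lower:
  assumes "\<And>i. \<bar>v $ i\<bar> \<le> \<tau>" 
  shows "- diff2 w v x \<le> kinks \<tau> x"
proof (cases rule: w_cases_minimal[of x])
  case 1
  have "0 \<le> \<tau>" using assms[of 1] by linarith
  then show ?thesis using 1 w_nonneg[of "x + v"] w_nonneg[of "x - v"] kinks_nonneg[of \<tau> x] by (simp add: diff2_def)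
next
  case (2 k i)
  have \<tau>: "0 \<le> \<tau>" using assms[of 1] by linarith
  have gp: "0 < g k i x" using 2 by simp
  note loc = g_pos[OF gp 2(1)]
  let ?a = "if \<bar>x $ 1 - m k i\<bar> \<le> \<tau> then \<tau> else 0"
  let ?b = "if \<bar>x $ 2 - (1 / 2 + \<rho> k)\<bar> \<le> \<tau> then \<tau> else 0"
  let ?d = "if \<bar>(1 / 2 - \<rho> k) - x $ 2\<bar> \<le> \<tau> then \<tau> else 0"
  let ?B1 = "cbox (vector [m k i - \<tau>, 0]) (vector [m k i + \<tau>, \<theta> ^ k / (2 * \<theta>)]) :: (real^2) set"
  let ?B2 = "cbox (vector [m k i - \<tau>, 1 - \<theta> ^ k / (2 * \<theta>)]) (vector [m k i + \<tau>, 1]) :: (real^2) set"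
  let ?B3 = "cbox (vector [0, 1 / 2 + \<rho> k - \<tau>]) (vector [1, 1 / 2 + \<rho> k + \<tau>]) :: (real^2) set"
  let ?B4 = "cbox (vector [0, 1 / 2 - \<rho> k - \<tau>]) (vector [1, 1 / 2 - \<rho> k + \<tau>]) :: (real^2) set"
  have "- diff2 w v x \<le> - diff2 (g k i) v x"
    using g_le_w[OF 2(1), of "x + v"] g_le_w[OF 2(1), of "x - v"] 2(2) by (simp add: diff2_def)
  also have "\<dots> \<le> 2 * ?a + c k * (?b + ?d)"
  proof -
    have "c k * ((ramp (x $ 2 - (1 / 2 + \<rho> k) + v $ 2) + ramp (x $ 2 - (1 / 2 + \<rho> k) - v $ 2) - 2 * ramp (x $ 2 - (1 / 2 + \<rho> k)))
      + (ramp ((1 / 2 - \<rho> k) - x $ 2 + v $ 2) + ramp ((1 / 2 - \<rho> k) - x $ 2 - v $ 2) - 2 * ramp ((1 / 2 - \<rho> k) - x $ 2)))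
      \<le> c k * (?b + ?d)"
      by (intro mult_left_mono add_mono ramp_diff2 assms less_imp_le c_pos)
    moreover have "- (- 2 * R - X) \<le> 2 * A + Y" if "R \<le> A" "X \<le> Y" for R A X Y :: real
      using that by linarith
    ultimately show ?thesis unfolding g_diff2 using ramp_diff2[OF assms, of "x $ 1 - m k i" 1] by blast
  qed
  also have "\<dots> \<le> (\<Sum>i<n * 2 ^ k. 2 * \<tau> * indicator (cbox (vector [m k i - \<tau>, 0]) (vector [m k i + \<tau>, \<theta> ^ k / (2 * \<theta>)])) x
        + 2 * \<tau> * indicator (cbox (vector [m k i - \<tau>, 1 - \<theta> ^ k / (2 * \<theta>)]) (vector [m k i + \<tau>, 1])) x)
     + (c k * \<tau> * indicator ?B3 x + c k * \<tau> * indicator ?B4 x)"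
  proof (rule add_mono)
    have "\<bar>x $ 2 - 1 / 2\<bar> < 1 / 2" using loc(3) \<rho>(2)[of "Suc k"] by linarith
    from active_strip[OF this 2(4)]
    have "2 * ?a \<le> 2 * \<tau> * indicator ?B1 x + 2 * \<tau> * indicator ?B2 x"
      using \<tau> by (auto simp: indicator_def mem_cbox_2 abs_le_iff)
    also have "\<dots> \<le> (\<Sum>i<n * 2 ^ k. 2 * \<tau> * indicator (cbox (vector [m k i - \<tau>, 0]) (vector [m k i + \<tau>, \<theta> ^ k / (2 * \<theta>)])) x
        + 2 * \<tau> * indicator (cbox (vector [m k i - \<tau>, 1 - \<theta> ^ k / (2 * \<theta>)]) (vector [m k i + \<tau>, 1])) x)"
      using 2(1) \<tau> by (intro member_le_sum) (auto simp: I_def)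
    finally show "2 * ?a \<le> \<dots>" .
    have "?b \<le> \<tau> * indicator ?B3 x" "?d \<le> \<tau> * indicator ?B4 x"
      using \<tau> loc by (auto simp: indicator_def mem_cbox_2 abs_le_iff)
    then have "c k * (?b + ?d) \<le> c k * (\<tau> * indicator ?B3 x + \<tau> * indicator ?B4 x)"
      by (rule mult_left_mono[OF add_mono less_imp_le[OF c_pos]])
    then show "c k * (?b + ?d) \<le> c k * \<tau> * indicator ?B3 x + c k * \<tau> * indicator ?B4 x"
      by (simp add: distrib_left)
  qed
  also have "\<dots> \<le> kinks \<tau> x"
    unfolding kinks_def
  proof (rule member_le_sum[of k "{..N}"])
    show "k \<in> {..N}" using 2(1) by (simp add: I_def)
  qed (auto intro!: add_nonneg_nonneg sum_nonneg mult_nonneg_nonneg simp: \<tau> less_imp_le[OF c_pos])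
  finally show ?thesis .
qed

lemma w_diff2_integral:
  assumes \<tau>: "0 < \<tau>" and v: "\<And>i. \<bar>v $ i\<bar> \<le> \<tau>"
  shows "(\<integral>\<^sup>+x. ennreal \<bar>diff2 w v x\<bar> \<partial>lborel) \<le> ennreal (2 * V * \<tau>\<^sup>2)"
proof -
  have wm: "w \<in> borel_measurable borel" by (rule borel_measurable_continuous_onI[OF w_continuous])
  have i0: "integrable lebesgue w" by (rule integrable_continuous_box[OF w_continuous w_outside])
  have i1: "integrable lebesgue (\<lambda>x. w (x + u))" for u
    using integrable_mult_shift[OF continuous_on_const[of _ 1] w_continuous, of 0 1 u] w_outside by simp
  have eq: "diff2 w v x = w (x + v) + w (x + - v) - 2 * w x" for x by (simp add: diff2_def)
  have i: "integrable lebesgue (diff2 w v)"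
    unfolding eq[abs_def] by (intro Bochner_Integration.integrable_add Bochner_Integration.integrable_diff integrable_mult_right i0 i1)
  have z: "(LINT x|lebesgue. diff2 w v x) = 0"
    unfolding eq using lebesgue_integral_translation[OF wm] 
    by (simp add: Bochner_Integration.integral_add Bochner_Integration.integral_diff i0 i1 del: add_uminus_conv_diff)
  have km: "kinks \<tau> \<in> borel_measurable lborel" using kinks_integral(1)[OF \<tau>] by (rule borel_measurable_integrable)
  have ki: "integrable lebesgue (kinks \<tau>)" "(LINT x|lebesgue. kinks \<tau> x) = V * \<tau>\<^sup>2"
    using kinks_integral[OF \<tau>] km by (simp_all add: integrable_completion integral_completion)
  have "(LINT x|lebesgue. \<bar>diff2 w v x\<bar>) \<le> (LINT x|lebesgue. diff2 w v x + 2 * kinks \<tau> x)"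
  proof (rule integral_mono)
    \<comment> \<open>Adding twice a bound on the negative part dominates the modulus; the first
      summand integrates to \<open>0\<close> by translation invariance.\<close>
    fix x show "\<bar>diff2 w v x\<bar> \<le> diff2 w v x + 2 * kinks \<tau> x"
      using w_diff2_lower[of v \<tau> x, OF v] kinks_nonneg[of \<tau> x] \<tau> by linarith
  qed (use i ki in auto)
  also have "\<dots> = 2 * V * \<tau>\<^sup>2" using i ki z by simp
  finally have "(LINT x|lebesgue. \<bar>diff2 w v x\<bar>) \<le> 2 * V * \<tau>\<^sup>2" .
  moreover have "(\<integral>\<^sup>+x. ennreal \<bar>diff2 w v x\<bar> \<partial>lborel) = ennreal (LINT x|lebesgue. \<bar>diff2 w v x\<bar>)"
    unfolding nn_integral_completion[of lborel, symmetric] using i by (intro nn_integral_eq_integral) auto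
  ultimately show ?thesis by (simp add: ennreal_leI)
qed

definition u :: "real^2 \<Rightarrow> real^2" where "u x = vector [f x, 0]"

lemma u_D2_TV: "D2_TV U u \<le> ennreal (16 * V)"
proof -
  have "D2_TV U (\<lambda>x. vector [f x, 0] :: real^2) \<le> ennreal (8 * (2 * V))"
  proof (rule D2_TV_le[OF f_continuous])
    fix \<tau> :: real and v :: "real^2"
    assume \<tau>: "0 < \<tau>" and v: "\<And>i. \<bar>v $ i\<bar> \<le> \<tau>"
    have "diff2 f v x = diff2 w v x" for x by (simp add: diff2_def f_def algebra_simps)
    then show "(\<integral>\<^sup>+x. ennreal \<bar>diff2 f v x\<bar> \<partial>lborel) \<le> ennreal (2 * V * \<tau>\<^sup>2)"
      using w_diff2_integral[OF \<tau>, of v] v by simp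
  qed (use V_nonneg in simp)
  then show ?thesis by (simp add: u_def[abs_def])
qed

section \<open>Gradient and elastic energy of the construction\<close>

text \<open>Here \<open>\<sigma>\<close> is the first partial derivative of \<open>f\<close>, and \<open>s\<close> is the sign of the slope of the
  penalty in direction \<open>x $ 2\<close>.\<close>

definition piece :: "nat \<Rightarrow> nat \<Rightarrow> real \<Rightarrow> real \<Rightarrow> (real^2) \<times> real" where
  "piece k i \<sigma> s = (vector [\<sigma>, - s * c k],
     (if \<sigma> = 1 then - (1 - \<mu>) * real i * h k else (1 + \<mu>) * (real i + 1) * h k) + s * c k / 2 + \<bar>s\<bar> * c k * \<rho> k)"

text \<open>A finite superset of the affine branches of \<open>f\<close>, as required by
  \<open>piecewise_affine_weak_gradient\<close>.\<close>

definition pieces :: "((real^2) \<times> real) set" where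
  "pieces = insert (vector [\<mu>, 0], 0) ((\<lambda>((k, i), \<sigma>, s). piece k i \<sigma> s) ` (I \<times> {1, -1} \<times> {0, 1, -1}))"

lemma finite_pieces: "finite pieces"
  unfolding pieces_def by (auto intro: finite_I)

lemma piece_in: "(k, i) \<in> I \<Longrightarrow> \<sigma> \<in> {1, -1} \<Longrightarrow> s \<in> {0, 1, -1} \<Longrightarrow> piece k i \<sigma> s \<in> pieces"
  unfolding pieces_def by (intro insertI2 image_eqI[of _ _ "((k, i), \<sigma>, s)"]) auto

lemma inner_vector_2: "(vector [a, b] :: real^2) \<bullet> x = a * x $ 1 + b * x $ 2"
  by (simp add: inner_vec_def sum_2)

text \<open>\<open>\<sigma>\<close> records the side of the ridge and \<open>s\<close> the side of
  the penalty. The clause on \<open>s = 0\<close> makes the region where generation \<open>k\<close>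
  is not penalised free of elastic energy.\<close>

lemma piece_value:
  obtains \<sigma> s where "\<sigma> \<in> {1, -1}" "s \<in> {0, 1, -1}" "\<bar>x $ 2 - 1 / 2\<bar> \<le> \<rho> k \<Longrightarrow> s = 0"
    "\<mu> * x $ 1 + g k i x = fst (piece k i \<sigma> s) \<bullet> x + snd (piece k i \<sigma> s)"
proof -
  define \<sigma> :: real where "\<sigma> = (if x $ 1 \<le> m k i then 1 else -1)"
  define s :: real where "s = (if \<bar>x $ 2 - 1 / 2\<bar> \<le> \<rho> k then 0 else if 1 / 2 \<le> x $ 2 then 1 else -1)"
  have T: "\<mu> * x $ 1 + T k i (x $ 1) = \<sigma> * x $ 1 + (if \<sigma> = 1 then - (1 - \<mu>) * real i * h k else (1 + \<mu>) * (real i + 1) * h k)"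
    by (auto simp: T_def ramp_def \<sigma>_def m_def max_def algebra_simps add_divide_distrib)
  have t: "t k (x $ 2) = s * c k * x $ 2 - (s * c k / 2 + \<bar>s\<bar> * c k * \<rho> k)"
  proof (cases "\<bar>x $ 2 - 1 / 2\<bar> \<le> \<rho> k")
    case True
    then show ?thesis by (simp add: t_zero s_def)
  next
    case False
    then show ?thesis using \<rho>(1)[of k] by (auto simp: t_def s_def ramp_def max_def abs_le_iff algebra_simps)
  qed
  show thesis
  proof (rule that[of \<sigma> s])
    show "\<sigma> \<in> {1, -1}" "s \<in> {0, 1, -1}" "\<bar>x $ 2 - 1 / 2\<bar> \<le> \<rho> k \<Longrightarrow> s = 0" by (auto simp: \<sigma>_def s_def)
    show "\<mu> * x $ 1 + g k i x = fst (piece k i \<sigma> s) \<bullet> x + snd (piece k i \<sigma> s)"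
      using T t by (simp add: g_def piece_def inner_vector_2)
  qed
qed

lemma f_pieces: "\<exists>(v, c)\<in>pieces. f x = v \<bullet> x + c"
proof (cases rule: w_cases[of x])
  case 1
  then have "f x = vector [\<mu>, 0] \<bullet> x + 0" by (simp add: f_def inner_vector_2)
  then show ?thesis unfolding pieces_def by blast
next
  case (2 k i)
  obtain \<sigma> s where *: "\<sigma> \<in> {1, -1}" "s \<in> {0, 1, -1}" 
    "\<mu> * x $ 1 + g k i x = fst (piece k i \<sigma> s) \<bullet> x + snd (piece k i \<sigma> s)"
    using piece_value[of x k i] by metis
  show ?thesis using piece_in[OF 2(1) *(1,2)] *(3) 2(2)
    by (intro bexI[of _ "piece k i \<sigma> s"]) (auto simp: f_def split_beta)
qed

text \<open>Dominates the indicator of the part of the square where generation \<open>k\<close> is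
  penalised. It is a sum over the two edges, so that its integral is simply the total area
  \<open>\<theta> ^ k\<close>.\<close>

definition strip :: "nat \<Rightarrow> real^2 \<Rightarrow> real" where
  "strip k x = indicator (cbox (vector [0, 0]) (vector [1, \<theta> ^ k / 2])) x + indicator (cbox (vector [0, 1 - \<theta> ^ k / 2]) (vector [1, 1])) x"

lemma strip_ge: 
  assumes "x \<in> cbox 0 1" "\<rho> k \<le> \<bar>x $ 2 - 1 / 2\<bar>" shows "1 \<le> strip k x"
proof -
  have "x $ 2 \<le> \<theta> ^ k / 2 \<or> 1 - \<theta> ^ k / 2 \<le> x $ 2"
    using assms(2) by (auto simp: \<rho>_def abs_if field_simps split: if_splits)
  then have "x \<in> cbox (vector [0, 0]) (vector [1, \<theta> ^ k / 2]) \<or> x \<in> cbox (vector [0, 1 - \<theta> ^ k / 2]) (vector [1, 1])"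
    using assms(1) by (auto simp: mem_cbox_2 mem_box_cart forall_2)
  then show ?thesis by (auto simp: strip_def indicator_def)
qed

lemma strip_nonneg: "0 \<le> strip k x" by (simp add: strip_def)

lemma strip_integral: "integrable lborel (strip k)" "(LINT x|lborel. strip k x) = \<theta> ^ k"
proof -
  have i: "integrable lborel (\<lambda>x. indicator (cbox a b) x :: real)" for a b :: "real^2"
    using integrable_indicator_cbox[of 1 a b] by simp
  show "integrable lborel (strip k)" unfolding strip_def[abs_def] by (intro Bochner_Integration.integrable_add i)
  have "0 \<le> \<theta> ^ k" using \<theta> by simp
  then show "(LINT x|lborel. strip k x) = \<theta> ^ k"
    unfolding strip_def by (subst Bochner_Integration.integral_add[OF i i]) (simp add: measure_cbox_2)
qed

lemma norm_vector_matrix: "norm (vector [vector [a, b], 0] :: real^2^2) \<le> \<bar>a\<bar> + \<bar>b\<bar>"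
proof -
  have "(vector [vector [a, b], 0] :: real^2^2) = axis 1 (vector [a, b])" by (auto simp: vec_eq_iff forall_2 axis_def)
  then show ?thesis using norm_le_l1_cart[of "vector [a, b] :: real^2"] by (simp add: norm_axis sum_2)
qed

lemma infdist_K2_le:
  assumes "\<sigma> \<in> {1, -1}" 
  shows "infdist (vector [vector [a, b], 0]) K2 \<le> \<bar>a - \<sigma>\<bar> + \<bar>b\<bar>"
proof -
  have "vector [vector [a, b], 0] - Fmat \<sigma> = vector [vector [a - \<sigma>, b], 0]"
    by (simp add: Fmat_def vec_eq_iff forall_2)
  then have "dist (vector [vector [a, b], 0]) (Fmat \<sigma>) \<le> \<bar>a - \<sigma>\<bar> + \<bar>b\<bar>"
    using norm_vector_matrix[of "a - \<sigma>" b] by (simp add: dist_norm)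
  moreover have "Fmat \<sigma> \<in> K2" using assms by (auto simp: K2_Fmat)
  ultimately show ?thesis using infdist_le order_trans by blast
qed

lemma node_exists:
  assumes "0 \<le> y" "y \<le> 1"
  obtains i where "(N, i) \<in> I" "real i * h N \<le> y" "y \<le> (real i + 1) * h N"
proof -
  let ?M = "n * 2 ^ N"
  have M: "0 < ?M" "h N = 1 / real ?M" using n by (auto simp: h_def)
  show thesis
  \<comment> \<open>At \<open>y = 1\<close> the floor would yield the index
    \<open>n * 2 ^ N\<close>, one beyond the last tent.\<close>
  proof (cases "y = 1")
    case True
    show thesis
    proof (rule that[of "?M - 1"])
      show "(N, ?M - 1) \<in> I" using M by (simp add: I_def)
      have r: "real (?M - 1) = real ?M - 1" using M by (simp add: of_nat_diff)
      show "real (?M - 1) * h N \<le> y" "y \<le> (real (?M - 1) + 1) * h N"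
        unfolding r M(2) using M(1) True by (auto simp: field_simps)
    qed
  next
    case False
    define i where "i = nat \<lfloor>y * real ?M\<rfloor>"
    have i: "real i = of_int \<lfloor>y * real ?M\<rfloor>" using assms M by (simp add: i_def)
    have 1: "real i \<le> y * real ?M" "y * real ?M < real i + 1" unfolding i by linarith+
    have "y * real ?M < 1 * real ?M" using False assms M by (intro mult_strict_right_mono) auto
    then have "i < ?M" using 1 by linarith
    then have "(N, i) \<in> I" by (simp add: I_def)
    moreover have "real i * h N \<le> y" "y \<le> (real i + 1) * h N"
      unfolding M(2) using 1 M(1) by (auto simp: pos_divide_le_eq pos_le_divide_eq)
    ultimately show thesis using that by blast
  qed
qed

text \<open>Where generation \<open>N\<close> is not penalised its tents are nonnegative. If
  \<open>w x = 0\<close>, one of them vanishes at \<open>x\<close>, so both the piece of slope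
  \<open>\<mu>\<close> and a piece of slope 1 or -1 match \<open>f\<close> there; \<open>gr\<close>
  would then prescribe two different gradients. Such points thus belong to the exceptional null
  set.\<close>

lemma zero_set_strip:
  assumes x: "x \<in> cbox 0 1" and w: "w x = 0"
    and gr: "\<forall>(v, c)\<in>pieces. f x = v \<bullet> x + c \<longrightarrow> grad u x = vector [v, 0]"
  shows "\<rho> N \<le> \<bar>x $ 2 - 1 / 2\<bar>"
proof (rule ccontr)
  assume *: "\<not> ?thesis"
  then have t: "t N (x $ 2) = 0" by (intro t_zero) simp
  obtain i where i: "(N, i) \<in> I" "real i * h N \<le> x $ 1" "x $ 1 \<le> (real i + 1) * h N"
    using node_exists[of "x $ 1"] x by (auto simp: mem_box_cart)
  have "T N i (x $ 1) = 0"
    using T_nonneg[OF i(2,3)] g_le_w[OF i(1), of x] w t by (simp add: g_def)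
  then have "f x = \<mu> * x $ 1 + g N i x" using w t by (simp add: f_def g_def)
  moreover obtain \<sigma> s where s: "\<sigma> \<in> {1, -1}" "s \<in> {0, 1, -1}" 
    "\<mu> * x $ 1 + g N i x = fst (piece N i \<sigma> s) \<bullet> x + snd (piece N i \<sigma> s)"
    using piece_value[of x N i] by metis
  ultimately have "grad u x = vector [fst (piece N i \<sigma> s), 0]"
    using gr piece_in[OF i(1) s(1,2)] by (auto simp: split_beta)
  moreover have "grad u x = vector [vector [\<mu>, 0], 0]"
    using gr w by (auto simp: pieces_def f_def inner_vector_2)
  ultimately have "vector [fst (piece N i \<sigma> s), 0] $ 1 $ 1 = (vector [vector [\<mu>, 0], 0] :: real^2^2) $ 1 $ 1" by simp
  then show False using s(1) mu by (auto simp: piece_def)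
qed

text \<open>The two parts are the vertical slopes \<open>c k\<close> in the penalised strips and the
  set where \<open>w\<close> vanishes, on which the gradient is the boundary datum at distance at
  most \<open>2\<close> from a well.\<close>

definition eb :: "real^2 \<Rightarrow> real" where
  "eb x = (\<Sum>k\<le>N. c k powr p * strip k x) + 2 powr p * strip N x"

lemma eb_nonneg: "0 \<le> eb x"
  unfolding eb_def using strip_nonneg by (intro add_nonneg_nonneg sum_nonneg mult_nonneg_nonneg) auto

text \<open>Where generation \<open>k\<close> is active, the first partial derivative is in the
  wells and the distance is at most the slope \<open>\<bar>s\<bar> * c k\<close> of the penalty.
  Summing over all generations avoids tracking which one is active.\<close>

lemma energy_density:
  assumes x: "x \<in> cbox 0 1" 
    and gr: "\<forall>(v, c)\<in>pieces. f x = v \<bullet> x + c \<longrightarrow> grad u x = vector [v, 0]"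
  shows "infdist (grad u x) K2 powr p \<le> eb x"
proof (cases rule: w_cases[of x])
  case 1
  have "grad u x = vector [vector [\<mu>, 0], 0]"
    using gr 1 by (auto simp: pieces_def f_def inner_vector_2)
  then have "infdist (grad u x) K2 \<le> 2" using infdist_K2_le[of 1 \<mu> 0] mu by simp
  then have "infdist (grad u x) K2 powr p \<le> 2 powr p * 1"
    unfolding mult_1_right using p by (intro powr_mono2 infdist_nonneg) auto
  also have "\<dots> \<le> 2 powr p * strip N x"
    using strip_ge[OF x zero_set_strip[OF x 1 gr]] by (intro mult_left_mono) auto
  also have "\<dots> \<le> eb x" unfolding eb_def using strip_nonneg by (simp add: sum_nonneg)
  finally show ?thesis .
next
  case (2 k i)
  obtain \<sigma> s where s: "\<sigma> \<in> {1, -1}" "s \<in> {0, 1, -1}" "\<bar>x $ 2 - 1 / 2\<bar> \<le> \<rho> k \<Longrightarrow> s = 0"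
    "\<mu> * x $ 1 + g k i x = fst (piece k i \<sigma> s) \<bullet> x + snd (piece k i \<sigma> s)"
    using piece_value[of x k i] by metis
  have "grad u x = vector [fst (piece k i \<sigma> s), 0]"
    using gr piece_in[OF 2(1) s(1,2)] s(4) 2(2) by (auto simp: split_beta f_def)
  then have id: "infdist (grad u x) K2 \<le> \<bar>s\<bar> * c k"
    using infdist_K2_le[OF s(1), of \<sigma> "- s * c k"] c_pos[of k] by (simp add: piece_def abs_mult)
  show ?thesis
  proof (cases "\<bar>x $ 2 - 1 / 2\<bar> \<le> \<rho> k")
    case True
    then have "infdist (grad u x) K2 = 0" using id s(3) infdist_nonneg[of "grad u x" K2] by auto
    then show ?thesis using eb_nonneg[of x] p by simp
  next
    case False
    have "\<bar>s\<bar> * c k \<le> 1 * c k" using s(2) c_pos[of k] by (intro mult_right_mono) auto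
    then have "infdist (grad u x) K2 powr p \<le> c k powr p * 1" using id p infdist_nonneg by (auto intro!: powr_mono2)
    also have "\<dots> \<le> c k powr p * strip k x"
      using strip_ge[OF x, of k] False by (intro mult_left_mono) auto
    also have "\<dots> \<le> (\<Sum>k\<le>N. c k powr p * strip k x)"
      using 2(1) strip_nonneg by (intro member_le_sum) (auto simp: I_def)
    also have "\<dots> \<le> eb x" unfolding eb_def using strip_nonneg[of N x] by simp
    finally show ?thesis .
  qed
qed

lemma u_gradient:
  "W1p_loc p u" "AE x in lebesgue. \<forall>(v, c)\<in>pieces. f x = v \<bullet> x + c \<longrightarrow> grad u x = vector [v, 0]"
  using piecewise_affine_weak_gradient[OF f_lipschitz finite_pieces f_pieces, of p] p 
  unfolding u_def[abs_def] by auto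

lemma u_admissible: "u \<in> admissible p (Fmat \<mu>)"
proof -
  have "u x = Fmat \<mu> *v x + 0" if "x \<notin> cbox 0 1" for x
    using w_outside[OF that] by (simp add: u_def f_def vec_eq_iff forall_2)
  then have "AE x in lebesgue. x \<notin> cbox 0 1 \<longrightarrow> u x = Fmat \<mu> *v x + 0" by (intro AE_I2) auto
  then show ?thesis using u_gradient(1) unfolding admissible_def by blast
qed

lemma u_energy:
  assumes "0 \<le> \<epsilon>"
  shows "energy p \<epsilon> u \<le> ennreal ((\<Sum>k\<le>N. c k powr p * \<theta> ^ k) + 2 powr p * \<theta> ^ N + \<epsilon> * (16 * V))"
proof -
  have ei: "integrable lborel eb" "(LINT x|lborel. eb x) = (\<Sum>k\<le>N. c k powr p * \<theta> ^ k) + 2 powr p * \<theta> ^ N"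
    unfolding eb_def[abs_def] by (auto simp: strip_integral Bochner_Integration.integral_sum)
  have "(\<integral>\<^sup>+x\<in>cbox 0 1. ennreal (infdist (grad u x) K2 powr p) \<partial>lebesgue) \<le> (\<integral>\<^sup>+x. ennreal (eb x) \<partial>lebesgue)"
  proof (rule nn_integral_mono_AE)
    show "AE x in lebesgue. ennreal (infdist (grad u x) K2 powr p) * indicator (cbox 0 1) x \<le> ennreal (eb x)"
      using u_gradient(2)
    proof eventually_elim
      case (elim x)
      then show ?case using energy_density[OF _ elim] by (auto simp: indicator_def ennreal_leI)
    qed
  qed
  also have "\<dots> = ennreal (LINT x|lborel. eb x)"
    unfolding nn_integral_completion using ei(1) by (intro nn_integral_eq_integral) (auto simp: eb_nonneg)
  finally have 1: "(\<integral>\<^sup>+x\<in>cbox 0 1. ennreal (infdist (grad u x) K2 powr p) \<partial>lebesgue) 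
    \<le> ennreal ((\<Sum>k\<le>N. c k powr p * \<theta> ^ k) + 2 powr p * \<theta> ^ N)" using ei(2) by simp
  have 2: "ennreal \<epsilon> * D2_TV (box 0 1) u \<le> ennreal (\<epsilon> * (16 * V))"
    using mult_left_mono[OF u_D2_TV, of "ennreal \<epsilon>" "box 0 1"] assms V_nonneg by (simp add: ennreal_mult)
  have nn: "0 \<le> (\<Sum>k\<le>N. c k powr p * \<theta> ^ k) + 2 powr p * \<theta> ^ N" "0 \<le> \<epsilon> * (16 * V)"
    using \<theta> assms V_nonneg by (auto intro!: add_nonneg_nonneg sum_nonneg)
  show ?thesis unfolding energy_def ennreal_plus[OF nn] by (rule add_mono[OF 1 2])
qed

section \<open>Summation over the generations and the choice of \<open>n\<close> and
  \<open>N\<close>\<close>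

lemma geometric_sum_le: "(\<Sum>k\<le>N. q ^ k) \<le> 1 / (1 - q)"
proof -
  have "(1 - q) * (\<Sum>k\<le>N. q ^ k) = 1 - q ^ Suc N" by (rule sum_gp_basic)
  also have "\<dots> \<le> 1" using q by simp
  finally show ?thesis using q by (simp add: field_simps)
qed

lemma inverse_geometric_sum_le: "(\<Sum>k\<le>M. 1 / q ^ k) \<le> 1 / (q ^ M * (1 - q))"
proof (induction M)
  case 0
  show ?case using q by (simp add: field_simps)
next
  case (Suc M)
  have "(\<Sum>k\<le>Suc M. 1 / q ^ k) \<le> 1 / (q ^ M * (1 - q)) + 1 / q ^ Suc M" using Suc by simp
  also have "\<dots> = 1 / (q ^ Suc M * (1 - q))" using q by (simp add: field_simps)
  finally show ?case .
qed

lemma q_power_powr: "(q ^ k) powr p = (1 / 2) ^ k"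
proof -
  have "(q ^ k) powr p = (q powr p) ^ k" using q by (simp add: powr_realpow[symmetric] powr_powr mult.commute)
  then show ?thesis using q by simp
qed

text \<open>The summands belong to the penalty slopes, the leftover strips, and the total variation,
  the last split into ridges of tents and creases of penalties.\<close>

definition C0 :: real where
  "C0 = 2 powr p / (1 - q) + 2 powr p + 16 * (8 / (\<theta> * (1 - q)) + 8 / (q * (1 - q)))"

lemma C0_pos: "0 < C0"
  unfolding C0_def using q \<theta> by (intro add_pos_pos mult_pos_pos divide_pos_pos) auto

text \<open>Since \<open>q powr p = 1 / 2\<close>, the elastic terms equal
  \<open>(2 / n) powr p * q ^ k\<close> and sum geometrically. In \<open>V\<close> the ridges
  contribute order \<open>n\<close> and the creases \<open>1 / (n * q ^ N)\<close>; the lower bound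
  on \<open>q ^ N\<close> keeps the latter bounded, so \<open>N\<close> must be neither too small
  nor too large.\<close>

lemma energy_estimate:
  assumes e: "0 < e" "e < 1" and n_e: "1 / e \<le> real n" "real n \<le> 2 / e" and N_e: "q ^ N \<le> e" "q * e \<le> q ^ N"
  shows "(\<Sum>k\<le>N. c k powr p * \<theta> ^ k) + 2 powr p * \<theta> ^ N + (e powr p * e) * (16 * V) \<le> C0 * e powr p"
proof -
  have ep: "0 \<le> e powr p" by simp
  have \<theta>k: "\<theta> ^ k = q ^ k * (1 / 2) ^ k" for k by (simp add: \<theta>_def power_divide)
  have "c k powr p * \<theta> ^ k = 2 powr p * (1 / real n) powr p * q ^ k" for k
  proof -
    have "c k powr p = 2 powr p / ((q ^ k) powr p * real n powr p)"
      using q by (simp add: c_def powr_divide powr_mult)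
    also have "\<dots> = 2 powr p * (1 / real n) powr p / (1 / 2) ^ k"
      unfolding q_power_powr by (simp add: powr_divide)
    finally show ?thesis by (simp add: \<theta>k power_divide)
  qed
  then have "(\<Sum>k\<le>N. c k powr p * \<theta> ^ k) = 2 powr p * (1 / real n) powr p * (\<Sum>k\<le>N. q ^ k)"
    by (simp add: sum_distrib_left)
  also have "\<dots> \<le> 2 powr p * e powr p * (1 / (1 - q))"
  proof (intro mult_mono geometric_sum_le order_refl)
    have "1 / real n \<le> e" using n_e e n by (simp add: field_simps)
    then show "(1 / real n) powr p \<le> e powr p" using p by (intro powr_mono2) auto
    show "0 \<le> (\<Sum>k\<le>N. q ^ k)" using q by (intro sum_nonneg) auto
  qed auto
  finally have 1: "(\<Sum>k\<le>N. c k powr p * \<theta> ^ k) \<le> 2 powr p / (1 - q) * e powr p" by simp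
  \<comment> \<open>Only the second factor is estimated by \<open>e powr p\<close>; the first one is
    merely bounded by \<open>1\<close>.\<close>
  have "\<theta> ^ N = q ^ N * (q ^ N) powr p" unfolding q_power_powr by (rule \<theta>k)
  also have "\<dots> \<le> 1 * e powr p"
    using q N_e p e by (intro mult_mono powr_mono2) auto
  finally have 2: "2 powr p * \<theta> ^ N \<le> 2 powr p * e powr p" by simp
  have "V = 4 * real n / \<theta> * (\<Sum>k\<le>N. q ^ k) + 8 / real n * (\<Sum>k\<le>N. 1 / q ^ k)"
    unfolding V_def sum.distrib sum_distrib_left by (intro arg_cong2[where f="(+)"] sum.cong refl) (auto simp: c_def)
  also have "\<dots> \<le> (8 / e) / \<theta> * (1 / (1 - q)) + 8 * e * (1 / (q * e * (1 - q)))"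
  proof (intro add_mono mult_mono geometric_sum_le)
    show "4 * real n / \<theta> \<le> 8 / e / \<theta>" using n_e \<theta> by (intro divide_right_mono) auto
    show "8 / real n \<le> 8 * e" using n_e e n by (simp add: field_simps)
    have "1 / (q ^ N * (1 - q)) \<le> 1 / (q * e * (1 - q))"
      using N_e q e by (intro divide_left_mono mult_right_mono mult_pos_pos) auto
    then show "(\<Sum>k\<le>N. 1 / q ^ k) \<le> 1 / (q * e * (1 - q))" using inverse_geometric_sum_le[of N] by linarith
  qed (use q \<theta> e in \<open>auto intro!: sum_nonneg\<close>)
  also have "8 * e * (1 / (q * e * (1 - q))) = 8 / (q * (1 - q))" using e by simp
  finally have "e * V \<le> e * ((8 / e) / \<theta> * (1 / (1 - q)) + 8 / (q * (1 - q)))" using e by (intro mult_left_mono) auto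
  also have "\<dots> = 8 / (\<theta> * (1 - q)) + e * (8 / (q * (1 - q)))" using e by (simp add: distrib_left)
  also have "\<dots> \<le> 8 / (\<theta> * (1 - q)) + 1 * (8 / (q * (1 - q)))"
    using e q by (intro add_left_mono mult_right_mono) auto
  finally have 3: "e powr p * 16 * (e * V) \<le> e powr p * 16 * (8 / (\<theta> * (1 - q)) + 8 / (q * (1 - q)))"
    by (intro mult_left_mono) auto
  have "(e powr p * e) * (16 * V) = e powr p * 16 * (e * V)" by simp
  moreover have "C0 * e powr p = 2 powr p / (1 - q) * e powr p + 2 powr p * e powr p
      + e powr p * 16 * (8 / (\<theta> * (1 - q)) + 8 / (q * (1 - q)))"
    unfolding C0_def by (simp only: distrib_left distrib_right mult_ac add_ac)
  ultimately show ?thesis using add_mono[OF add_mono[OF 1 2] 3] by simp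
qed

end

lemma min_energy_upper_bound:
  assumes p: "1 \<le> p" and \<mu>: "\<bar>\<mu>\<bar> < 1"
  obtains C where "0 < C" 
    "\<And>\<epsilon>. 0 < \<epsilon> \<Longrightarrow> \<epsilon> < 1 \<Longrightarrow> min_energy p \<epsilon> (Fmat \<mu>) \<le> ennreal (C * \<epsilon> powr (p / (p + 1)))"
proof -
  \<comment> \<open>An auxiliary instance that names \<open>C0\<close> before
    \<open>\<epsilon>\<close> is fixed. \<open>q\<close>, \<open>\<theta>\<close> and
    \<open>C0\<close> depend on \<open>p\<close> alone and therefore coincide with those of the
    later instance \<open>B\<close>.\<close>
  interpret P: branching \<mu> p 1 0 by unfold_locales (use assms in auto)
  show thesis
  proof (rule that[OF P.C0_pos])
    fix \<epsilon> :: real assume \<epsilon>: "0 < \<epsilon>" "\<epsilon> < 1"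
    define e where "e = \<epsilon> powr (1 / (p + 1))"
    have e: "0 < e" "e < 1" using \<epsilon> p powr_less_mono2[of "1 / (p + 1)" \<epsilon> 1] by (auto simp: e_def)
    have ep: "e powr p = \<epsilon> powr (p / (p + 1))" by (simp add: e_def powr_powr)
    have \<epsilon>e: "e powr p * e = \<epsilon>"
    proof -
      have "e powr p * e = e powr (p + 1)" using e by (simp add: powr_add)
      also have "\<dots> = \<epsilon> powr 1" unfolding e_def powr_powr using p by simp
      finally show ?thesis using \<epsilon> by simp
    qed
    \<comment> \<open>Rounding up costs at most a factor \<open>2\<close>, because
      \<open>1 / e\<close> exceeds \<open>1\<close>.\<close>
    define n where "n = nat \<lceil>1 / e\<rceil>"
    have n: "1 / e \<le> real n" unfolding n_def by (rule real_nat_ceiling_ge)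
    have "1 < 1 / e" using e by simp
    then have "real n \<le> 1 / e + 1" unfolding n_def by linarith
    then have n2: "real n \<le> 2 / e" using \<open>1 < 1 / e\<close> by simp
    have n0: "0 < n" using n e by (cases n) auto
    \<comment> \<open>Minimality supplies the lower bound: one generation earlier the power of
      \<open>q\<close> is still above \<open>e\<close>, and \<open>N = 0\<close> is impossible
      because \<open>e < 1\<close>.\<close>
    define N where "N = (LEAST N. P.q ^ N \<le> e)"
    have "\<exists>N. P.q ^ N < e" using P.q e by (intro real_arch_pow_inv) auto
    then have "\<exists>N. P.q ^ N \<le> e" using less_imp_le by blast
    then have N1: "P.q ^ N \<le> e" unfolding N_def by (rule LeastI_ex)
    have N2: "P.q * e \<le> P.q ^ N"
    proof (cases N)
      case 0
      then show ?thesis using N1 e by simp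
    next
      case (Suc M)
      have "\<not> P.q ^ M \<le> e" using not_less_Least[of M "\<lambda>N. P.q ^ N \<le> e"] Suc N_def by auto
      then show ?thesis using Suc P.q by simp
    qed
    interpret B: branching \<mu> p n N by unfold_locales (use assms n0 in auto)
    have "min_energy p \<epsilon> (Fmat \<mu>) \<le> energy p \<epsilon> B.u"
      unfolding min_energy_def by (rule INF_lower[OF B.u_admissible])
    also have "\<dots> \<le> ennreal ((\<Sum>k\<le>N. B.c k powr p * B.\<theta> ^ k) + 2 powr p * B.\<theta> ^ N + \<epsilon> * (16 * B.V))"
      using \<epsilon> by (intro B.u_energy) auto
    also have "\<dots> \<le> ennreal (P.C0 * \<epsilon> powr (p / (p + 1)))"
      using B.energy_estimate[OF e n n2 N1 N2] unfolding \<epsilon>e unfolding ep by (rule ennreal_leI)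
    finally show "min_energy p \<epsilon> (Fmat \<mu>) \<le> ennreal (P.C0 * \<epsilon> powr (p / (p + 1)))" .
  qed
qed

section \<open>The lamination convex hull of the two wells\<close>

lemma Fmat_eq_iff: "Fmat a = Fmat b \<longleftrightarrow> a = b"
  by (metis Fmat_nth(1))

lemma Fmat_convex: "l *\<^sub>R Fmat a + (1 - l) *\<^sub>R Fmat b = Fmat (l * a + (1 - l) * b)"
  by (simp add: Fmat_def vec_eq_iff forall_2)

lemma rank_Fmat: 
  assumes "a \<noteq> 0" shows "rank (Fmat a) = 1"
proof -
  have "range (\<lambda>x. Fmat a *v x) = span {axis 1 1}"
  proof (intro equalityI subsetI)
    fix y assume "y \<in> range (\<lambda>x. Fmat a *v x)"
    then obtain x where "y = Fmat a *v x" by blast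
    then have "y = (a * x $ 1) *\<^sub>R axis 1 1" by (simp add: vec_eq_iff forall_2 axis_def)
    then show "y \<in> span {axis 1 1}" by (simp add: span_base span_scale)
  next
    fix y :: "real^2" assume "y \<in> span {axis 1 1}"
    then obtain r where "y = r *\<^sub>R axis 1 1" by (auto simp: span_singleton)
    then have "y = Fmat a *v axis 1 (r / a)" using assms by (simp add: vec_eq_iff forall_2 axis_def)
    then show "y \<in> range (\<lambda>x. Fmat a *v x)" by blast
  qed
  moreover have "dim {axis 1 1 :: real^2} = 1"
    by (rule dim_eq_card_independent[THEN trans]) (auto simp: axis_eq_0_iff)
  ultimately show ?thesis by (simp add: rank_dim_range)
qed

text \<open>The segment between the wells is convex, so it is stable under all convex combinations
  and in particular under those along rank-one directions.\<close>

lemma lam_step_K2: "lam_step K2 j \<subseteq> {Fmat \<mu> | \<mu>. \<bar>\<mu>\<bar> \<le> 1}"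
proof (induction j)
  case 0
  show ?case by (auto simp: K2_Fmat)
next
  case (Suc j)
  have cv: "\<bar>l * a + (1 - l) * b\<bar> \<le> 1" if "\<bar>a\<bar> \<le> 1" "\<bar>b\<bar> \<le> 1" "0 \<le> l" "l \<le> 1" for a b l :: real
  proof -
    have "\<bar>l * a + (1 - l) * b\<bar> \<le> l * \<bar>a\<bar> + (1 - l) * \<bar>b\<bar>"
      using that abs_triangle_ineq[of "l * a" "(1 - l) * b"] by (simp add: abs_mult)
    also have "\<dots> \<le> l * 1 + (1 - l) * 1" using that by (intro add_mono mult_left_mono) auto
    finally show ?thesis by simp
  qed
  show ?case
  proof
    fix A assume "A \<in> lam_step K2 (Suc j)"
    then consider "A \<in> lam_step K2 j" 
      | l X Y where "A = l *\<^sub>R X + (1 - l) *\<^sub>R Y" "X \<in> lam_step K2 j" "Y \<in> lam_step K2 j" "0 \<le> l" "l \<le> 1"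
      by auto
    then show "A \<in> {Fmat \<mu> | \<mu>. \<bar>\<mu>\<bar> \<le> 1}"
    proof cases
      case (2 l X Y)
      obtain a b where ab: "X = Fmat a" "Y = Fmat b" "\<bar>a\<bar> \<le> 1" "\<bar>b\<bar> \<le> 1" using Suc 2(2,3) by blast
      then show ?thesis using 2(1) cv[OF ab(3,4) 2(4,5)] by (auto simp: Fmat_convex)
    qed (use Suc in blast)
  qed
qed

lemma lam_hull_K2: "lam_hull K2 - K2 = {Fmat \<mu> | \<mu>. \<bar>\<mu>\<bar> < 1}"
proof (intro equalityI subsetI)
  fix A assume A: "A \<in> lam_hull K2 - K2"
  then obtain \<mu> where \<mu>: "A = Fmat \<mu>" "\<bar>\<mu>\<bar> \<le> 1" using lam_step_K2 by (auto simp: lam_hull_def)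
  moreover have "\<bar>\<mu>\<bar> \<noteq> 1" using A \<mu> by (auto simp: K2_Fmat abs_if split: if_splits)
  ultimately show "A \<in> {Fmat \<mu> | \<mu>. \<bar>\<mu>\<bar> < 1}" by force
next
  fix A assume "A \<in> {Fmat \<mu> | \<mu>. \<bar>\<mu>\<bar> < 1}"
  then obtain \<mu> where \<mu>: "A = Fmat \<mu>" "\<bar>\<mu>\<bar> < 1" by blast
  \<comment> \<open>The weight \<open>(1 + \<mu>) / 2\<close> produces the entry
    \<open>\<mu>\<close>; as the wells are rank-one connected, a single lamination step reaches the
    whole segment.\<close>
  have "A = ((1 + \<mu>) / 2) *\<^sub>R Fmat 1 + (1 - (1 + \<mu>) / 2) *\<^sub>R Fmat (-1)"
    unfolding Fmat_convex by (simp add: \<mu>(1) Fmat_eq_iff field_simps)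
  moreover have "Fmat 1 - Fmat (-1) = Fmat 2" by (simp add: Fmat_def vec_eq_iff forall_2)
  then have "rank (Fmat 1 - Fmat (-1)) = 1" by (simp add: rank_Fmat)
  moreover have "0 \<le> (1 + \<mu>) / 2" "(1 + \<mu>) / 2 \<le> 1" "Fmat 1 \<in> K2" "Fmat (-1) \<in> K2"
    using \<mu> by (auto simp: K2_Fmat)
  ultimately have "A \<in> lam_step K2 (Suc 0)" unfolding lam_step.simps by blast
  moreover have "A \<notin> K2" using \<mu> by (auto simp: K2_Fmat Fmat_eq_iff)
  ultimately show "A \<in> lam_hull K2 - K2" unfolding lam_hull_def by blast
qed

theorem theorem1:
  shows "lam_hull K2 - K2 = {vector [vector [\<mu>, 0], vector [0, 0]] | \<mu>::real. \<bar>\<mu>\<bar> < 1} \<and>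
    (\<forall>(p::real) (F::real^2^2). 1 \<le> p \<longrightarrow> F \<in> lam_hull K2 - K2 \<longrightarrow>
       (\<exists>c C::real. 0 < c \<and> c \<le> C \<and>
          (\<forall>\<epsilon>::real. 0 < \<epsilon> \<and> \<epsilon> < 1 \<longrightarrow>
             ennreal (c * \<epsilon> powr (p / (p + 1))) \<le> min_energy p \<epsilon> F \<and>
             min_energy p \<epsilon> F \<le> ennreal (C * \<epsilon> powr (p / (p + 1))))))"
proof (intro conjI allI impI)
  show "lam_hull K2 - K2 = {vector [vector [\<mu>, 0], vector [0, 0]] | \<mu>::real. \<bar>\<mu>\<bar> < 1}"
    using lam_hull_K2 by (simp only: Fmat_def)
  fix p :: real and F :: "real^2^2"
  assume p: "1 \<le> p" and "F \<in> lam_hull K2 - K2"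
  then obtain \<mu> where \<mu>: "F = Fmat \<mu>" "\<bar>\<mu>\<bar> < 1" unfolding lam_hull_K2 by blast
  obtain C where C: "0 < C" "\<And>\<epsilon>. 0 < \<epsilon> \<Longrightarrow> \<epsilon> < 1 \<Longrightarrow> min_energy p \<epsilon> F \<le> ennreal (C * \<epsilon> powr (p / (p + 1)))"
    using min_energy_upper_bound[OF p \<mu>(2)] unfolding \<mu>(1) by blast
  define c where "c = ((1 - \<bar>\<mu>\<bar>) / 600) powr p"
  have c: "0 < c" using \<mu>(2) by (simp add: c_def)
  have lower: "ennreal (c * \<epsilon> powr (p / (p + 1))) \<le> min_energy p \<epsilon> F" if "0 < \<epsilon>" "\<epsilon> < 1" for \<epsilon>
    unfolding min_energy_def c_def \<mu>(1) by (intro INF_greatest energy_lower_bound p \<mu>(2) that)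
  \<comment> \<open>Enlarging \<open>C\<close> to \<open>max c C\<close> secures the required order
    of the two constants.\<close>
  have upper: "min_energy p \<epsilon> F \<le> ennreal (max c C * \<epsilon> powr (p / (p + 1)))" if "0 < \<epsilon>" "\<epsilon> < 1" for \<epsilon>
    by (rule order_trans[OF C(2)[OF that]]) (intro ennreal_leI mult_right_mono, auto)
  show "\<exists>c C::real. 0 < c \<and> c \<le> C \<and>
          (\<forall>\<epsilon>::real. 0 < \<epsilon> \<and> \<epsilon> < 1 \<longrightarrow>
             ennreal (c * \<epsilon> powr (p / (p + 1))) \<le> min_energy p \<epsilon> F \<and>
             min_energy p \<epsilon> F \<le> ennreal (C * \<epsilon> powr (p / (p + 1))))"
    using c lower upper by (intro exI[of _ c] exI[of _ "max c C"]) auto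
qed

end
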